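(* Let $G=(L\cup R,E)$ be an undirected, unweighted bipartite graph with $n$ vertices and $m$ edges, $L$ the side with fewer vertices, with integer budgets $b_v\le|R|$ for $v\in L\cup R$. For every $\varepsilon>0$ there exists a shared-memory parallel algorithm for $(1-\varepsilon)$-approximate maximum cardinality bipartite $b$-matching that uses $O\!\left(\frac{\log^3 n}{\varepsilon^2}\right)$ depth and $O\!\left(\frac{m\log n}{\varepsilon^2}\right)$ total work.
   Context: A $b$-matching is a set $M\subseteq E$ such that each vertex $v$ is incident to at most $b_v$ edges of $M$; a maximum cardinality $b$-matching maximizes $|M|$, and a $(1-\varepsilon)$-approximation has at least $(1-\varepsilon)$ times that cardinality. Shared-memory work-depth model: work is the total number of operations, depth is the longest chain of sequential dependencies. *)

theory Defs
  imports Complex_Main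
begin

section \<open>Bipartite b-matchings\<close>

text \<open>An undirected edge of a bipartite graph is stored as the pair of its endpoint in L and its
  endpoint in R, so a set of such pairs is a simple bipartite graph.\<close>

definition bipartite_graph :: "'v set \<Rightarrow> 'v set \<Rightarrow> ('v \<times> 'v) set \<Rightarrow> bool" where
  "bipartite_graph L R E \<longleftrightarrow> finite L \<and> finite R \<and> L \<inter> R = {} \<and> E \<subseteq> L \<times> R"

definition incident :: "'v \<Rightarrow> 'v \<times> 'v \<Rightarrow> bool" where
  "incident v e \<longleftrightarrow> v = fst e \<or> v = snd e"

definition b_matching ::
  "'v set \<Rightarrow> 'v set \<Rightarrow> ('v \<times> 'v) set \<Rightarrow> ('v \<Rightarrow> nat) \<Rightarrow> ('v \<times> 'v) set \<Rightarrow> bool" where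
  "b_matching L R E b M \<longleftrightarrow> M \<subseteq> E \<and> (\<forall>v \<in> L \<union> R. card {e \<in> M. incident v e} \<le> b v)"

definition maximum_b_matching ::
  "'v set \<Rightarrow> 'v set \<Rightarrow> ('v \<times> 'v) set \<Rightarrow> ('v \<Rightarrow> nat) \<Rightarrow> ('v \<times> 'v) set \<Rightarrow> bool" where
  "maximum_b_matching L R E b M \<longleftrightarrow>
     b_matching L R E b M \<and> (\<forall>M'. b_matching L R E b M' \<longrightarrow> card M' \<le> card M)"

definition approx_maximum_b_matching ::
  "real \<Rightarrow> 'v set \<Rightarrow> 'v set \<Rightarrow> ('v \<times> 'v) set \<Rightarrow> ('v \<Rightarrow> nat) \<Rightarrow> ('v \<times> 'v) set \<Rightarrow> bool" where
  "approx_maximum_b_matching \<epsilon> L R E b M \<longleftrightarrow>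
     b_matching L R E b M \<and>
     (\<exists>M'. maximum_b_matching L R E b M' \<and> (1 - \<epsilon>) * real (card M') \<le> real (card M))"


section \<open>A shared-memory work-depth machine\<close>

text \<open>Programs run on a word RAM with unbounded fork-join parallelism. Every thread has private
  registers; all threads share one memory. Registers, memory cells and addresses are words of
  \<open>w\<close> bits, represented as natural numbers below \<open>2 ^ w\<close>.\<close>

type_synonym regs = "string \<Rightarrow> nat"
type_synonym memory = "nat \<Rightarrow> nat"

datatype binop = Add | Sub | Mul | Div | Mod | Less | Eq

datatype exp = Const nat | Reg string | Op binop exp exp

text \<open>Subtraction is truncated at 0, division by 0 yields 0, and comparisons yield 1 or 0.\<close>

fun apply_binop :: "binop \<Rightarrow> nat \<Rightarrow> nat \<Rightarrow> nat" where
  "apply_binop Add x y = x + y"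
| "apply_binop Sub x y = x - y"
| "apply_binop Mul x y = x * y"
| "apply_binop Div x y = x div y"
| "apply_binop Mod x y = x mod y"
| "apply_binop Less x y = (if x < y then 1 else 0)"
| "apply_binop Eq x y = (if x = y then 1 else 0)"

fun val :: "nat \<Rightarrow> exp \<Rightarrow> regs \<Rightarrow> nat" where
  "val w (Const k) s = k mod 2 ^ w"
| "val w (Reg x) s = s x"
| "val w (Op f e1 e2) s = apply_binop f (val w e1 s) (val w e2 s) mod 2 ^ w"

fun ops :: "exp \<Rightarrow> nat" where
  "ops (Const k) = 0"
| "ops (Reg x) = 0"
| "ops (Op f e1 e2) = 1 + ops e1 + ops e2"

datatype com =
    Skip
  | Assign string exp
  | Load string exp
  | Store exp exp
  | Seq com com
  | If exp com com
  | While exp com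
  | ParFor string exp com

text \<open>\<open>exec w c s m s' m' A B t d\<close>: started with registers \<open>s\<close> and memory \<open>m\<close>, the program \<open>c\<close>
  terminates with registers \<open>s'\<close> and memory \<open>m'\<close>, having read the cells \<open>A\<close> and written the cells
  \<open>B\<close>, using work \<open>t\<close> and depth \<open>d\<close>.

  \<open>ParFor x e c\<close> forks \<open>k\<close> threads, where \<open>k\<close> is the value of \<open>e\<close>; thread \<open>i\<close> runs \<open>c\<close> on its own
  copy of the registers, with \<open>x\<close> set to \<open>i\<close>. Each thread costs one operation in addition to its
  body. Cells may be read concurrently, but there is no execution if some thread accesses a cell
  that another thread of the same \<open>ParFor\<close> writes. Hence each thread may be run on the memory as it
  was at the fork: the result does not depend on how the threads are interleaved.\<close>

inductive exec ::
  "nat \<Rightarrow> com \<Rightarrow> regs \<Rightarrow> memory \<Rightarrow> regs \<Rightarrow> memory \<Rightarrow> nat set \<Rightarrow> nat set \<Rightarrow> nat \<Rightarrow> nat \<Rightarrow> bool"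
  for w :: nat where
  exec_Skip: "exec w Skip s m s m {} {} 0 0"
| exec_Assign:
    "exec w (Assign x e) s m (s(x := val w e s)) m {} {} (1 + ops e) (1 + ops e)"
| exec_Load:
    "exec w (Load x e) s m (s(x := m (val w e s))) m {val w e s} {} (1 + ops e) (1 + ops e)"
| exec_Store:
    "exec w (Store e1 e2) s m s (m(val w e1 s := val w e2 s)) {} {val w e1 s}
       (1 + ops e1 + ops e2) (1 + ops e1 + ops e2)"
| exec_Seq:
    "exec w c1 s m s1 m1 A1 B1 t1 d1 \<Longrightarrow> exec w c2 s1 m1 s2 m2 A2 B2 t2 d2 \<Longrightarrow>
     exec w (Seq c1 c2) s m s2 m2 (A1 \<union> A2) (B1 \<union> B2) (t1 + t2) (d1 + d2)"
| exec_If_true: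
    "val w e s \<noteq> 0 \<Longrightarrow> exec w c1 s m s' m' A B t d \<Longrightarrow>
     exec w (If e c1 c2) s m s' m' A B (1 + ops e + t) (1 + ops e + d)"
| exec_If_false:
    "val w e s = 0 \<Longrightarrow> exec w c2 s m s' m' A B t d \<Longrightarrow>
     exec w (If e c1 c2) s m s' m' A B (1 + ops e + t) (1 + ops e + d)"
| exec_While_false:
    "val w e s = 0 \<Longrightarrow> exec w (While e c) s m s m {} {} (1 + ops e) (1 + ops e)"
| exec_While_true:
    "val w e s \<noteq> 0 \<Longrightarrow> exec w c s m s1 m1 A1 B1 t1 d1 \<Longrightarrow>
     exec w (While e c) s1 m1 s2 m2 A2 B2 t2 d2 \<Longrightarrow>
     exec w (While e c) s m s2 m2 (A1 \<union> A2) (B1 \<union> B2)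
       (1 + ops e + t1 + t2) (1 + ops e + d1 + d2)"
| exec_ParFor:
    "k = val w e s \<Longrightarrow>
     (\<And>i. i < k \<Longrightarrow> exec w c (s(x := i)) m (S i) (M i) (A i) (B i) (t i) (d i)) \<Longrightarrow>
     (\<And>i j. i < k \<Longrightarrow> j < k \<Longrightarrow> i \<noteq> j \<Longrightarrow> B i \<inter> (A j \<union> B j) = {}) \<Longrightarrow>
     (\<And>i a. i < k \<Longrightarrow> a \<in> B i \<Longrightarrow> m' a = M i a) \<Longrightarrow>
     (\<And>a. a \<notin> (\<Union>i<k. B i) \<Longrightarrow> m' a = m a) \<Longrightarrow>
     exec w (ParFor x e c) s m s m' (\<Union>i<k. A i) (\<Union>i<k. B i)
       (1 + ops e + (\<Sum>i<k. 1 + t i))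
       (1 + ops e + Max (insert 0 ((\<lambda>i. 1 + d i) ` {..<k})))"

inductive_cases exec_SkipE: "exec w Skip s m s' m' A B t d"
inductive_cases exec_AssignE: "exec w (Assign x e) s m s' m' A B t d"
inductive_cases exec_LoadE: "exec w (Load x e) s m s' m' A B t d"
inductive_cases exec_StoreE: "exec w (Store e1 e2) s m s' m' A B t d"
inductive_cases exec_SeqE: "exec w (Seq c1 c2) s m s' m' A B t d"
inductive_cases exec_IfE: "exec w (If e c1 c2) s m s' m' A B t d"
inductive_cases exec_WhileE: "exec w (While e c) s m s' m' A B t d"
inductive_cases exec_ParForE: "exec w (ParFor x e c) s m s' m' A B t d"

lemma exec_deterministic:
  assumes "exec w c s m s1 m1 A1 B1 t1 d1" and "exec w c s m s2 m2 A2 B2 t2 d2"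
  shows "s1 = s2 \<and> m1 = m2 \<and> A1 = A2 \<and> B1 = B2 \<and> t1 = t2 \<and> d1 = d2"
  using assms
proof (induction arbitrary: s2 m2 A2 B2 t2 d2 rule: exec.induct)
  case (exec_Seq c1 s m s1 m1 A1 B1 t1 d1 c2 s2' m2' A2' B2' t2' d2')
  from exec_Seq.prems show ?case
  proof (rule exec_SeqE)
    fix s3 m3 A3 B3 t3 d3 A4 B4 t4 d4
    assume r: "A2 = A3 \<union> A4" "B2 = B3 \<union> B4" "t2 = t3 + t4" "d2 = d3 + d4"
      and 1: "exec w c1 s m s3 m3 A3 B3 t3 d3" and 2: "exec w c2 s3 m3 s2 m2 A4 B4 t4 d4"
    from exec_Seq.IH(1)[OF 1] 2 have "exec w c2 s1 m1 s2 m2 A4 B4 t4 d4" by simp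
    from exec_Seq.IH(1)[OF 1] exec_Seq.IH(2)[OF this] r show ?thesis by simp
  qed
next
  case (exec_If_true e s c1 m s' m' A B t d c2)
  from exec_If_true.prems show ?case
  proof (rule exec_IfE)
    fix t3 d3
    assume r: "t2 = Suc (ops e + t3)" "d2 = Suc (ops e + d3)"
      and 1: "exec w c1 s m s2 m2 A2 B2 t3 d3"
    from exec_If_true.IH[OF 1] r show ?thesis by simp
  qed (use exec_If_true.hyps in simp_all)
next
  case (exec_If_false e s c2 m s' m' A B t d c1)
  from exec_If_false.prems show ?case
  proof (rule exec_IfE)
    fix t3 d3
    assume r: "t2 = Suc (ops e + t3)" "d2 = Suc (ops e + d3)"
      and 1: "exec w c2 s m s2 m2 A2 B2 t3 d3"
    from exec_If_false.IH[OF 1] r show ?thesis by simp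
  qed (use exec_If_false.hyps in simp_all)
next
  case (exec_While_true e s c m s1 m1 A1 B1 t1 d1 s2' m2' A2' B2' t2' d2')
  from exec_While_true.prems show ?case
  proof (rule exec_WhileE)
    fix s3 m3 A3 B3 t3 d3 A4 B4 t4 d4
    assume r: "A2 = A3 \<union> A4" "B2 = B3 \<union> B4" "t2 = Suc (ops e + t3 + t4)" "d2 = Suc (ops e + d3 + d4)"
      and 1: "exec w c s m s3 m3 A3 B3 t3 d3" and 2: "exec w (While e c) s3 m3 s2 m2 A4 B4 t4 d4"
    from exec_While_true.IH(1)[OF 1] 2 have "exec w (While e c) s1 m1 s2 m2 A4 B4 t4 d4" by simp
    from exec_While_true.IH(1)[OF 1] exec_While_true.IH(2)[OF this] r show ?thesis by simp
  qed (use exec_While_true.hyps in simp)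
next
  case (exec_ParFor k e s c x m S M A B t d m')
  from exec_ParFor.prems obtain S' M' A' B' t' d' where
    eqs: "s2 = s" "A2 = (\<Union>i<k. A' i)" "B2 = (\<Union>i<k. B' i)"
      "t2 = 1 + ops e + (\<Sum>i<k. 1 + t' i)"
      "d2 = 1 + ops e + Max (insert 0 ((\<lambda>i. 1 + d' i) ` {..<k}))"
    and ex: "\<And>i. i < k \<Longrightarrow> exec w c (s(x := i)) m (S' i) (M' i) (A' i) (B' i) (t' i) (d' i)"
    and inB: "\<And>i a. i < k \<Longrightarrow> a \<in> B' i \<Longrightarrow> m2 a = M' i a"
    and notinB: "\<And>a. a \<notin> (\<Union>i<k. B' i) \<Longrightarrow> m2 a = m a"
    proof (rule exec_ParForE)
    fix S' M' A' B' t' d'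
    assume r1: "s2 = s" "A2 = (\<Union>i<val w e s. A' i)" "B2 = (\<Union>i<val w e s. B' i)"
      "t2 = Suc (ops e + (\<Sum>i<val w e s. Suc (t' i)))"
      "d2 = Suc (ops e + Max (insert 0 ((\<lambda>i. Suc (d' i)) ` {..<val w e s})))"
      and r2: "\<And>i. i < val w e s \<Longrightarrow> exec w c (s(x := i)) m (S' i) (M' i) (A' i) (B' i) (t' i) (d' i)"
      and r3: "\<And>i a. i < val w e s \<Longrightarrow> a \<in> B' i \<Longrightarrow> m2 a = M' i a"
      and r4: "\<And>a. \<forall>i\<in>{..<val w e s}. a \<notin> B' i \<Longrightarrow> m2 a = m a"
    note k = exec_ParFor.hyps(1)
    show thesis
    proof (rule that[of A' B' t' d' S' M'])
      show "s2 = s" by (fact r1)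
      show "A2 = (\<Union>i<k. A' i)" "B2 = (\<Union>i<k. B' i)"
        "t2 = 1 + ops e + (\<Sum>i<k. 1 + t' i)"
        "d2 = 1 + ops e + Max (insert 0 ((\<lambda>i. 1 + d' i) ` {..<k}))"
        using r1 k by simp_all
      show "exec w c (s(x := i)) m (S' i) (M' i) (A' i) (B' i) (t' i) (d' i)" if "i < k" for i
        using that unfolding k by (rule r2)
      show "m2 a = M' i a" if "i < k" "a \<in> B' i" for i a
        using that unfolding k by (rule r3)
      show "m2 a = m a" if "a \<notin> (\<Union>i<k. B' i)" for a
        by (rule r4) (use that k in blast)
    qed
  qed
  have same: "M i = M' i \<and> A i = A' i \<and> B i = B' i \<and> t i = t' i \<and> d i = d' i" if "i < k" for i
    using exec_ParFor.IH[OF that ex[OF that]] by blast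
  have un: "(\<Union>i<k. A i) = A2" "(\<Union>i<k. B i) = B2"
    using same unfolding eqs by auto
  have "m' a = m2 a" for a
  proof (cases "a \<in> (\<Union>i<k. B i)")
    case True
    then obtain i where i: "i < k" "a \<in> B i" by blast
    then have "m' a = M i a" by (rule exec_ParFor.hyps)
    moreover have "m2 a = M' i a" using inB i same by blast
    ultimately show ?thesis using same i by simp
  next
    case False
    then have "m' a = m a" by (rule exec_ParFor.hyps)
    moreover have "m2 a = m a" by (rule notinB) (use False un(2) eqs(3) in simp)
    ultimately show ?thesis by simp
  qed
  then have "m' = m2" by blast
  moreover have "(\<Sum>i<k. 1 + t i) = (\<Sum>i<k. 1 + t' i)"
    using same by (intro sum.cong) auto
  moreover have "(\<lambda>i. 1 + d i) ` {..<k} = (\<lambda>i. 1 + d' i) ` {..<k}"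
    using same by (intro image_cong) auto
  ultimately show ?case using un eqs by presburger
qed (auto elim: exec_SkipE exec_AssignE exec_LoadE exec_StoreE exec_WhileE)


section \<open>Input and output\<close>

text \<open>The vertices are \<open>0, \<dots>, n - 1\<close>, and the edges are given as a list in arbitrary order. Registers
  \<open>n\<close> and \<open>m\<close> hold the numbers of vertices and edges; cells \<open>2 * i\<close> and \<open>2 * i + 1\<close> hold the endpoints
  in L and R of the \<open>i\<close>-th edge, and cell \<open>2 * m + v\<close> holds the budget of the vertex \<open>v\<close>.
  All other registers and cells are 0.\<close>

definition input_regs :: "nat \<Rightarrow> (nat \<times> nat) list \<Rightarrow> regs" where
  "input_regs n es = (\<lambda>_. 0)(''n'' := n, ''m'' := length es)"

definition input_mem :: "nat \<Rightarrow> (nat \<times> nat) list \<Rightarrow> (nat \<Rightarrow> nat) \<Rightarrow> memory" where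
  "input_mem n es b a =
     (if a < 2 * length es then (if even a then fst (es ! (a div 2)) else snd (es ! (a div 2)))
      else if a < 2 * length es + n then b (a - 2 * length es)
      else 0)"

text \<open>The \<open>i\<close>-th edge is selected by a nonzero value in the \<open>i\<close>-th cell after the input.\<close>

definition output_edges :: "nat \<Rightarrow> (nat \<times> nat) list \<Rightarrow> memory \<Rightarrow> (nat \<times> nat) set" where
  "output_edges n es mem = {es ! i | i. i < length es \<and> mem (2 * length es + n + i) \<noteq> 0}"

text \<open>Words have logarithmically many bits in the number of vertices; every larger word size must
  work too. In the cost bounds, the maximum with 1 only matters if the graph has no edge (so that
  the bound on the work would be 0) or \<open>\<epsilon>\<close> is larger than 1: no program is asked to run in less
  than a constant number of steps.\<close>

definition parallel_approx_b_matching_alg :: "real \<Rightarrow> real \<Rightarrow> com \<Rightarrow> bool" where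
  "parallel_approx_b_matching_alg C \<epsilon> P \<longleftrightarrow>
     (\<forall>w n L R E b es.
        bipartite_graph L R E \<and> L \<union> R = {..<n} \<and> card L \<le> card R \<and>
        (\<forall>v \<in> L \<union> R. b v \<le> card R) \<and>
        distinct es \<and> set es = E \<and>
        C * log 2 (real n + 2) \<le> real w
        \<longrightarrow>
        (\<exists>s' mem' A B work depth.
           exec w P (input_regs n es) (input_mem n es b) s' mem' A B work depth \<and>
           approx_maximum_b_matching \<epsilon> L R E b (output_edges n es mem') \<and>
           real depth \<le> C * max 1 (log 2 (real n) ^ 3 / \<epsilon>\<^sup>2) \<and>
           real work \<le> C * max 1 (real (card E) * log 2 (real n) / \<epsilon>\<^sup>2)))"

end

theory Submission
  imports Defs
begin

text \<open>A fractional solution is found by adjusting integer levels. Every edge \<open>uv\<close> carries the value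
  \<open>(1 - 1/D) ^ (w0 + lev v - lev u)\<close> (capped at 1, and rounded in fixed point), where \<open>D\<close> is of order
  \<open>1 / \<epsilon>\<close>. In each round, overloaded vertices of R go up one level, then the vertices of L go up if
  this does not overload them. After \<open>O(log n / \<epsilon>\<^sup>2)\<close> rounds every vertex of L that did not go up in
  all rounds and every vertex of R that went up at least once is almost saturated. Cutting the
  levels at one of \<open>D\<close> thresholds gives a solution of the dual (a vertex cover with slack edges)
  whose value is matched up to a factor \<open>1 - O(\<epsilon>)\<close>, because only edges with a level just above
  the threshold violate complementary slackness, and for some threshold they carry little value.

  The solution is then rounded to multiples of \<open>2 ^ - k\<close>, and the last bit is removed \<open>k\<close> times. The
  edges with last bit 1 are paired at every vertex; along the resulting paths and cycles they are
  rounded up and down alternately, which keeps all loads feasible as the budgets are integral. The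
  alternation comes from the minima of the orbits of a permutation, found by pointer jumping; this
  costs a factor \<open>log n\<close>, but the numbers of such edges form a geometric series.

  If \<open>\<epsilon>\<close> is tiny compared with \<open>n\<close>, then \<open>D\<close> is capped at \<open>6 N\<^sup>2\<close>, which already makes the result
  exact and keeps all numbers polynomial in \<open>n\<close>.\<close>

section \<open>Symbolic execution and Hoare-style rules that bound work and depth\<close>

section \<open>Cost-aware program logic\<close>

text \<open>The machine admits no concurrent writes, so a vertex cannot collect its load from its
  edges directly: the edges are sorted once by either endpoint, loads are differences of prefix
  sums, and the first edge of a segment acts for its vertex. A round of level changes thus costs
  linear work and logarithmic depth, and \<open>6 * D * D * lg\<close> rounds fit the bounds. The
  delicate point is the work of the rounding, where pointer jumping costs a factor
  \<open>log n\<close> per odd edge. An odd edge carries at least one unit, so there are at most as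
  many as the value of the solution counted in the current unit. The first unit is therefore chosen
  from the value itself: the value is about \<open>m * D\<close> units, enough for the loss of under
  one unit on each of \<open>m\<close> edges to be a fraction \<open>1 / D\<close>, and so few that
  the odd edges of all rounds together number O(m D). The levels lose a fraction
  \<open>5 / D\<close> and this truncation \<open>1 / D\<close>, while the halvings lose nothing,
  whence \<open>D\<close> is the ceiling of \<open>6 / \<epsilon>\<close>, unless it is
  capped.\<close>

fun nval :: "exp \<Rightarrow> regs \<Rightarrow> nat" where
  "nval (Const k) s = k"
| "nval (Reg x) s = s x"
| "nval (Op f e1 e2) s = apply_binop f (nval e1 s) (nval e2 s)"

fun leaves :: "exp \<Rightarrow> nat" where
  "leaves (Const k) = 1"
| "leaves (Reg x) = 1"
| "leaves (Op f e1 e2) = leaves e1 + leaves e2"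

fun consts_le :: "nat \<Rightarrow> exp \<Rightarrow> bool" where
  "consts_le b (Const k) = (k \<le> b)"
| "consts_le b (Reg x) = True"
| "consts_le b (Op f e1 e2) = (consts_le b e1 \<and> consts_le b e2)"

text \<open>The two bounds make machine arithmetic exact: if all registers are at most
  \<open>X\<close> with \<open>64 \<le> X\<close> and \<open>X ^ 40 < 2 ^ w\<close>, such an
  expression and its subexpressions evaluate below \<open>2 ^ w\<close>, so the reduction modulo the
  word size in \<open>val\<close> never acts and \<open>nval\<close> may replace it.\<close>

definition small_exp :: "exp \<Rightarrow> bool" where
  "small_exp e \<longleftrightarrow> leaves e \<le> 40 \<and> consts_le 64 e"

lemma leaves_pos: "0 < leaves e"
  by (induction e) auto

lemma ops_leaves: "ops e + 1 = leaves e"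
  by (induction e) auto

text \<open>Multiplication grows fastest once both bounds are at least 2, because then p + q \<le> p
  * q; so every leaf contributes at most one factor \<open>X\<close>, whatever the operations
  are.\<close>

lemma nval_le:
  assumes "\<And>x. s x \<le> X" "consts_le b e" "b \<le> X" "2 \<le> X"
  shows "nval e s \<le> X ^ leaves e"
  using assms(2)
proof (induction e)
  case (Op f e1 e2)
  let ?x = "nval e1 s" and ?y = "nval e2 s" and ?p = "X ^ leaves e1" and ?q = "X ^ leaves e2"
  have xy: "?x \<le> ?p" "?y \<le> ?q" using Op by auto
  have "X ^ 1 \<le> ?p" "X ^ 1 \<le> ?q"
    using leaves_pos[of e1] leaves_pos[of e2] assms(4) by (auto intro: self_le_power)
  then have "2 \<le> ?p" "2 \<le> ?q" using assms(4) by auto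
  then obtain p' q' where pq: "?p = 2 + p'" "?q = 2 + q'"
    by (metis nat_le_iff_add)
  have sum: "?p + ?q \<le> ?p * ?q"
    unfolding pq by (simp add: algebra_simps)
  have "apply_binop f ?x ?y \<le> ?p * ?q"
  proof (cases f)
    case Mul
    then show ?thesis using xy by (simp add: mult_le_mono)
  next
    case Div
    have "?x div ?y \<le> ?x" by simp
    then have "?x div ?y \<le> ?p * ?q" using xy sum by linarith
    then show ?thesis using Div by simp
  next
    case Mod
    have "?x mod ?y \<le> ?x" by simp
    then have "?x mod ?y \<le> ?p * ?q" using xy sum by linarith
    then show ?thesis using Mod by simp
  qed (use xy sum \<open>2 \<le> ?p\<close> \<open>2 \<le> ?q\<close> in auto)
  then show ?case by (simp add: power_add)
qed (use assms in auto)

fun arr :: "nat \<Rightarrow> exp \<Rightarrow> exp" where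
  "arr r e = (if r = 32 then e else Op Add (Reg ''z'') (Op Add (Const r) (Op Mul (Const 32) e)))"

definition adr :: "nat \<Rightarrow> nat \<Rightarrow> nat \<Rightarrow> nat" where
  "adr z r i = (if r = 32 then i else z + (r + 32 * i))"

text \<open>The memory above the cell \<open>z\<close> is seen as 32 interleaved arrays; the cells below \<open>z\<close> (the input
  and the output) form the array number 32.\<close>

definition view :: "nat \<Rightarrow> memory \<Rightarrow> nat \<Rightarrow> nat \<Rightarrow> nat" where
  "view z m r i = (if r < 32 \<or> r = 32 \<and> i < z then m (adr z r i) else 0)"

text \<open>Above \<open>z\<close> the remainder modulo 32 recovers the array and the quotient the
  index; the raw cells of array 32 lie below \<open>z\<close>.\<close>

lemma adr_inj:
  assumes "adr z r i = adr z r' i'" "r \<le> 32" "r' \<le> 32" "r = 32 \<longrightarrow> i < z" "r' = 32 \<longrightarrow> i' < z"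
  shows "r = r' \<and> i = i'"
proof -
  have aux: "a = c \<and> b = d" if "a + 32 * b = c + 32 * d" "a < 32" "c < 32" for a b c d :: nat
  proof -
    have "(a + 32 * b) mod 32 = a" "(c + 32 * d) mod 32 = c" using that(2,3) by simp_all
    then have "a = c" using that(1) by metis
    then show ?thesis using that(1) by simp
  qed
  show ?thesis
  proof (cases "r = 32 \<or> r' = 32")
    case True
    then show ?thesis using assms by (auto simp: adr_def split: if_splits)
  next
    case False
    then show ?thesis using assms aux[of r i r' i'] by (auto simp: adr_def)
  qed
qed

type_synonym load = "string \<times> nat \<times> exp"
type_synonym store = "exp \<times> nat \<times> exp \<times> exp"

text \<open>The only form of thread that is ever forked: loads, whose addresses may depend on
  earlier loads, and then at most one guarded store. With a single store per thread, freedom from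
  races reduces to one injectivity and one disjointness condition.\<close>

fun body :: "load list \<Rightarrow> store \<Rightarrow> com" where
  "body [] (c, r, e1, e2) = If c (Store (arr r e1) e2) Skip"
| "body ((x, r, e) # ls) st = Seq (Load x (arr r e)) (body ls st)"

text \<open>A thread writes nothing before its final store, so the arrays \<open>a\<close> seen by
  its loads stay fixed and the loads can be evaluated symbolically.\<close>

fun lsem :: "load list \<Rightarrow> regs \<Rightarrow> (nat \<Rightarrow> nat \<Rightarrow> nat) \<Rightarrow> regs" where
  "lsem [] s a = s"
| "lsem ((x, r, e) # ls) s a = lsem ls (s(x := a r (nval e s))) a"

fun lreads :: "load list \<Rightarrow> regs \<Rightarrow> (nat \<Rightarrow> nat \<Rightarrow> nat) \<Rightarrow> (nat \<times> nat) list" where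
  "lreads [] s a = []"
| "lreads ((x, r, e) # ls) s a = (r, nval e s) # lreads ls (s(x := a r (nval e s))) a"

fun loads_ok :: "load list \<Rightarrow> bool" where
  "loads_ok [] = True"
| "loads_ok ((x, r, e) # ls) = (x \<noteq> ''z'' \<and> r \<le> 32 \<and> small_exp (arr r e) \<and> loads_ok ls)"

fun loads_cost :: "load list \<Rightarrow> nat" where
  "loads_cost [] = 0"
| "loads_cost ((x, r, e) # ls) = 4 + ops e + loads_cost ls"

fun store_ok :: "store \<Rightarrow> bool" where
  "store_ok (c, r, e1, e2) = (r \<le> 32 \<and> small_exp c \<and> small_exp (arr r e1) \<and> small_exp e2)"

fun store_cost :: "store \<Rightarrow> nat" where
  "store_cost (c, r, e1, e2) = 5 + ops c + ops e1 + ops e2"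

text \<open>With one more step for the fork, a thread costs at most 99. Evaluating the number k of
  threads costs at most 40, so the total is at most 40 + 99 * k in work and 139 in depth; this is
  the origin of 100 * (k + 1) and 200 in \<open>runs_ParFor\<close>. The constants 4 and 5 in the
  costs contain the three operations of an array address.\<close>

definition body_ok :: "load list \<Rightarrow> store \<Rightarrow> bool" where
  "body_ok ls st \<longleftrightarrow> loads_ok ls \<and> store_ok st \<and> loads_cost ls + store_cost st \<le> 98"

locale machine =
  fixes w X z :: nat
  assumes X_ge: "64 \<le> X" and X_word: "X ^ 40 < 2 ^ w"
begin

definition bounded :: "regs \<Rightarrow> memory \<Rightarrow> bool" where
  "bounded s m \<longleftrightarrow> (\<forall>x. s x \<le> X) \<and> (\<forall>a. m a \<le> X) \<and> s ''z'' = z"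

lemma val_eq_aux:
  assumes "\<And>x. s x \<le> X" "leaves e \<le> 40" "consts_le 64 e"
  shows "val w e s = nval e s"
proof -
  have lt: "nval e s < 2 ^ w" if "leaves e \<le> 40" "consts_le 64 e" for e
  proof -
    have "nval e s \<le> X ^ leaves e" using nval_le[of s X 64 e] assms(1) that X_ge by auto
    also have "\<dots> \<le> X ^ 40" using that X_ge by (intro power_increasing) auto
    finally show ?thesis using X_word by simp
  qed
  show ?thesis using assms(2,3)
  proof (induction e)
    case (Const k)
    then show ?case using lt[of "Const k"] by simp
  next
    case (Op f e1 e2)
    then show ?case using lt[of "Op f e1 e2"] by simp
  qed simp
qed

lemma val_eq: "bounded s m \<Longrightarrow> small_exp e \<Longrightarrow> val w e s = nval e s"
  by (rule val_eq_aux) (auto simp: bounded_def small_exp_def)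

lemma nval_arr: "bounded s m \<Longrightarrow> nval (arr r e) s = adr z r (nval e s)"
  by (auto simp: bounded_def adr_def)

lemma view_adr: "r \<le> 32 \<Longrightarrow> r = 32 \<longrightarrow> i < z \<Longrightarrow> m (adr z r i) = view z m r i"
  by (auto simp: view_def)

text \<open>Reads are bounded from above only, which is enough to exclude races; a thread is
  sequential, so its work equals its depth.\<close>

lemma exec_body:
  assumes "bounded s m" "loads_ok ls" "store_ok st" "st = (c, r, e1, e2)"
    and "\<forall>(r, j) \<in> set (lreads ls s (view z m)). r = 32 \<longrightarrow> j < z"
  shows "\<exists>A B t. exec w (body ls st) s m (lsem ls s (view z m))
      (if nval c (lsem ls s (view z m)) \<noteq> 0
       then m(adr z r (nval e1 (lsem ls s (view z m))) := nval e2 (lsem ls s (view z m))) else m) A B t t \<and>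
      A \<subseteq> (\<lambda>(r, j). adr z r j) ` set (lreads ls s (view z m)) \<and>
      B = (if nval c (lsem ls s (view z m)) \<noteq> 0 then {adr z r (nval e1 (lsem ls s (view z m)))} else {}) \<and>
      t \<le> loads_cost ls + store_cost st"
  using assms(1,2,5)
proof (induction ls arbitrary: s)
  case Nil
  have ops: "ops (arr r e1) \<le> 3 + ops e1" by auto
  have v: "val w c s = nval c s" "val w (arr r e1) s = adr z r (nval e1 s)" "val w e2 s = nval e2 s"
    using val_eq[OF Nil(1)] nval_arr[OF Nil(1)] assms(3,4) by (auto simp del: arr.simps)
  show ?case
  proof (cases "nval c s = 0")
    case True
    then have "exec w (body [] st) s m s m {} {} (1 + ops c + 0) (1 + ops c + 0)"
      unfolding assms(4) body.simps by (intro exec_If_false exec_Skip) (simp add: v)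
    with True show ?thesis by (auto simp: assms(4) simp del: body.simps intro!: exI)
  next
    case False
    have E: "exec w (body [] st) s m s (m(val w (arr r e1) s := val w e2 s)) {} {val w (arr r e1) s}
       (1 + ops c + (1 + ops (arr r e1) + ops e2)) (1 + ops c + (1 + ops (arr r e1) + ops e2))"
      unfolding assms(4) body.simps
      by (intro exec_If_true exec_Store) (simp add: v False)
    have le: "1 + ops c + (1 + ops (arr r e1) + ops e2) \<le> loads_cost [] + store_cost st"
      using ops by (simp add: assms(4) del: arr.simps)
    show ?thesis unfolding lsem.simps if_P[OF False]
      by (rule exI[of _ "{}"], rule exI, rule exI, intro conjI, rule E[unfolded v], simp, simp, rule le)
  qed
next
  case (Cons l ls)
  obtain x q e where l: "l = (x, q, e)" by (cases l) auto
  let ?s = "s(x := view z m q (nval e s))"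
  have ok: "x \<noteq> ''z''" "q \<le> 32" "small_exp (arr q e)" "loads_ok ls" "q = 32 \<longrightarrow> nval e s < z"
    using Cons.prems by (auto simp: l simp del: arr.simps)
  have m: "m (adr z q (nval e s)) = view z m q (nval e s)" using ok by (intro view_adr) auto
  have b: "bounded ?s m" using Cons.prems(1) ok(1) m[symmetric] by (auto simp: bounded_def)
  have v: "val w (arr q e) s = adr z q (nval e s)"
    using val_eq[OF Cons.prems(1)] nval_arr[OF Cons.prems(1)] ok by (auto simp del: arr.simps)
  have "\<forall>(r, j)\<in>set (lreads ls ?s (view z m)). r = 32 \<longrightarrow> j < z"
    using Cons.prems(3) by (auto simp: l)
  from Cons.IH[OF b ok(4) this] obtain A B t where IH:
     "exec w (body ls st) ?s m (lsem ls ?s (view z m))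
      (if nval c (lsem ls ?s (view z m)) \<noteq> 0
       then m(adr z r (nval e1 (lsem ls ?s (view z m))) := nval e2 (lsem ls ?s (view z m))) else m) A B t t"
      "A \<subseteq> (\<lambda>(r, j). adr z r j) ` set (lreads ls ?s (view z m))"
      "B = (if nval c (lsem ls ?s (view z m)) \<noteq> 0 then {adr z r (nval e1 (lsem ls ?s (view z m)))} else {})"
      "t \<le> loads_cost ls + store_cost st" by blast
  have ld: "exec w (Load x (arr q e)) s m ?s m {adr z q (nval e s)} {} (1 + ops (arr q e)) (1 + ops (arr q e))"
    using exec_Load[of w x "arr q e" s m] unfolding v m .
  have "ops (arr q e) \<le> 3 + ops e" by auto
  with exec_Seq[OF ld IH(1)] IH(2-4) show ?case unfolding l lsem.simps
    by (intro exI[of _ "{adr z q (nval e s)} \<union> A"] exI[of _ B] exI[of _ "1 + ops (arr q e) + t"])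
       (auto simp del: arr.simps)
qed

text \<open>Total correctness with upper bounds on work and depth, over the array view of the
  memory. The sets of accessed cells are dropped: they matter only inside \<open>ParFor\<close>,
  whose threads all have the form \<open>body\<close>, and there \<open>exec_body\<close> supplies
  them. The bound on all words is carried along as an invariant.\<close>

definition runs :: "com \<Rightarrow> regs \<Rightarrow> (nat \<Rightarrow> nat \<Rightarrow> nat) \<Rightarrow> nat \<Rightarrow> nat \<Rightarrow>
    (regs \<Rightarrow> (nat \<Rightarrow> nat \<Rightarrow> nat) \<Rightarrow> bool) \<Rightarrow> bool" where
  "runs c s a t d Q \<longleftrightarrow> (\<forall>m. bounded s m \<and> view z m = a \<longrightarrow>
     (\<exists>s' m' A B t' d'. exec w c s m s' m' A B t' d' \<and> t' \<le> t \<and> d' \<le> d \<and>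
        bounded s' m' \<and> Q s' (view z m')))"

lemma runs_mono:
  assumes "runs c s a t d Q" "t \<le> t'" "d \<le> d'" "\<And>s a. Q s a \<Longrightarrow> Q' s a"
  shows "runs c s a t' d' Q'"
  unfolding runs_def
proof (intro allI impI)
  fix m assume "bounded s m \<and> view z m = a"
  with assms(1) obtain s' m' A B t1 d1 where "exec w c s m s' m' A B t1 d1" "t1 \<le> t" "d1 \<le> d"
    "bounded s' m'" "Q s' (view z m')" unfolding runs_def by blast
  with assms(2-) show "\<exists>s' m' A B t1 d1. exec w c s m s' m' A B t1 d1 \<and> t1 \<le> t' \<and> d1 \<le> d' \<and>
        bounded s' m' \<and> Q' s' (view z m')"
    by (meson order_trans)
qed

lemma runs_Skip: "Q s a \<Longrightarrow> runs Skip s a t d Q"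
  unfolding runs_def using exec_Skip by fastforce

lemma runs_Seq:
  assumes "runs c s a ta da P" "\<And>s a. P s a \<Longrightarrow> runs c' s a tb db Q" "ta + tb \<le> t" "da + db \<le> d"
  shows "runs (Seq c c') s a t d Q"
  unfolding runs_def
proof (intro allI impI)
  fix m assume "bounded s m \<and> view z m = a"
  with assms(1) obtain s' m' A B t' d' where 1: "exec w c s m s' m' A B t' d'" "t' \<le> ta" "d' \<le> da"
    "bounded s' m'" "P s' (view z m')" unfolding runs_def by blast
  with assms(2)[OF 1(5)] obtain s'' m'' A' B' t'' d'' where 2: "exec w c' s' m' s'' m'' A' B' t'' d''"
    "t'' \<le> tb" "d'' \<le> db" "bounded s'' m''" "Q s'' (view z m'')" unfolding runs_def by blast
  show "\<exists>s' m' A B t' d'. exec w (Seq c c') s m s' m' A B t' d' \<and> t' \<le> t \<and> d' \<le> d \<and>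
        bounded s' m' \<and> Q s' (view z m')"
    using exec_Seq[OF 1(1) 2(1)] 1 2 assms(3,4)
    by (metis add_le_mono order_trans)
qed

lemma runs_Assign:
  assumes "small_exp e" "x \<noteq> ''z''" "nval e s \<le> X" "Q (s(x := nval e s)) a" "40 \<le> t" "40 \<le> d"
  shows "runs (Assign x e) s a t d Q"
  unfolding runs_def
proof (intro allI impI)
  fix m assume b: "bounded s m \<and> view z m = a"
  then have v: "val w e s = nval e s" using val_eq assms by blast
  have o: "1 + ops e \<le> 40" using assms(1) ops_leaves[of e] by (simp add: small_exp_def)
  show "\<exists>s' m' A B t' d'. exec w (Assign x e) s m s' m' A B t' d' \<and> t' \<le> t \<and> d' \<le> d \<and>
        bounded s' m' \<and> Q s' (view z m')"
    using exec_Assign[of w x e s m] o assms b unfolding v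
    by (intro exI[of _ "s(x := nval e s)"] exI[of _ m] exI[of _ "{}"] exI[of _ "1 + ops e"])
       (auto simp: bounded_def)
qed

lemma runs_Load:
  assumes "small_exp (arr r e)" "x \<noteq> ''z''" "r < 32" "Q (s(x := a r (nval e s))) a" "40 \<le> t" "40 \<le> d"
  shows "runs (Load x (arr r e)) s a t d Q"
  unfolding runs_def
proof (intro allI impI)
  fix m assume b: "bounded s m \<and> view z m = a"
  then have v: "val w (arr r e) s = adr z r (nval e s)" using val_eq assms nval_arr by metis
  have m: "m (adr z r (nval e s)) = a r (nval e s)" using b view_adr[of r "nval e s" m] assms(3) by auto
  have o: "1 + ops (arr r e) \<le> 40" using assms(1) ops_leaves[of "arr r e"] by (simp add: small_exp_def)
  show "\<exists>s' m' A B t' d'. exec w (Load x (arr r e)) s m s' m' A B t' d' \<and> t' \<le> t \<and> d' \<le> d \<and>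
        bounded s' m' \<and> Q s' (view z m')"
  proof -
    have "bounded (s(x := a r (nval e s))) m"
      using b assms(2) m[symmetric] by (auto simp: bounded_def)
    moreover have "Q (s(x := a r (nval e s))) (view z m)" using assms(4) b by simp
    moreover have "1 + ops (arr r e) \<le> t" "1 + ops (arr r e) \<le> d" using o assms by auto
    ultimately show ?thesis using exec_Load[of w x "arr r e" s m] unfolding v m by blast
  qed
qed

lemma runs_If:
  assumes "small_exp e" "nval e s \<noteq> 0 \<Longrightarrow> runs c1 s a t d Q" "nval e s = 0 \<Longrightarrow> runs c2 s a t d Q"
    "40 + t \<le> t'" "40 + d \<le> d'"
  shows "runs (If e c1 c2) s a t' d' Q"
  unfolding runs_def
proof (intro allI impI)
  fix m assume b: "bounded s m \<and> view z m = a"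
  then have v: "val w e s = nval e s" using val_eq assms by blast
  have o: "1 + ops e \<le> 40" using assms(1) ops_leaves[of e] by (simp add: small_exp_def)
  show "\<exists>s' m' A B t d. exec w (If e c1 c2) s m s' m' A B t d \<and> t \<le> t' \<and> d \<le> d' \<and>
        bounded s' m' \<and> Q s' (view z m')"
  proof (cases "nval e s = 0")
    case True
    with assms(3) b obtain s' m' A B t1 d1 where 1: "exec w c2 s m s' m' A B t1 d1" "t1 \<le> t" "d1 \<le> d"
      "bounded s' m'" "Q s' (view z m')" unfolding runs_def by blast
    have "1 + ops e + t1 \<le> t'" "1 + ops e + d1 \<le> d'" using 1 o assms by auto
    moreover have "exec w (If e c1 c2) s m s' m' A B (1 + ops e + t1) (1 + ops e + d1)"
      using exec_If_false[OF _ 1(1)] v True by simp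
    ultimately show ?thesis using 1 by blast
  next
    case False
    with assms(2) b obtain s' m' A B t1 d1 where 1: "exec w c1 s m s' m' A B t1 d1" "t1 \<le> t" "d1 \<le> d"
      "bounded s' m'" "Q s' (view z m')" unfolding runs_def by blast
    have "1 + ops e + t1 \<le> t'" "1 + ops e + d1 \<le> d'" using 1 o assms by auto
    moreover have "exec w (If e c1 c2) s m s' m' A B (1 + ops e + t1) (1 + ops e + d1)"
      using exec_If_true[OF _ 1(1)] v False by simp
    ultimately show ?thesis using 1 by blast
  qed
qed

text \<open>The invariant is indexed by the number of completed iterations, and their total number
  \<open>k\<close> is fixed in advance. This allows cost bounds that vary between iterations; prefix
  sums and rounding need it, as their costs form geometric series.\<close>

lemma runs_While:
  assumes "small_exp e" "I 0 s a"
    and step: "\<And>j s a. j < k \<Longrightarrow> I j s a \<Longrightarrow> nval e s \<noteq> 0 \<and> runs c s a (tb j) (db j) (I (Suc j))"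
    and exit: "\<And>s a. I k s a \<Longrightarrow> nval e s = 0 \<and> Q s a"
    and "(\<Sum>j<k. tb j) + 40 * (k + 1) \<le> t" "(\<Sum>j<k. db j) + 40 * (k + 1) \<le> d"
  shows "runs (While e c) s a t d Q"
proof -
  have o: "1 + ops e \<le> 40" using assms(1) ops_leaves[of e] by (simp add: small_exp_def)
  have main: "runs (While e c) s a ((\<Sum>j=i..<k. tb j) + 40 * (k - i + 1)) ((\<Sum>j=i..<k. db j) + 40 * (k - i + 1)) Q"
    if "i \<le> k" "I i s a" for i s a
    using that
  proof (induction "k - i" arbitrary: i s a)
    case 0
    then have i: "i = k" by simp
    show ?case unfolding runs_def
    proof (intro allI impI)
      fix m assume b: "bounded s m \<and> view z m = a"
      then have v: "val w e s = 0" using val_eq[of s m e] assms(1) exit 0 i by auto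
      show "\<exists>s' m' A B t d. exec w (While e c) s m s' m' A B t d \<and>
          t \<le> (\<Sum>j=i..<k. tb j) + 40 * (k - i + 1) \<and> d \<le> (\<Sum>j=i..<k. db j) + 40 * (k - i + 1) \<and>
        bounded s' m' \<and> Q s' (view z m')"
        using exec_While_false[OF v, of c m] o b exit 0 i
        by (intro exI[of _ s] exI[of _ m] exI[of _ "{}"] exI[of _ "1 + ops e"]) auto
    qed
  next
    case (Suc r)
    then have i: "i < k" by simp
    show ?case unfolding runs_def
    proof (intro allI impI)
      fix m assume b: "bounded s m \<and> view z m = a"
      then have v: "val w e s \<noteq> 0" using val_eq[of s m e] assms(1) step[OF i Suc(4)] by auto
      from step[OF i Suc(4)] b obtain s1 m1 A B t1 d1 where 1: "exec w c s m s1 m1 A B t1 d1"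
        "t1 \<le> tb i" "d1 \<le> db i" "bounded s1 m1" "I (Suc i) s1 (view z m1)" unfolding runs_def by blast
      have "runs (While e c) s1 (view z m1) ((\<Sum>j=Suc i..<k. tb j) + 40 * (k - Suc i + 1))
          ((\<Sum>j=Suc i..<k. db j) + 40 * (k - Suc i + 1)) Q"
        using Suc(1)[of "Suc i" s1 "view z m1"] Suc(2) i 1 by auto
      with 1 obtain s2 m2 A2 B2 t2 d2 where 2: "exec w (While e c) s1 m1 s2 m2 A2 B2 t2 d2"
        "t2 \<le> (\<Sum>j=Suc i..<k. tb j) + 40 * (k - Suc i + 1)"
        "d2 \<le> (\<Sum>j=Suc i..<k. db j) + 40 * (k - Suc i + 1)"
        "bounded s2 m2" "Q s2 (view z m2)" unfolding runs_def by blast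
      have s: "sum f {i..<k} = f i + sum f {Suc i..<k}" for f :: "nat \<Rightarrow> nat"
        using i by (simp add: sum.atLeast_Suc_lessThan)
      have "k - i = Suc (k - Suc i)" using i by simp
      then have "1 + ops e + t1 + t2 \<le> (\<Sum>j=i..<k. tb j) + 40 * (k - i + 1)"
        "1 + ops e + d1 + d2 \<le> (\<Sum>j=i..<k. db j) + 40 * (k - i + 1)"
        using o 1 2 by (auto simp: s)
      with exec_While_true[OF v 1(1) 2(1)] 2 show
        "\<exists>s' m' A B t d. exec w (While e c) s m s' m' A B t d \<and>
          t \<le> (\<Sum>j=i..<k. tb j) + 40 * (k - i + 1) \<and> d \<le> (\<Sum>j=i..<k. db j) + 40 * (k - i + 1) \<and>
        bounded s' m' \<and> Q s' (view z m')" by blast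
    qed
  qed
  show ?thesis
    by (rule runs_mono[OF main[of 0 s a]]) (use assms in \<open>auto simp: lessThan_atLeast0\<close>)
qed

text \<open>Since a thread has at most one store (\<open>v i\<close> into cell \<open>f i\<close> of
  array \<open>r\<close> if \<open>C i\<close>), \<open>inj\<close> and \<open>race\<close> exclude
  all conflicts. \<open>race\<close> also covers a thread reading its own target, so updates of an
  array in place go through a second array that is copied back afterwards.\<close>

lemma runs_ParFor:
  assumes k: "nval ke s = k" "k \<le> X" and ok: "small_exp ke" "x \<noteq> ''z''" "body_ok ls (c, r, e1, e2)"
    and low: "\<And>i q j. i < k \<Longrightarrow> (q, j) \<in> set (lreads ls (s(x := i)) a) \<Longrightarrow> q = 32 \<Longrightarrow> j < z"
    and cond: "\<And>i. i < k \<Longrightarrow> (nval c (lsem ls (s(x := i)) a) \<noteq> 0) = C i"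
    and idx: "\<And>i. i < k \<Longrightarrow> C i \<Longrightarrow> nval e1 (lsem ls (s(x := i)) a) = f i"
    and vl: "\<And>i. i < k \<Longrightarrow> C i \<Longrightarrow> nval e2 (lsem ls (s(x := i)) a) = v i"
    and bnd: "\<And>i. i < k \<Longrightarrow> C i \<Longrightarrow> v i \<le> X"
    and lows: "\<And>i. i < k \<Longrightarrow> C i \<Longrightarrow> r = 32 \<Longrightarrow> f i < z"
    and inj: "\<And>i j. i < k \<Longrightarrow> j < k \<Longrightarrow> C i \<Longrightarrow> C j \<Longrightarrow> f i = f j \<Longrightarrow> i = j"
    and race: "\<And>i j. i < k \<Longrightarrow> j < k \<Longrightarrow> C j \<Longrightarrow> (r, f j) \<notin> set (lreads ls (s(x := i)) a)"
    and post: "\<And>a'. (\<And>i. i < k \<Longrightarrow> C i \<Longrightarrow> a' r (f i) = v i) \<Longrightarrow>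
       (\<And>j. (\<And>i. i < k \<Longrightarrow> C i \<Longrightarrow> f i \<noteq> j) \<Longrightarrow> a' r j = a r j) \<Longrightarrow>
       (\<And>q. q \<noteq> r \<Longrightarrow> a' q = a q) \<Longrightarrow> Q s a'"
    and cost: "100 * (k + 1) \<le> t" "200 \<le> d"
  shows "runs (ParFor x ke (body ls (c, r, e1, e2))) s a t d Q"
  unfolding runs_def
proof (intro allI impI)
  fix m assume b: "bounded s m \<and> view z m = a"
  have o: "1 + ops ke \<le> 40" using ok(1) ops_leaves[of ke] by (simp add: small_exp_def)
  have ok': "loads_ok ls" "store_ok (c, r, e1, e2)" "loads_cost ls + store_cost (c, r, e1, e2) \<le> 98"
    using ok(3) by (auto simp: body_ok_def simp del: store_ok.simps store_cost.simps)
  have r: "r \<le> 32" using ok'(2) by simp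
  let ?B = "\<lambda>i. if C i then {adr z r (f i)} else {}"
  let ?M = "\<lambda>i. if C i then m(adr z r (f i) := v i) else m"
  let ?S = "\<lambda>i. lsem ls (s(x := i)) a"
  have bi: "bounded (s(x := i)) m" if "i < k" for i
    using b that k(2) ok(2) by (auto simp: bounded_def)
  have "\<exists>A t. exec w (body ls (c, r, e1, e2)) (s(x := i)) m (?S i) (?M i) A (?B i) t t \<and>
     A \<subseteq> (\<lambda>(r, j). adr z r j) ` set (lreads ls (s(x := i)) a) \<and> t \<le> 98" if i: "i < k" for i
  proof -
    have v: "view z m = a" using b by blast
    have "\<forall>(r, j)\<in>set (lreads ls (s(x := i)) (view z m)). r = 32 \<longrightarrow> j < z"
      unfolding v using low[OF i] by auto
    from exec_body[OF bi[OF i] ok'(1,2) refl this] obtain A B t where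
      "exec w (body ls (c, r, e1, e2)) (s(x := i)) m (?S i)
         (if nval c (?S i) \<noteq> 0 then m(adr z r (nval e1 (?S i)) := nval e2 (?S i)) else m) A B t t"
      "A \<subseteq> (\<lambda>(r, j). adr z r j) ` set (lreads ls (s(x := i)) a)"
      "B = (if nval c (?S i) \<noteq> 0 then {adr z r (nval e1 (?S i))} else {})"
      "t \<le> loads_cost ls + store_cost (c, r, e1, e2)"
      unfolding v by auto
    then show ?thesis using cond[OF i] idx[OF i] vl[OF i] ok'(3)
      by (intro exI[of _ A] exI[of _ t]) (auto split: if_splits simp del: store_cost.simps)
  qed
  then obtain A t1 where ex: "\<And>i. i < k \<Longrightarrow>
      exec w (body ls (c, r, e1, e2)) (s(x := i)) m (?S i) (?M i) (A i) (?B i) (t1 i) (t1 i)"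
    and A: "\<And>i. i < k \<Longrightarrow> A i \<subseteq> (\<lambda>(r, j). adr z r j) ` set (lreads ls (s(x := i)) a)"
    and t1: "\<And>i. i < k \<Longrightarrow> t1 i \<le> 98"
    by metis
  have vk: "k = val w ke s" using k val_eq b ok(1) by metis
  have lreads_le: "q \<le> 32" if "loads_ok ls" "(q, j) \<in> set (lreads ls s' a)" for q j s'
    using that by (induction ls s' a rule: lreads.induct) auto
  have disj: "?B i \<inter> (A j \<union> ?B j) = {}" if ij: "i < k" "j < k" "i \<noteq> j" for i j
  proof (cases "C i")
    case True
    have "adr z r (f i) \<notin> ?B j"
      using inj[OF ij(1,2) True] ij True adr_inj[of z r "f i" r "f j"] r lows by auto
    moreover have "adr z r (f i) \<notin> A j"
    proof
      assume "adr z r (f i) \<in> A j"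
      then obtain q l where ql: "(q, l) \<in> set (lreads ls (s(x := j)) a)" "adr z r (f i) = adr z q l"
        using A[OF ij(2)] by auto
      then have "q \<le> 32" "q = 32 \<longrightarrow> l < z" using lreads_le[OF ok'(1)] low[OF ij(2)] by auto
      then have "r = q \<and> f i = l" using adr_inj[OF ql(2)] r lows ij True by auto
      then show False using ql(1) race[OF ij(2,1) True] by auto
    qed
    ultimately show ?thesis using True by simp
  qed simp
  \<comment> \<open>By \<open>disj\<close> at most one thread writes a given cell, so the choice is
    unique.\<close>
  define m' where "m' = (\<lambda>l. if \<exists>i<k. l \<in> ?B i then v (SOME i. i < k \<and> l \<in> ?B i) else m l)"
  have in_B: "m' l = v i" if "i < k" "C i" "l = adr z r (f i)" for i l
  proof -
    define i0 where "i0 = (SOME i. i < k \<and> l \<in> ?B i)"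
    have i0: "i0 < k \<and> l \<in> ?B i0" unfolding i0_def by (rule someI[of _ i]) (use that in auto)
    then have "i0 = i" using disj[of i0 i] that by (auto split: if_splits)
    moreover have "\<exists>i<k. l \<in> ?B i" using i0 by blast
    ultimately show ?thesis by (simp only: m'_def i0_def if_True)
  qed
  have out_B: "m' l = m l" if "l \<notin> (\<Union>i<k. ?B i)" for l
    using that by (auto simp: m'_def)
  have run: "exec w (ParFor x ke (body ls (c, r, e1, e2))) s m s m' (\<Union>i<k. A i) (\<Union>i<k. ?B i)
       (1 + ops ke + (\<Sum>i<k. 1 + t1 i))
       (1 + ops ke + Max (insert 0 ((\<lambda>i. 1 + t1 i) ` {..<k})))"
  proof (rule exec_ParFor[OF vk ex disj])
    show "m' l = ?M i l" if "i < k" "l \<in> ?B i" for i l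
      using that in_B[of i l] by (auto split: if_splits)
  qed (use out_B in auto)
  have "(\<Sum>i<k. 1 + t1 i) \<le> (\<Sum>i<k. 99)" using t1 by (intro sum_mono) auto
  then have T: "1 + ops ke + (\<Sum>i<k. 1 + t1 i) \<le> t" using o cost by simp
  have "Max (insert 0 ((\<lambda>i. 1 + t1 i) ` {..<k})) \<le> 99" using t1 by (subst Max_le_iff) auto
  then have Dp: "1 + ops ke + Max (insert 0 ((\<lambda>i. 1 + t1 i) ` {..<k})) \<le> d" using o cost by linarith
  have "m' l \<le> X" for l
    using in_B[of _ l] out_B[of l] bnd b by (cases "l \<in> (\<Union>i<k. ?B i)") (auto simp: bounded_def split: if_splits)
  then have b': "bounded s m'" using b by (auto simp: bounded_def)
  have "Q s (view z m')"
  proof (rule post)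
    show "view z m' r (f i) = v i" if "i < k" "C i" for i
      using in_B[OF that refl] lows[OF that] r by (auto simp: view_def)
    show "view z m' r j = a r j" if j: "\<And>i. i < k \<Longrightarrow> C i \<Longrightarrow> f i \<noteq> j" for j
    proof (cases "r < 32 \<or> r = 32 \<and> j < z")
      case True
      have "adr z r j \<notin> (\<Union>i<k. ?B i)"
      proof
        assume "adr z r j \<in> (\<Union>i<k. ?B i)"
        then obtain i where i: "i < k" "C i" "adr z r j = adr z r (f i)" by (auto split: if_splits)
        then show False using adr_inj[OF i(3)] True r lows j by auto
      qed
      from out_B[OF this] show ?thesis using True b by (auto simp: view_def)
    next
      case False
      then show ?thesis using b by (auto simp: view_def)
    qed
    show "view z m' q = a q" if q: "q \<noteq> r" for q
    proof
      fix j
      show "view z m' q j = a q j"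
      proof (cases "q < 32 \<or> q = 32 \<and> j < z")
        case True
        have "adr z q j \<notin> (\<Union>i<k. ?B i)"
        proof
          assume "adr z q j \<in> (\<Union>i<k. ?B i)"
          then obtain i where i: "i < k" "C i" "adr z q j = adr z r (f i)" by (auto split: if_splits)
          then show False using adr_inj[OF i(3)] True r lows q by auto
        qed
        from out_B[OF this] show ?thesis using True b by (auto simp: view_def)
      next
        case False
        then show ?thesis using b by (auto simp: view_def)
      qed
    qed
  qed
  with run T Dp b' show "\<exists>s' m' A B t' d'. exec w (ParFor x ke (body ls (c, r, e1, e2))) s m s' m' A B t' d' \<and>
      t' \<le> t \<and> d' \<le> d \<and> bounded s' m' \<and> Q s' (view z m')" by blast
qed

end

section \<open>Work-efficient parallel prefix sums on a heap-ordered binary tree\<close>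

section \<open>Prefix sums\<close>

abbreviation exp_plus (infixl "\<oplus>" 65) where "a \<oplus> b \<equiv> Op Add a b"
abbreviation exp_minus (infixl "\<ominus>" 65) where "a \<ominus> b \<equiv> Op Sub a b"
abbreviation exp_times (infixl "\<otimes>" 70) where "a \<otimes> b \<equiv> Op Mul a b"
abbreviation exp_div (infixl "\<oslash>" 70) where "a \<oslash> b \<equiv> Op Div a b"
abbreviation exp_mod (infixl "\<odot>" 70) where "a \<odot> b \<equiv> Op Mod a b"
abbreviation exp_less (infix "\<prec>" 50) where "a \<prec> b \<equiv> Op Less a b"
abbreviation exp_eq (infix "\<doteq>" 50) where "a \<doteq> b \<equiv> Op Eq a b"

text \<open>The heap has its root at 1 and its leaves from \<open>p\<close> on. The upward sweep
  puts the sum below each node into array 10. The downward sweep puts the sum of all leaves left of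
  the node into array 11: a left child inherits the value of its parent, a right child
  (\<open>i\<close> odd) adds the sum of its left sibling, the preceding heap cell. As tree levels
  double in size, the work is linear in \<open>p\<close> and the depth logarithmic.\<close>

definition scan :: com where
  "scan =
    Seq (Assign ''h'' (Reg ''p'' \<oslash> Const 2))
    (Seq (While (Const 0 \<prec> Reg ''h'')
      (Seq (ParFor ''i'' (Reg ''h'')
             (body [(''a'', 10, Const 2 \<otimes> (Reg ''h'' \<oplus> Reg ''i'')), (''b'', 10, Const 2 \<otimes> (Reg ''h'' \<oplus> Reg ''i'') \<oplus> Const 1)]
               (Const 1, 10, Reg ''h'' \<oplus> Reg ''i'', Reg ''a'' \<oplus> Reg ''b'')))
           (Assign ''h'' (Reg ''h'' \<oslash> Const 2))))
    (Seq (ParFor ''i'' (Const 1) (body [] (Const 1, 11, Const 1, Const 0)))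
    (Seq (Assign ''h'' (Const 1))
    (While (Reg ''h'' \<prec> Reg ''p'')
      (Seq (ParFor ''i'' (Const 2 \<otimes> Reg ''h'')
             (body [(''a'', 11, (Const 2 \<otimes> Reg ''h'' \<oplus> Reg ''i'') \<oslash> Const 2), (''b'', 10, Const 2 \<otimes> Reg ''h'' \<oplus> Reg ''i'' \<ominus> Const 1)]
               (Const 1, 11, Const 2 \<otimes> Reg ''h'' \<oplus> Reg ''i'', Reg ''a'' \<oplus> (Reg ''i'' \<odot> Const 2) \<otimes> Reg ''b'')))
           (Assign ''h'' (Const 2 \<otimes> Reg ''h'')))))))"

text \<open>The leaves below heap cell \<open>2 ^ b + i\<close>, that is, below the i-th node at
  distance \<open>b\<close> from the root of a tree with \<open>2 ^ q\<close> leaves.\<close>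

definition block :: "(nat \<Rightarrow> nat) \<Rightarrow> nat \<Rightarrow> nat \<Rightarrow> nat \<Rightarrow> nat" where
  "block f q b i = sum f {i * 2 ^ (q - b)..<Suc i * 2 ^ (q - b)}"

lemma block_split:
  assumes "b < q"
  shows "block f q b i = block f q (Suc b) (2 * i) + block f q (Suc b) (2 * i + 1)"
proof -
  define c where "c = (2::nat) ^ (q - Suc b)"
  have "q - b = Suc (q - Suc b)" using assms by simp
  then have c: "2 ^ (q - b) = 2 * c" by (simp add: c_def)
  have "sum f {2 * i * c..<(2 * i + 1) * c} + sum f {(2 * i + 1) * c..<(2 * i + 2) * c} =
      sum f {2 * i * c..<(2 * i + 2) * c}"
    by (intro sum.atLeastLessThan_concat) auto
  then show ?thesis
    unfolding block_def c c_def[symmetric] by (simp add: algebra_simps)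
qed

lemma block_le:
  assumes "i < 2 ^ b" "b \<le> q"
  shows "block f q b i \<le> sum f {..<2 ^ q}"
  unfolding block_def
proof (rule sum_mono2)
  have "Suc i * 2 ^ (q - b) \<le> 2 ^ b * 2 ^ (q - b)" using assms by (intro mult_le_mono) auto
  also have "\<dots> = 2 ^ q" using assms by (simp flip: power_add)
  finally show "{i * 2 ^ (q - b)..<Suc i * 2 ^ (q - b)} \<subseteq> {..<2 ^ q}" by auto
qed auto

lemma sum_pow2: "(\<Sum>j<q. 2 ^ (q - Suc j)) = 2 ^ q - (1::nat)" "(\<Sum>j<q. 2 ^ j) = 2 ^ q - (1::nat)"
proof -
  show "(\<Sum>j<q. 2 ^ j) = 2 ^ q - (1::nat)" by (induction q) auto
  then show "(\<Sum>j<q. 2 ^ (q - Suc j)) = 2 ^ q - (1::nat)"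
    by (subst sum.nat_diff_reindex)
qed

lemma le_pow2: "(q::nat) \<le> 2 ^ q"
  by (simp add: less_imp_le)

lemma arith1: "x + 40 * (q + 1) \<le> t" if "x \<le> 200 * p + 140 * q" "400 * p + 40 \<le> t" "q \<le> p" for x t p q :: nat
  using that by simp

lemmas ok_simps = small_exp_def body_ok_def arr.simps

declare body.simps [simp del] arr.simps [simp del]

context machine
begin

lemma runs_scan_up:
  assumes p: "s ''p'' = 2 ^ q" and X: "2 * 2 ^ q \<le> X" and f: "sum f {..<2 ^ q} \<le> X"
    and leaf: "\<And>j. j < 2 ^ q \<Longrightarrow> a 10 (2 ^ q + j) = f j"
    and post: "\<And>a'. (\<And>b i. b \<le> q \<Longrightarrow> i < 2 ^ b \<Longrightarrow> a' 10 (2 ^ b + i) = block f q b i) \<Longrightarrow>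
       (\<And>r. r \<noteq> 10 \<Longrightarrow> a' r = a r) \<Longrightarrow> Q (s(''h'' := 0)) a'"
    and t: "500 * 2 ^ q + 1000 \<le> t" "300 * (q + 1) \<le> d"
  shows "runs (While (Const 0 \<prec> Reg ''h'')
      (Seq (ParFor ''i'' (Reg ''h'')
             (body [(''a'', 10, Const 2 \<otimes> (Reg ''h'' \<oplus> Reg ''i'')), (''b'', 10, Const 2 \<otimes> (Reg ''h'' \<oplus> Reg ''i'') \<oplus> Const 1)]
               (Const 1, 10, Reg ''h'' \<oplus> Reg ''i'', Reg ''a'' \<oplus> Reg ''b'')))
           (Assign ''h'' (Reg ''h'' \<oslash> Const 2)))) (s(''h'' := 2 ^ q div 2)) a t d Q"
proof (rule runs_While[where k = q and tb = "\<lambda>j. 100 * (2 ^ (q - Suc j) + 1) + 40" and db = "\<lambda>j. 240"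
      and I = "\<lambda>j s' a'. s' = s(''h'' := 2 ^ q div 2 ^ Suc j) \<and>
        (\<forall>b i. q - j \<le> b \<and> b \<le> q \<and> i < 2 ^ b \<longrightarrow> a' 10 (2 ^ b + i) = block f q b i) \<and>
        (\<forall>r. r \<noteq> 10 \<longrightarrow> a' r = a r)"])
  fix j s' a'
  assume j: "j < q" and I: "s' = s(''h'' := 2 ^ q div 2 ^ Suc j) \<and>
        (\<forall>b i. q - j \<le> b \<and> b \<le> q \<and> i < 2 ^ b \<longrightarrow> a' 10 (2 ^ b + i) = block f q b i) \<and>
        (\<forall>r. r \<noteq> 10 \<longrightarrow> a' r = a r)"
  \<comment> \<open>Iteration \<open>j\<close> fills the tree level at distance \<open>b\<close>
    from the root; the level \<open>Suc b\<close> below it is already known.\<close>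
  define b where "b = q - Suc j"
  have q: "q = Suc j + b" "q - j = Suc b" "Suc b \<le> q" using j by (auto simp: b_def)
  have "(2::nat) ^ q = 2 ^ Suc j * 2 ^ b" by (metis power_add q(1))
  then have h: "2 ^ q div 2 ^ Suc j = (2::nat) ^ b" by (simp del: power_Suc)
  have s': "s' = s(''h'' := 2 ^ b)" using I h by simp
  have node: "a' 10 (2 * 2 ^ b + i) = block f q (Suc b) i" if "i < 2 * 2 ^ b" for i
    using I q that by (metis order_refl power_Suc)
  have kX: "2 ^ b \<le> X" using X q power_increasing[of b q "2::nat"] by linarith
  have bl: "block f q b i \<le> X" if "i < 2 ^ b" for i using block_le[OF that, of q f] f q by simp
  have blk: "a' 10 (2 * (2 ^ b + i)) + a' 10 (2 * (2 ^ b + i) + 1) = block f q b i" if "i < 2 ^ b" for i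
    using node[of "2 * i"] node[of "2 * i + 1"] that q block_split[of b q f i] by (simp add: algebra_simps)
  show "nval (Const 0 \<prec> Reg ''h'') s' \<noteq> 0 \<and> runs (Seq (ParFor ''i'' (Reg ''h'')
             (body [(''a'', 10, Const 2 \<otimes> (Reg ''h'' \<oplus> Reg ''i'')), (''b'', 10, Const 2 \<otimes> (Reg ''h'' \<oplus> Reg ''i'') \<oplus> Const 1)]
               (Const 1, 10, Reg ''h'' \<oplus> Reg ''i'', Reg ''a'' \<oplus> Reg ''b'')))
           (Assign ''h'' (Reg ''h'' \<oslash> Const 2))) s' a' (100 * (2 ^ (q - Suc j) + 1) + 40) 240
        (\<lambda>s' a'. s' = s(''h'' := 2 ^ q div 2 ^ Suc (Suc j)) \<and>
        (\<forall>b i. q - Suc j \<le> b \<and> b \<le> q \<and> i < 2 ^ b \<longrightarrow> a' 10 (2 ^ b + i) = block f q b i) \<and>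
        (\<forall>r. r \<noteq> 10 \<longrightarrow> a' r = a r))"
  proof (intro conjI)
    show "nval (Const 0 \<prec> Reg ''h'') s' \<noteq> 0" by (simp add: s')
    let ?P = "\<lambda>s' a'. s' = s(''h'' := 2 ^ b) \<and>
        (\<forall>b i. q - Suc j \<le> b \<and> b \<le> q \<and> i < 2 ^ b \<longrightarrow> a' 10 (2 ^ b + i) = block f q b i) \<and>
        (\<forall>r. r \<noteq> 10 \<longrightarrow> a' r = a r)"
    show "runs (Seq (ParFor ''i'' (Reg ''h'')
             (body [(''a'', 10, Const 2 \<otimes> (Reg ''h'' \<oplus> Reg ''i'')), (''b'', 10, Const 2 \<otimes> (Reg ''h'' \<oplus> Reg ''i'') \<oplus> Const 1)]
               (Const 1, 10, Reg ''h'' \<oplus> Reg ''i'', Reg ''a'' \<oplus> Reg ''b'')))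
           (Assign ''h'' (Reg ''h'' \<oslash> Const 2))) s' a' (100 * (2 ^ (q - Suc j) + 1) + 40) 240
        (\<lambda>s' a'. s' = s(''h'' := 2 ^ q div 2 ^ Suc (Suc j)) \<and>
        (\<forall>b i. q - Suc j \<le> b \<and> b \<le> q \<and> i < 2 ^ b \<longrightarrow> a' 10 (2 ^ b + i) = block f q b i) \<and>
        (\<forall>r. r \<noteq> 10 \<longrightarrow> a' r = a r))"
    proof (rule runs_Seq[where P = ?P and ta = "100 * (2 ^ b + 1)" and da = 200 and tb = 40 and db = 40])
      show "runs (ParFor ''i'' (Reg ''h'')
             (body [(''a'', 10, Const 2 \<otimes> (Reg ''h'' \<oplus> Reg ''i'')), (''b'', 10, Const 2 \<otimes> (Reg ''h'' \<oplus> Reg ''i'') \<oplus> Const 1)]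
               (Const 1, 10, Reg ''h'' \<oplus> Reg ''i'', Reg ''a'' \<oplus> Reg ''b''))) s' a' (100 * (2 ^ b + 1)) 200 ?P"
      proof (rule runs_ParFor[where k = "2 ^ b" and C = "\<lambda>i. True" and f = "\<lambda>i. 2 ^ b + i" and v = "\<lambda>i. block f q b i"])
        fix a''
        assume w: "\<And>i. i < 2 ^ b \<Longrightarrow> True \<Longrightarrow> a'' 10 (2 ^ b + i) = block f q b i"
          and u: "\<And>j. (\<And>i. i < 2 ^ b \<Longrightarrow> True \<Longrightarrow> 2 ^ b + i \<noteq> j) \<Longrightarrow> a'' 10 j = a' 10 j"
          and o: "\<And>r. r \<noteq> 10 \<Longrightarrow> a'' r = a' r"
        have "a'' 10 (2 ^ c + i) = block f q c i" if "q - Suc j \<le> c" "c \<le> q" "i < 2 ^ c" for c i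
        proof (cases "c = b")
          case False
          then have c: "Suc b \<le> c" using that by (simp add: b_def)
          then have "2 ^ Suc b \<le> (2::nat) ^ c" by (intro power_increasing) auto
          then have "a'' 10 (2 ^ c + i) = a' 10 (2 ^ c + i)" by (intro u) auto
          then show ?thesis using I c that q by metis
        qed (use w that in auto)
        then show "?P s' a''" using o I s' by auto
      qed (use kX bl blk in \<open>auto simp: s' ok_simps\<close>)
    next
      fix s1 a1 assume P: "?P s1 a1"
      have "2 ^ b div 2 = (2::nat) ^ q div 2 ^ Suc (Suc j)"
        by (metis h div_mult2_eq power_Suc2)
      then show "runs (Assign ''h'' (Reg ''h'' \<oslash> Const 2)) s1 a1 40 40
          (\<lambda>s' a'. s' = s(''h'' := 2 ^ q div 2 ^ Suc (Suc j)) \<and>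
        (\<forall>b i. q - Suc j \<le> b \<and> b \<le> q \<and> i < 2 ^ b \<longrightarrow> a' 10 (2 ^ b + i) = block f q b i) \<and>
        (\<forall>r. r \<noteq> 10 \<longrightarrow> a' r = a r))"
        using P kX by (intro runs_Assign) (auto simp: ok_simps)
    qed (simp_all add: b_def)
  qed
next
  show "s(''h'' := 2 ^ q div 2) = s(''h'' := 2 ^ q div 2 ^ Suc 0) \<and>
    (\<forall>b i. q - 0 \<le> b \<and> b \<le> q \<and> i < 2 ^ b \<longrightarrow> a 10 (2 ^ b + i) = block f q b i) \<and>
    (\<forall>r. r \<noteq> 10 \<longrightarrow> a r = a r)"
    using leaf by (auto simp: block_def dest!: le_antisym)
next
  have "(\<Sum>j<q. 100 * (2 ^ (q - Suc j) + 1) + 40) = 100 * (2 ^ q - 1) + (140 * q :: nat)"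
    unfolding sum_pow2(1)[symmetric] by (simp add: sum.distrib sum_distrib_left)
  also have "\<dots> \<le> 200 * 2 ^ q + 140 * q" by simp
  finally show "(\<Sum>j<q. 100 * (2 ^ (q - Suc j) + 1) + 40) + 40 * (q + 1) \<le> t"
    by (rule arith1[OF _ _ le_pow2]) (use t in simp)
qed (use t post in \<open>auto simp: ok_simps\<close>)

lemma runs_scan_down:
  assumes p: "s ''p'' = 2 ^ q" and X: "2 * 2 ^ q \<le> X" and f: "sum f {..<2 ^ q} \<le> X"
    and node: "\<And>b i. b \<le> q \<Longrightarrow> i < 2 ^ b \<Longrightarrow> a 10 (2 ^ b + i) = block f q b i" and one: "a 11 1 = 0"
    and post: "\<And>a'. (\<And>i. i < 2 ^ q \<Longrightarrow> a' 11 (2 ^ q + i) = sum f {..<i}) \<Longrightarrow>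
       (\<And>r. r \<noteq> 11 \<Longrightarrow> a' r = a r) \<Longrightarrow> Q (s(''h'' := 2 ^ q)) a'"
    and t: "600 * 2 ^ q + 1000 \<le> t" "300 * (q + 1) \<le> d"
  shows "runs (While (Reg ''h'' \<prec> Reg ''p'')
      (Seq (ParFor ''i'' (Const 2 \<otimes> Reg ''h'')
             (body [(''a'', 11, (Const 2 \<otimes> Reg ''h'' \<oplus> Reg ''i'') \<oslash> Const 2), (''b'', 10, Const 2 \<otimes> Reg ''h'' \<oplus> Reg ''i'' \<ominus> Const 1)]
               (Const 1, 11, Const 2 \<otimes> Reg ''h'' \<oplus> Reg ''i'', Reg ''a'' \<oplus> (Reg ''i'' \<odot> Const 2) \<otimes> Reg ''b'')))
           (Assign ''h'' (Const 2 \<otimes> Reg ''h'')))) (s(''h'' := 1)) a t d Q" (is "runs (While ?e (Seq ?c1 ?c2)) _ _ _ _ _")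
proof -
  let ?I = "\<lambda>j s' a'. s' = s(''h'' := 2 ^ j) \<and>
        (\<forall>i<2 ^ j. a' 11 (2 ^ j + i) = sum f {..<i * 2 ^ (q - j)}) \<and> (\<forall>r. r \<noteq> 11 \<longrightarrow> a' r = a r)"
  have step: "nval ?e s' \<noteq> 0 \<and> runs (Seq ?c1 ?c2) s' a' (100 * (2 * 2 ^ j + 1) + 40) 240 (?I (Suc j))"
    if j: "j < q" and I: "?I j s' a'" for j s' a'
  proof (intro conjI)
    have qj: "q - j = Suc (q - Suc j)" using j by simp
    have pw: "2 ^ Suc j \<le> (2::nat) ^ q" "2 ^ j < (2::nat) ^ q" using j by (auto intro!: power_increasing power_strict_increasing simp del: power_Suc)
    show "nval ?e s' \<noteq> 0" using pw p I by simp
    let ?v = "\<lambda>i. sum f {..<i * 2 ^ (q - Suc j)}"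
    let ?P = "\<lambda>s' a'. s' = s(''h'' := 2 ^ j) \<and>
        (\<forall>i<2 ^ Suc j. a' 11 (2 ^ Suc j + i) = ?v i) \<and> (\<forall>r. r \<noteq> 11 \<longrightarrow> a' r = a r)"
    have v: "a' 11 ((2 * 2 ^ j + i) div 2) + i mod 2 * a' 10 (2 * 2 ^ j + i - 1) = ?v i" if i: "i < 2 * 2 ^ j" for i
    proof (cases "even i")
      case True
      then obtain k where "i = 2 * k" by blast
      then show ?thesis using I i qj by (simp add: algebra_simps)
    next
      case False
      then obtain k where k: "i = 2 * k + 1" by (elim oddE)
      have "a' 10 (2 ^ Suc j + 2 * k) = block f q (Suc j) (2 * k)"
        using node[of "Suc j" "2 * k"] I j i k by simp
      moreover have "(2 * 2 ^ j + i) div 2 = 2 ^ j + k" using k by simp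
      moreover have "a' 11 (2 ^ j + k) = sum f {..<2 * k * 2 ^ (q - Suc j)}"
        using I i k qj by (simp add: algebra_simps)
      moreover have "sum f {..<2 * k * 2 ^ (q - Suc j)} + block f q (Suc j) (2 * k) = ?v i"
        unfolding block_def k lessThan_atLeast0 by (subst sum.atLeastLessThan_concat) auto
      ultimately show ?thesis using k by simp
    qed
    have vX: "?v i \<le> X" if "i < 2 * 2 ^ j" for i
    proof -
      have "i * 2 ^ (q - Suc j) \<le> 2 ^ Suc j * 2 ^ (q - Suc j)" using that by simp
      also have "\<dots> = 2 ^ q" using j by (simp flip: power_add power_Suc)
      finally show ?thesis using f by (intro order_trans[OF sum_mono2 f]) auto
    qed
    show "runs (Seq ?c1 ?c2) s' a' (100 * (2 * 2 ^ j + 1) + 40) 240 (?I (Suc j))"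
    proof (rule runs_Seq[where P = ?P and ta = "100 * (2 * 2 ^ j + 1)" and da = 200 and tb = 40 and db = 40])
      show "runs ?c1 s' a' (100 * (2 * 2 ^ j + 1)) 200 ?P"
        by (rule runs_ParFor[where k = "2 * 2 ^ j" and C = "\<lambda>i. True" and f = "\<lambda>i. 2 * 2 ^ j + i" and v = ?v])
          (use v vX I pw X in \<open>auto simp: ok_simps\<close>)
    next
      fix s1 a1 assume "?P s1 a1"
      then show "runs ?c2 s1 a1 40 40 (?I (Suc j))"
        using pw X by (intro runs_Assign) (auto simp: ok_simps)
    qed simp_all
  qed
  show ?thesis
  proof (rule runs_While[where k = q and I = ?I and tb = "\<lambda>j. 100 * (2 * 2 ^ j + 1) + 40" and db = "\<lambda>j. 240"])
    have "(\<Sum>j<q. 100 * (2 * 2 ^ j + 1) + 40) = 200 * (2 ^ q - 1) + (140 * q :: nat)"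
      unfolding sum_pow2(2)[symmetric] by (simp add: sum.distrib sum_distrib_left)
    also have "\<dots> \<le> 200 * 2 ^ q + 140 * q" by simp
    finally show "(\<Sum>j<q. 100 * (2 * 2 ^ j + 1) + 40) + 40 * (q + 1) \<le> t"
      by (rule arith1[OF _ _ le_pow2]) (use t in simp)
  qed (use step one t post p in \<open>auto simp: ok_simps\<close>)
qed

lemma runs_scan:
  assumes p: "s ''p'' = 2 ^ q" and X: "2 * 2 ^ q \<le> X" and f: "sum f {..<2 ^ q} \<le> X"
    and leaf: "\<And>j. j < 2 ^ q \<Longrightarrow> a 10 (2 ^ q + j) = f j"
    and post: "\<And>a'. (\<And>i. i < 2 ^ q \<Longrightarrow> a' 11 (2 ^ q + i) = sum f {..<i}) \<Longrightarrow>
       (\<And>j. j < 2 ^ q \<Longrightarrow> a' 10 (2 ^ q + j) = f j) \<Longrightarrow>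
       (\<And>r. r \<noteq> 10 \<Longrightarrow> r \<noteq> 11 \<Longrightarrow> a' r = a r) \<Longrightarrow> Q (s(''h'' := 2 ^ q)) a'"
    and t: "2000 * 2 ^ q + 3000 \<le> t" "1000 * (q + 1) \<le> d"
  shows "runs scan s a t d Q"
proof -
  let ?A = "\<lambda>s1 a1. s1 = s(''h'' := 2 ^ q div 2) \<and> a1 = a"
  let ?N = "\<lambda>a1. (\<forall>b i. b \<le> q \<longrightarrow> i < 2 ^ b \<longrightarrow> a1 10 (2 ^ b + i) = block f q b i) \<and>
    (\<forall>r. r \<noteq> 10 \<longrightarrow> r \<noteq> 11 \<longrightarrow> a1 r = a r)"
  have pX: "2 ^ q \<le> X" using X by simp
  have one: "(1::nat) \<le> 2 ^ q" "1 \<le> X" using X_ge by simp_all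
  show ?thesis
    unfolding scan_def
  proof (rule runs_Seq[where P = ?A and ta = 40 and da = 40 and tb = "1200 * 2 ^ q + 2500"
        and db = "600 * (q + 1) + 300"], goal_cases)
    case 1
    show ?case
      using p pX by (intro runs_Assign) (auto simp: ok_simps intro: div_le_dividend[THEN order_trans])
  next
    case A: (2 s1 a1)
    show ?case
    proof (rule runs_Seq[where P = "\<lambda>s1 a1. s1 = s(''h'' := 0) \<and> ?N a1" and ta = "500 * 2 ^ q + 1000"
          and da = "300 * (q + 1)" and tb = "600 * 2 ^ q + 1500" and db = "300 * (q + 1) + 300"], goal_cases)
      case 1
      show ?case
        using A by (clarify, intro runs_scan_up[where f = f and q = q] p X f leaf) auto
    next
      case A: (2 s1 a1)
      show ?case
      proof (rule runs_Seq[where P = "\<lambda>s1 a1. s1 = s(''h'' := 0) \<and> ?N a1 \<and> a1 11 1 = 0" and ta = 200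
            and da = 200 and tb = "600 * 2 ^ q + 1300" and db = "300 * (q + 1) + 100"], goal_cases)
        case 1
        show ?case
          by (rule runs_ParFor[where k = 1 and C = "\<lambda>_. True" and f = "\<lambda>_. 1" and v = "\<lambda>_. 0"])
            (use A X one in \<open>auto simp: ok_simps\<close>)
      next
        case A: (2 s1 a1)
        show ?case
        proof (rule runs_Seq[where P = "\<lambda>s1 a1. s1 = s(''h'' := 1) \<and> ?N a1 \<and> a1 11 1 = 0" and ta = 40
              and da = 40 and tb = "600 * 2 ^ q + 1000" and db = "300 * (q + 1)"], goal_cases)
          case 1
          show ?case
            by (rule runs_Assign) (use A X one in \<open>auto simp: ok_simps\<close>)
        next
          case A: (2 s1 a1)
          have "a2 10 (2 ^ q + j) = f j" if "a2 10 = a1 10" "j < 2 ^ q" for a2 :: "nat \<Rightarrow> nat \<Rightarrow> nat" and j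
            using A that by (simp add: block_def)
          with A show ?case
            by (clarify, intro runs_scan_down[where f = f and q = q] p X f post) auto
        qed auto
      qed auto
    qed auto
  qed (use t one in auto)
qed

end

section \<open>Primal-dual analysis: approximate complementary slackness for fractional
  b-matchings\<close>

section \<open>Levels and duality\<close>

lemma sum_cases:
  fixes f :: "'a \<Rightarrow> 'b :: comm_monoid_add"
  assumes "finite A"
  shows "(\<Sum>j | j \<in> A \<and> P j. f j) + (\<Sum>j | j \<in> A \<and> \<not> P j. f j) = sum f A"
proof -
  have "sum f ({j. j \<in> A \<and> P j} \<union> {j. j \<in> A \<and> \<not> P j}) =
      (\<Sum>j | j \<in> A \<and> P j. f j) + (\<Sum>j | j \<in> A \<and> \<not> P j. f j)"
    using assms by (intro sum.union_disjoint) auto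
  moreover have "{j. j \<in> A \<and> P j} \<union> {j. j \<in> A \<and> \<not> P j} = A" by auto
  ultimately show ?thesis by simp
qed

text \<open>Edges are numbered; \<open>ep 0 i\<close> and \<open>ep 1 i\<close> are the endpoints of the edge \<open>i\<close> in L and in R.\<close>

locale edges =
  fixes m :: nat and ep :: "nat \<Rightarrow> nat \<Rightarrow> nat" and b :: "nat \<Rightarrow> nat"
  assumes sides: "i < m \<Longrightarrow> j < m \<Longrightarrow> ep 0 i \<noteq> ep 1 j"
begin

definition inc :: "nat \<Rightarrow> nat \<Rightarrow> nat set" where
  "inc s v = {i. i < m \<and> ep s i = v}"

definition verts :: "nat \<Rightarrow> nat set" where
  "verts s = ep s ` {..<m}"

definition load :: "nat \<Rightarrow> (nat \<Rightarrow> nat) \<Rightarrow> nat \<Rightarrow> nat" where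
  "load s x v = sum x (inc s v)"

text \<open>A fractional b-matching in fixed point: \<open>y i / U\<close> is the value of edge
  \<open>i\<close>, and capacities are counted in units of \<open>1 / U\<close>. For
  \<open>U = 1\<close> it is an ordinary b-matching.\<close>

definition fractional :: "nat \<Rightarrow> (nat \<Rightarrow> nat) \<Rightarrow> bool" where
  "fractional U y \<longleftrightarrow> (\<forall>i<m. y i \<le> U) \<and> (\<forall>s<2. \<forall>v. load s y v \<le> b v * U)"

lemma finite_inc [simp]: "finite (inc s v)"
  by (simp add: inc_def)

lemma finite_verts [simp]: "finite (verts s)"
  by (simp add: verts_def)

lemma sum_load:
  fixes x :: "nat \<Rightarrow> nat"
  shows "(\<Sum>v | v \<in> verts s \<and> P v. load s x v) = (\<Sum>i | i < m \<and> P (ep s i). x i)"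
proof -
  have "(\<Sum>i | i < m \<and> P (ep s i). x i) = (\<Sum>v | v \<in> verts s \<and> P v. \<Sum>i | i \<in> {i. i < m \<and> P (ep s i)} \<and> ep s i = v. x i)"
    by (rule sum.group[symmetric]) (auto simp: verts_def)
  also have "\<dots> = (\<Sum>v | v \<in> verts s \<and> P v. load s x v)"
    unfolding load_def by (intro sum.cong) (auto simp: inc_def)
  finally show ?thesis ..
qed

lemma sum_load_all: "(\<Sum>v\<in>verts s. load s x v) = sum x {..<m}"
  using sum_load[where P = "\<lambda>_. True" and s = s and x = x] by (simp add: lessThan_def)

text \<open>The objective of the dual linear program: the vertices outside \<open>PA\<close> and
  \<open>PB\<close> form a partial cover and pay their budgets, and an edge left uncovered pays 1
  for the constraint that its value is at most 1. Edges whose endpoint in L has budget 0 pay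
  nothing, which is sound because they can carry nothing.\<close>

definition dual :: "(nat \<Rightarrow> bool) \<Rightarrow> (nat \<Rightarrow> bool) \<Rightarrow> nat" where
  "dual PA PB = (\<Sum>u | u \<in> verts 0 \<and> \<not> PA u. b u) + (\<Sum>v | v \<in> verts 1 \<and> \<not> PB v. b v) +
     card {i. i < m \<and> PA (ep 0 i) \<and> PB (ep 1 i) \<and> 0 < b (ep 0 i)}"

lemma sum_split3:
  fixes x :: "nat \<Rightarrow> nat"
  shows "sum x {..<m} = (\<Sum>i | i < m \<and> \<not> PA (ep 0 i). x i) + (\<Sum>i | i < m \<and> PA (ep 0 i) \<and> \<not> PB (ep 1 i). x i) +
    (\<Sum>i | i < m \<and> PA (ep 0 i) \<and> PB (ep 1 i). x i)"
proof -
  have "{..<m} = ({i. i < m \<and> \<not> PA (ep 0 i)} \<union> {i. i < m \<and> PA (ep 0 i) \<and> \<not> PB (ep 1 i)}) \<union>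
     {i. i < m \<and> PA (ep 0 i) \<and> PB (ep 1 i)}" by auto
  then have "sum x {..<m} = sum x (({i. i < m \<and> \<not> PA (ep 0 i)} \<union> {i. i < m \<and> PA (ep 0 i) \<and> \<not> PB (ep 1 i)}) \<union>
     {i. i < m \<and> PA (ep 0 i) \<and> PB (ep 1 i)})" by (rule arg_cong)
  also have "\<dots> = sum x ({i. i < m \<and> \<not> PA (ep 0 i)} \<union> {i. i < m \<and> PA (ep 0 i) \<and> \<not> PB (ep 1 i)}) +
     (\<Sum>i | i < m \<and> PA (ep 0 i) \<and> PB (ep 1 i). x i)"
    by (rule sum.union_disjoint) auto
  also have "sum x ({i. i < m \<and> \<not> PA (ep 0 i)} \<union> {i. i < m \<and> PA (ep 0 i) \<and> \<not> PB (ep 1 i)}) =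
     (\<Sum>i | i < m \<and> \<not> PA (ep 0 i). x i) + (\<Sum>i | i < m \<and> PA (ep 0 i) \<and> \<not> PB (ep 1 i). x i)"
    by (rule sum.union_disjoint) auto
  finally show ?thesis .
qed

text \<open>Every edge is charged once: to its endpoint in L if that is in the cover, otherwise to
  its endpoint in R if that is, otherwise to itself.\<close>

lemma weak_duality:
  assumes "fractional U y"
  shows "sum y {..<m} \<le> U * dual PA PB"
proof -
  have ld: "load 0 y v \<le> b v * U" "load 1 y v \<le> b v * U" for v
    using assms by (auto simp: fractional_def)
  have "(\<Sum>i | i < m \<and> \<not> PA (ep 0 i). y i) \<le> (\<Sum>u | u \<in> verts 0 \<and> \<not> PA u. b u * U)"
    unfolding sum_load[where P = "\<lambda>u. \<not> PA u" and s = 0, symmetric] by (intro sum_mono ld)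
  moreover have "(\<Sum>i | i < m \<and> PA (ep 0 i) \<and> \<not> PB (ep 1 i). y i) \<le> (\<Sum>i | i < m \<and> \<not> PB (ep 1 i). y i)"
    by (intro sum_mono2) auto
  moreover have "\<dots> \<le> (\<Sum>v | v \<in> verts 1 \<and> \<not> PB v. b v * U)"
    unfolding sum_load[where P = "\<lambda>v. \<not> PB v" and s = 1, symmetric] by (intro sum_mono ld)
  moreover have "(\<Sum>i | i < m \<and> PA (ep 0 i) \<and> PB (ep 1 i). y i) \<le>
     (\<Sum>i | i < m \<and> PA (ep 0 i) \<and> PB (ep 1 i) \<and> 0 < b (ep 0 i). U)"
  proof -
    have "y i = 0" if "i < m" "b (ep 0 i) = 0" for i
    proof -
      have "y i \<le> load 0 y (ep 0 i)" unfolding load_def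
        by (rule member_le_sum) (use that in \<open>auto simp: inc_def\<close>)
      then show ?thesis using ld(1)[of "ep 0 i"] that by simp
    qed
    then have "(\<Sum>i | i < m \<and> PA (ep 0 i) \<and> PB (ep 1 i). y i) =
      (\<Sum>i | i < m \<and> PA (ep 0 i) \<and> PB (ep 1 i) \<and> 0 < b (ep 0 i). y i)"
      by (intro sum.mono_neutral_right) auto
    also have "\<dots> \<le> (\<Sum>i | i < m \<and> PA (ep 0 i) \<and> PB (ep 1 i) \<and> 0 < b (ep 0 i). U)"
      using assms by (intro sum_mono) (auto simp: fractional_def)
    finally show ?thesis .
  qed
  ultimately have "sum y {..<m} \<le> (\<Sum>u | u \<in> verts 0 \<and> \<not> PA u. b u * U) +
     (\<Sum>v | v \<in> verts 1 \<and> \<not> PB v. b v * U) +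
     (\<Sum>i | i < m \<and> PA (ep 0 i) \<and> PB (ep 1 i) \<and> 0 < b (ep 0 i). U)"
    unfolding sum_split3[of y PA PB] by linarith
  also have "\<dots> = U * dual PA PB"
    unfolding dual_def distrib_left by (simp add: sum_distrib_left mult.commute)
  finally show ?thesis .
qed

end

text \<open>\<open>g\<close> abstracts an integer table of Big * (1 - 1/D) ^ k, and
  \<open>w0\<close> is the distance at which its values are negligible. That \<open>g_small\<close>
  has 2 * D instead of 0 is due to rounding; by the lower bound on \<open>Big\<close>, even
  \<open>m\<close> values of this size add up to at most Big / D.\<close>

locale levels = edges +
  fixes g :: "nat \<Rightarrow> nat" and D Big w0 :: nat
  assumes g0: "g 0 = Big"
    and g_Suc: "g (Suc k) \<le> g k" "(D - 1) * g k \<le> D * g (Suc k)"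
    and g_small: "w0 \<le> k \<Longrightarrow> g k \<le> 2 * D"
    and D: "6 \<le> D" and Big: "2 * D * D * m \<le> Big" and w0: "0 < w0"
begin

text \<open>Truncated subtraction realises the cap: a nonpositive exponent gives
  \<open>g 0 = Big\<close>, the fixed-point 1. The parameter \<open>c\<close> lifts the endpoint in
  L by \<open>c\<close> levels, so \<open>c = 1\<close> yields the load that a vertex of L would
  have after going up.\<close>

definition xval :: "nat \<Rightarrow> (nat \<Rightarrow> nat) \<Rightarrow> nat \<Rightarrow> nat" where
  "xval c lev i = (if 0 < b (ep 0 i) then g ((w0 + lev (ep 1 i)) - (lev (ep 0 i) + c)) else 0)"

lemma g_antimono: "i \<le> j \<Longrightarrow> g j \<le> g i"
  using g_Suc(1) by (rule lift_Suc_antimono_le)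

lemma g_le: "g k \<le> Big"
  using g_antimono[of 0 k] g0 by simp

text \<open>One additional step of the exponent costs at most the factor (D - 1) / D, and a smaller
  exponent never lowers the value; all estimates for a round rest on this.\<close>

lemma g_near: "j \<le> Suc i \<Longrightarrow> (D - 1) * g i \<le> D * g j"
proof (cases "j \<le> i")
  case True
  then have "(D - 1) * g i \<le> D * g j" by (intro mult_le_mono g_antimono) auto
  then show ?thesis .
next
  case False
  assume "j \<le> Suc i"
  with False have "j = Suc i" by simp
  then show ?thesis using g_Suc(2) by simp
qed

lemmas g_near' = g_near g_near[unfolded One_nat_def]

text \<open>All vertices of a side move at once. This is sound because the load of a vertex depends
  on its own level and on levels of the other side, which are fixed meanwhile.\<close>

definition raise_R :: "(nat \<Rightarrow> nat) \<Rightarrow> nat \<Rightarrow> nat" where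
  "raise_R lev v = lev v + (if v \<in> verts 1 \<and> b v * Big < load 1 (xval 0 lev) v then 1 else 0)"

definition raise_L :: "(nat \<Rightarrow> nat) \<Rightarrow> nat \<Rightarrow> nat" where
  "raise_L lev v = lev v + (if v \<in> verts 0 \<and> \<not> b v * Big < load 0 (xval 1 lev) v then 1 else 0)"

text \<open>Approximate complementary slackness: vertices whose level is not extreme are nearly
  tight. The asymmetry is deliberate: L is kept feasible by testing a move before it is made, while
  R reacts to an overload only after it has occurred, so loads in R overshoot and are clipped
  later.\<close>

definition invar :: "nat \<Rightarrow> (nat \<Rightarrow> nat) \<Rightarrow> bool" where
  "invar t lev \<longleftrightarrow>
     (\<forall>u\<in>verts 0. load 0 (xval 0 lev) u \<le> b u * Big \<and> lev u \<le> t \<and>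
       (lev u = t \<or> (D - 1) * (b u * Big) \<le> D * load 0 (xval 0 lev) u)) \<and>
     (\<forall>v\<in>verts 1. lev v \<le> t \<and>
       (lev v = 0 \<or> (D - 1) * (b v * Big) \<le> D * load 1 (xval 0 lev) v) \<and>
       (lev v = t \<or> (D - 1) * load 1 (xval 0 lev) v \<le> D * (b v * Big)))"

lemma load_mono: "(\<And>i. i \<in> inc s v \<Longrightarrow> c * x i \<le> d * y i) \<Longrightarrow> c * load s x v \<le> d * load s y v"
  unfolding load_def sum_distrib_left by (rule sum_mono)

lemma load_mono1: "(\<And>i. i \<in> inc s v \<Longrightarrow> x i \<le> y i) \<Longrightarrow> load s x v \<le> load s y v"
  using load_mono[of s v 1 x 1 y] by simp

lemma verts_disjoint: "v \<in> verts 0 \<Longrightarrow> v \<notin> verts 1"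
  using sides by (auto simp: verts_def)

text \<open>At level 0 every edge has value at most 2 * D, and even all \<open>m\<close> edges
  together fit into \<open>Big\<close>, the capacity of a vertex with budget 1.\<close>

lemma invar_0: "invar 0 (\<lambda>_. 0)"
proof -
  have "load 0 (xval 0 (\<lambda>_. 0)) u \<le> b u * Big" for u
  proof (cases "b u = 0")
    case False
    have "load 0 (xval 0 (\<lambda>_. 0)) u \<le> (\<Sum>i\<in>inc 0 u. 2 * D)"
      unfolding load_def by (intro sum_mono) (auto simp: xval_def g_small)
    also have "\<dots> = card (inc 0 u) * (2 * D)" by simp
    also have "\<dots> \<le> m * (2 * D)"
      using card_mono[of "{..<m}" "inc 0 u"] by (intro mult_right_mono) (auto simp: inc_def)
    also have "\<dots> \<le> 2 * D * D * m" using D by simp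
    also have "\<dots> \<le> b u * Big" using Big False by (cases "b u") auto
    finally show ?thesis .
  qed (auto simp: load_def xval_def inc_def)
  moreover have "load 1 (xval 0 (\<lambda>_. 0)) v \<le> load 1 (xval 0 (\<lambda>_. 0)) v" for v by simp
  ultimately show ?thesis by (auto simp: invar_def)
qed

text \<open>In one round an edge drops by at most one step through its endpoint in R and rises by at
  most one step through its endpoint in L. A vertex of L that stays was stopped by a tentative load
  above its capacity, and its true load is within one step of that; if it moves, its own step makes
  up for all drops, so saturation persists, and the test keeps it feasible. A vertex of R that moves
  was overloaded and loses at most one step; one that stays was feasible and gains at most one
  step.\<close>

lemma invar_step:
  assumes inv: "invar t lev"
  shows "invar (Suc t) (raise_L (raise_R lev))"
proof -
  let ?l1 = "raise_R lev" let ?l2 = "raise_L ?l1"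
  have ep_in: "ep 0 i \<in> verts 0" "ep 1 i \<in> verts 1" "ep 0 i \<notin> verts 1" "ep 1 i \<notin> verts 0" if "i < m" for i
    using that verts_disjoint by (auto simp: verts_def)
  have l1L: "?l1 u = lev u" if "u \<in> verts 0" for u using verts_disjoint[OF that] by (simp add: raise_R_def)
  have l2R: "?l2 v = ?l1 v" if "v \<in> verts 1" for v using verts_disjoint that by (auto simp: raise_L_def)
  have l1: "lev v \<le> ?l1 v" "?l1 v \<le> Suc (lev v)" for v by (auto simp: raise_R_def)
  have l2: "?l1 v \<le> ?l2 v" "?l2 v \<le> Suc (?l1 v)" for v by (auto simp: raise_L_def)
  have Lpart: "load 0 (xval 0 ?l2) u \<le> b u * Big \<and> ?l2 u \<le> Suc t \<and>
       (?l2 u = Suc t \<or> (D - 1) * (b u * Big) \<le> D * load 0 (xval 0 ?l2) u)" if u: "u \<in> verts 0" for u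
  proof -
    have Iu: "load 0 (xval 0 lev) u \<le> b u * Big" "lev u \<le> t"
       "lev u = t \<or> (D - 1) * (b u * Big) \<le> D * load 0 (xval 0 lev) u"
      using inv u unfolding invar_def by blast+
    show ?thesis
    proof (cases "b u * Big < load 0 (xval 1 ?l1) u")
    case True
    then have l2u: "?l2 u = lev u" by (simp add: raise_L_def l1L[OF u])
    have x: "xval 0 ?l2 i \<le> xval 0 lev i" "(D - 1) * xval 1 ?l1 i \<le> D * xval 0 ?l2 i" if "i \<in> inc 0 u" for i
    proof -
      have i: "i < m" "ep 0 i = u" using that by (auto simp: inc_def)
      show "xval 0 ?l2 i \<le> xval 0 lev i"
        using l2u l2R[OF ep_in(2)[OF i(1)]] l1(1)[of "ep 1 i"] i by (auto simp: xval_def intro!: g_antimono)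
      show "(D - 1) * xval 1 ?l1 i \<le> D * xval 0 ?l2 i"
        using l2u l2R[OF ep_in(2)[OF i(1)]] l1L[OF u] i by (auto simp: xval_def intro!: g_near')
    qed
    have "load 0 (xval 0 ?l2) u \<le> load 0 (xval 0 lev) u" by (intro load_mono1 x)
    moreover have "(D - 1) * (b u * Big) \<le> (D - 1) * load 0 (xval 1 ?l1) u" using True by simp
    moreover have "\<dots> \<le> D * load 0 (xval 0 ?l2) u" by (intro load_mono x)
    ultimately show ?thesis using Iu unfolding l2u by (blast intro: le_SucI order_trans)
  next
    case False
    then have l2u: "?l2 u = Suc (lev u)" using u by (simp add: raise_L_def l1L[OF u])
    have x: "xval 0 ?l2 i = xval 1 ?l1 i" "xval 0 lev i \<le> xval 0 ?l2 i" if "i \<in> inc 0 u" for i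
    proof -
      have i: "i < m" "ep 0 i = u" using that by (auto simp: inc_def)
      show "xval 0 ?l2 i = xval 1 ?l1 i"
        using l2u l2R[OF ep_in(2)[OF i(1)]] l1L[OF u] i by (auto simp: xval_def)
      show "xval 0 lev i \<le> xval 0 ?l2 i"
        using l2u l2R[OF ep_in(2)[OF i(1)]] l1(2)[of "ep 1 i"] i by (auto simp: xval_def intro!: g_antimono)
    qed
    have "load 0 (xval 0 ?l2) u \<le> load 0 (xval 1 ?l1) u" using x by (intro load_mono1) simp
    moreover have "load 0 (xval 0 lev) u \<le> load 0 (xval 0 ?l2) u" by (intro load_mono1 x)
    then have "D * load 0 (xval 0 lev) u \<le> D * load 0 (xval 0 ?l2) u" by simp
    ultimately show ?thesis using Iu False unfolding l2u not_less Suc_le_mono nat.inject by (blast intro: order_trans)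
  qed
  qed
  have Rpart: "?l2 v \<le> Suc t \<and> (?l2 v = 0 \<or> (D - 1) * (b v * Big) \<le> D * load 1 (xval 0 ?l2) v) \<and>
       (?l2 v = Suc t \<or> (D - 1) * load 1 (xval 0 ?l2) v \<le> D * (b v * Big))" if v: "v \<in> verts 1" for v
  proof -
    have Iv: "lev v \<le> t" "lev v = 0 \<or> (D - 1) * (b v * Big) \<le> D * load 1 (xval 0 lev) v"
       "lev v = t \<or> (D - 1) * load 1 (xval 0 lev) v \<le> D * (b v * Big)"
      using inv v unfolding invar_def by blast+
    show ?thesis
    proof (cases "b v * Big < load 1 (xval 0 lev) v")
    case True
    then have l2v: "?l2 v = Suc (lev v)" using v by (simp add: raise_R_def l2R[OF v])
    have x: "(D - 1) * xval 0 lev i \<le> D * xval 0 ?l2 i" "xval 0 ?l2 i \<le> xval 0 lev i" if "i \<in> inc 1 v" for i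
    proof -
      have i: "i < m" "ep 1 i = v" using that by (auto simp: inc_def)
      have "lev (ep 0 i) \<le> ?l2 (ep 0 i)" "?l2 (ep 0 i) \<le> Suc (lev (ep 0 i))"
        using l2[of "ep 0 i"] l1L[OF ep_in(1)[OF i(1)]] by auto
      then show "(D - 1) * xval 0 lev i \<le> D * xval 0 ?l2 i" "xval 0 ?l2 i \<le> xval 0 lev i"
        using l2v i by (auto simp: xval_def intro!: g_near' g_antimono)
    qed
    have "(D - 1) * (b v * Big) \<le> (D - 1) * load 1 (xval 0 lev) v" using True by simp
    moreover have "\<dots> \<le> D * load 1 (xval 0 ?l2) v" by (intro load_mono x)
    moreover have "load 1 (xval 0 ?l2) v \<le> load 1 (xval 0 lev) v" by (intro load_mono1 x)
    then have "(D - 1) * load 1 (xval 0 ?l2) v \<le> (D - 1) * load 1 (xval 0 lev) v" by simp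
    ultimately show ?thesis using Iv unfolding l2v Suc_le_mono nat.inject by (blast intro: le_SucI order_trans)
  next
    case False
    then have l2v: "?l2 v = lev v" using v by (simp add: raise_R_def l2R[OF v])
    have x: "(D - 1) * xval 0 ?l2 i \<le> D * xval 0 lev i" "xval 0 lev i \<le> xval 0 ?l2 i" if "i \<in> inc 1 v" for i
    proof -
      have i: "i < m" "ep 1 i = v" using that by (auto simp: inc_def)
      have "lev (ep 0 i) \<le> ?l2 (ep 0 i)" "?l2 (ep 0 i) \<le> Suc (lev (ep 0 i))"
        using l2[of "ep 0 i"] l1L[OF ep_in(1)[OF i(1)]] by auto
      then show "(D - 1) * xval 0 ?l2 i \<le> D * xval 0 lev i" "xval 0 lev i \<le> xval 0 ?l2 i"
        using l2v i by (auto simp: xval_def intro!: g_near' g_antimono)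
    qed
    have "(D - 1) * load 1 (xval 0 ?l2) v \<le> D * load 1 (xval 0 lev) v" by (intro load_mono x)
    moreover have "D * load 1 (xval 0 lev) v \<le> D * (b v * Big)" using False by simp
    moreover have "load 1 (xval 0 lev) v \<le> load 1 (xval 0 ?l2) v" by (intro load_mono1 x)
    then have "D * load 1 (xval 0 lev) v \<le> D * load 1 (xval 0 ?l2) v" by simp
    ultimately show ?thesis using Iv unfolding l2v Suc_le_mono nat.inject by (blast intro: le_SucI order_trans)
  qed
  qed
  show ?thesis unfolding invar_def using Lpart Rpart by blast
qed

text \<open>The value that remains when the edges at each overloaded vertex of R are scaled down to
  its capacity.\<close>

definition clipped :: "(nat \<Rightarrow> nat) \<Rightarrow> nat" where
  "clipped lev = (\<Sum>v\<in>verts 1. min (load 1 (xval 0 lev) v) (b v * Big))"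

text \<open>The D * w0 levels split into \<open>D\<close> bands of width \<open>w0\<close>, and some
  band meets edges of total value only about 1 / D of the whole. With the threshold at that band,
  the covered vertices are nearly saturated and the uncovered edges have full value, while the edges
  covered at both ends, which the dual pays twice, lie in the band or are negligible.\<close>

lemma clipped_ge_dual:
  assumes inv: "invar (D * w0) lev"
  obtains PA PB where "(D - 5) * (Big * dual PA PB) \<le> D * clipped lev"
proof -
  let ?x = "xval 0 lev" let ?T = "D * w0" let ?l = "\<lambda>s v. real (load s (xval 0 lev) v)"
  define q where "q = 1 - 1 / real D"
  have q: "0 < q" "q \<le> 1" "real (D - 1) = q * real D" using D by (auto simp: q_def field_simps)
  define V where "V = real (clipped lev)"
  let ?mn = "\<lambda>v. real (min (load 1 ?x v) (b v * Big))"
  have V: "V = (\<Sum>v\<in>verts 1. ?mn v)" by (simp add: V_def clipped_def)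
  have cancel: "q * real a \<le> real c" if "(D - 1) * a \<le> D * c" for a c :: nat
  proof -
    have "real ((D - 1) * a) \<le> real (D * c)" using that by (simp only: of_nat_le_iff)
    then have "real D * (q * real a) \<le> real D * real c" using q(3) by (simp add: ac_simps)
    then show ?thesis using D by simp
  qed
  have satL: "q * (real (b u) * real Big) \<le> ?l 0 u" if "u \<in> verts 0" "lev u < ?T" for u
  proof -
    have "(D - 1) * (b u * Big) \<le> D * load 0 ?x u" using inv that unfolding invar_def by (metis less_irrefl)
    from cancel[OF this] show ?thesis by (simp only: of_nat_mult)
  qed
  have satR: "q * (real (b v) * real Big) \<le> ?l 1 v" if "v \<in> verts 1" "0 < lev v" for v
  proof -
    have "(D - 1) * (b v * Big) \<le> D * load 1 ?x v" using inv that unfolding invar_def by (metis less_irrefl)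
    from cancel[OF this] show ?thesis by (simp only: of_nat_mult)
  qed
  have capR: "q * ?l 1 v \<le> real (b v) * real Big" if "v \<in> verts 1" "lev v < ?T" for v
  proof -
    have "(D - 1) * load 1 ?x v \<le> D * (b v * Big)" using inv that unfolding invar_def by (metis less_irrefl)
    from cancel[OF this] show ?thesis by (simp only: of_nat_mult)
  qed
  have mn_cap: "q * ?l 1 v \<le> ?mn v" if "v \<in> verts 1" "lev v < ?T" for v
    using capR[OF that] q mult_right_mono[of q 1 "?l 1 v"] by (simp add: min_def)
  have mn_sat: "q * (real (b v) * real Big) \<le> ?mn v" if "v \<in> verts 1" "0 < lev v" for v
    using satR[OF that] q mult_right_mono[of q 1 "real (b v) * real Big"] by (simp add: min_def)
  \<comment> \<open>The edges that can noticeably violate complementary slackness for threshold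
    \<open>i\<close>: their endpoint in R lies strictly inside band \<open>i\<close>.\<close>
  define bad where "bad = (\<lambda>i. \<Sum>j | j < m \<and> i * w0 < lev (ep 1 j) \<and> lev (ep 1 j) < Suc i * w0. ?x j)"
  have uniq: "i = i'" if "i * w0 < l" "l < Suc i * w0" "i' * w0 < l" "l < Suc i' * w0" for i i' l
  proof -
    have "i < Suc i'" "i' < Suc i" using that w0 by (metis less_trans mult_less_cancel2)+
    then show ?thesis by simp
  qed
  \<comment> \<open>The bands are disjoint and lie below the top level, where loads in R exceed
    capacities by at most the factor 1 / q; so all bands together carry at most V / q.\<close>
  have "(\<Sum>i<D. bad i) = (\<Sum>j | j < m \<and> (\<exists>i<D. i * w0 < lev (ep 1 j) \<and> lev (ep 1 j) < Suc i * w0). ?x j)"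
  proof -
    have "(\<Sum>i<D. bad i) = sum ?x (\<Union>i<D. {j. j < m \<and> i * w0 < lev (ep 1 j) \<and> lev (ep 1 j) < Suc i * w0})"
      unfolding bad_def by (rule sum.UNION_disjoint[symmetric]) (use uniq in \<open>simp, simp, blast\<close>)
    also have "(\<Union>i<D. {j. j < m \<and> i * w0 < lev (ep 1 j) \<and> lev (ep 1 j) < Suc i * w0}) =
      {j. j < m \<and> (\<exists>i<D. i * w0 < lev (ep 1 j) \<and> lev (ep 1 j) < Suc i * w0)}" by auto
    finally show ?thesis .
  qed
  also have "\<dots> \<le> (\<Sum>j | j < m \<and> lev (ep 1 j) < ?T. ?x j)"
  proof (rule sum_mono2)
    have "Suc i * w0 \<le> ?T" if "i < D" for i using that by (intro mult_le_mono) auto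
    then show "{j. j < m \<and> (\<exists>i<D. i * w0 < lev (ep 1 j) \<and> lev (ep 1 j) < Suc i * w0)} \<subseteq> {j. j < m \<and> lev (ep 1 j) < ?T}"
      by (auto intro: less_le_trans)
  qed auto
  also have "\<dots> = (\<Sum>v | v \<in> verts 1 \<and> lev v < ?T. load 1 ?x v)" by (rule sum_load[symmetric])
  finally have "q * real (\<Sum>i<D. bad i) \<le> q * real (\<Sum>v | v \<in> verts 1 \<and> lev v < ?T. load 1 ?x v)"
    using q(1) by (intro mult_left_mono) (simp_all only: of_nat_le_iff less_imp_le)
  also have "\<dots> \<le> (\<Sum>v | v \<in> verts 1 \<and> lev v < ?T. ?mn v)"
    unfolding of_nat_sum sum_distrib_left by (rule sum_mono) (use mn_cap in auto)
  also have "\<dots> \<le> V" unfolding V by (rule sum_mono2) auto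
  finally have total: "q * real (\<Sum>i<D. bad i) \<le> V" .
  have "\<exists>i<D. q * real D * real (bad i) \<le> V"
  proof (rule ccontr)
    assume "\<not> ?thesis"
    then have "(\<Sum>i<D. V) < (\<Sum>i<D. q * real D * real (bad i))"
      using D by (intro sum_strict_mono) (auto simp: not_le lessThan_empty_iff)
    also have "\<dots> = real D * (q * real (\<Sum>i<D. bad i))" by (simp add: sum_distrib_left ac_simps)
    also have "\<dots> \<le> real D * V" using total by (intro mult_left_mono) auto
    finally show False by simp
  qed
  then obtain i where i: "i < D" "q * real D * real (bad i) \<le> V" by blast
  \<comment> \<open>Between a vertex of L with lev u \<ge> w0 + i * w0 and one of R with lev v \<le>
    i * w0 the exponent truncates to 0, so uncovered edges have value \<open>Big\<close> (or budget
    0 in L).\<close>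
  define PA where "PA = (\<lambda>u. w0 + i * w0 \<le> lev u)"
  define PB where "PB = (\<lambda>v. lev v \<le> i * w0)"
  have iT: "w0 + i * w0 \<le> ?T" using i(1) mult_le_mono1[of "Suc i" D w0] by simp
  have iT': "i * w0 < ?T" using iT w0 by linarith
  define cAB where "cAB = card {i. i < m \<and> PA (ep 0 i) \<and> PB (ep 1 i) \<and> 0 < b (ep 0 i)}"
  define bL where "bL = (\<Sum>u | u \<in> verts 0 \<and> \<not> PA u. real (b u))"
  define bR where "bR = (\<Sum>v | v \<in> verts 1 \<and> \<not> PB v. real (b v))"
  have dual: "real (dual PA PB) = bL + bR + real cAB"
    by (simp add: dual_def bL_def bR_def cAB_def)
  have AB: "(\<Sum>j | j < m \<and> PA (ep 0 j) \<and> PB (ep 1 j). ?x j) = Big * cAB"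
  proof -
    have "(\<Sum>j | j < m \<and> PA (ep 0 j) \<and> PB (ep 1 j). ?x j) =
       (\<Sum>j | j < m \<and> PA (ep 0 j) \<and> PB (ep 1 j) \<and> 0 < b (ep 0 j). Big)"
      by (rule sum.mono_neutral_cong_right) (auto simp: xval_def PA_def PB_def g0)
    then show ?thesis by (simp add: cAB_def)
  qed
  \<comment> \<open>An edge covered at both ends has lev u < w0 + i * w0 and lev v > i * w0. Either
    lev v lies in the band, or it is at least w0 + i * w0 and hence above lev u, so that the
    exponent is at least \<open>w0\<close>.\<close>
  have Z: "(\<Sum>j | j < m \<and> \<not> PA (ep 0 j) \<and> \<not> PB (ep 1 j). ?x j) \<le> bad i + 2 * D * m"
  proof -
    let ?S = "{j. j < m \<and> \<not> PA (ep 0 j) \<and> \<not> PB (ep 1 j)}"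
    let ?B = "{j. j < m \<and> i * w0 < lev (ep 1 j) \<and> lev (ep 1 j) < Suc i * w0}"
    have "sum ?x ?S = sum ?x (?S \<inter> ?B) + sum ?x (?S - ?B)"
    proof -
      have "sum ?x ((?S \<inter> ?B) \<union> (?S - ?B)) = sum ?x (?S \<inter> ?B) + sum ?x (?S - ?B)"
        by (rule sum.union_disjoint) auto
      then show ?thesis by (simp only: Int_Diff_Un)
    qed
    moreover have "sum ?x (?S \<inter> ?B) \<le> bad i" unfolding bad_def by (rule sum_mono2) auto
    moreover have "sum ?x (?S - ?B) \<le> (\<Sum>j\<in>?S - ?B. 2 * D)"
    proof (rule sum_mono)
      fix j assume j: "j \<in> ?S - ?B"
      then have "lev (ep 0 j) \<le> lev (ep 1 j)" by (auto simp: PA_def PB_def)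
      then show "?x j \<le> 2 * D" by (auto simp: xval_def g_small)
    qed
    moreover have "(\<Sum>j\<in>?S - ?B. 2 * D) = card (?S - ?B) * (2 * D)" by simp
    moreover have "card (?S - ?B) * (2 * D) \<le> card {..<m} * (2 * D)" by (intro mult_le_mono1 card_mono) auto
    moreover have "card {..<m} * (2 * D) = 2 * D * m" by simp
    ultimately show ?thesis by linarith
  qed
  \<comment> \<open>Both sides count the edges that satisfy \<open>PB\<close> at R or fail
    \<open>PA\<close> at L. This converts saturation in L into load at the vertices of R satisfying
    \<open>PB\<close>, where clipping loses at most the factor \<open>q\<close>.\<close>
  have "(\<Sum>j | j < m \<and> PB (ep 1 j). ?x j) + (\<Sum>j | j < m \<and> \<not> PA (ep 0 j) \<and> \<not> PB (ep 1 j). ?x j) =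
      (\<Sum>j | j < m \<and> PA (ep 0 j) \<and> PB (ep 1 j). ?x j) + (\<Sum>j | j < m \<and> \<not> PA (ep 0 j). ?x j)"
  proof -
    have 1: "(\<Sum>j | j < m \<and> PB (ep 1 j). ?x j) = (\<Sum>j | j < m \<and> PA (ep 0 j) \<and> PB (ep 1 j). ?x j) +
       (\<Sum>j | j < m \<and> \<not> PA (ep 0 j) \<and> PB (ep 1 j). ?x j)"
      using sum_cases[where A = "{j. j < m \<and> PB (ep 1 j)}" and P = "\<lambda>j. PA (ep 0 j)" and f = ?x] by (simp add: conj_commute conj_left_commute)
    have 2: "(\<Sum>j | j < m \<and> \<not> PA (ep 0 j). ?x j) = (\<Sum>j | j < m \<and> \<not> PA (ep 0 j) \<and> PB (ep 1 j). ?x j) +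
       (\<Sum>j | j < m \<and> \<not> PA (ep 0 j) \<and> \<not> PB (ep 1 j). ?x j)"
      using sum_cases[where A = "{j. j < m \<and> \<not> PA (ep 0 j)}" and P = "\<lambda>j. PB (ep 1 j)" and f = ?x] by (simp add: conj_commute conj_left_commute)
    show ?thesis unfolding 1 2 by simp
  qed
  then have "Big * cAB + (\<Sum>j | j < m \<and> \<not> PA (ep 0 j). ?x j) \<le>
      (\<Sum>j | j < m \<and> PB (ep 1 j). ?x j) + (bad i + 2 * D * m)"
    using Z unfolding AB by linarith
  then have "real (Big * cAB + (\<Sum>j | j < m \<and> \<not> PA (ep 0 j). ?x j)) \<le>
      real ((\<Sum>j | j < m \<and> PB (ep 1 j). ?x j) + (bad i + 2 * D * m))"
    by (simp only: of_nat_le_iff)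
  then have "real (\<Sum>j | j < m \<and> PB (ep 1 j). ?x j) \<ge> real Big * real cAB +
     real (\<Sum>j | j < m \<and> \<not> PA (ep 0 j). ?x j) - real (bad i) - 2 * real D * real m"
    by (simp only: of_nat_add of_nat_mult of_nat_numeral)
  moreover have "real (\<Sum>j | j < m \<and> \<not> PA (ep 0 j). ?x j) \<ge> q * real Big * bL"
  proof -
    have "q * real Big * bL = (\<Sum>u | u \<in> verts 0 \<and> \<not> PA u. q * (real (b u) * real Big))"
      by (simp add: bL_def sum_distrib_left ac_simps)
    also have "\<dots> \<le> (\<Sum>u | u \<in> verts 0 \<and> \<not> PA u. ?l 0 u)"
      using satL iT by (intro sum_mono) (auto simp: PA_def)
    also have "\<dots> = real (\<Sum>j | j < m \<and> \<not> PA (ep 0 j). ?x j)"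
      unfolding of_nat_sum[symmetric] by (simp only: sum_load)
    finally show ?thesis .
  qed
  ultimately have Rload: "real (\<Sum>j | j < m \<and> PB (ep 1 j). ?x j) \<ge>
     real Big * real cAB + q * real Big * bL - real (bad i) - 2 * real D * real m" by linarith
  have "V = (\<Sum>v | v \<in> verts 1 \<and> PB v. ?mn v) + (\<Sum>v | v \<in> verts 1 \<and> \<not> PB v. ?mn v)"
    unfolding V using sum_cases[where A = "verts 1" and P = PB and f = ?mn] by simp
  moreover have "(\<Sum>v | v \<in> verts 1 \<and> \<not> PB v. ?mn v) \<ge> (\<Sum>v | v \<in> verts 1 \<and> \<not> PB v. q * (real (b v) * real Big))"
    by (rule sum_mono) (use mn_sat in \<open>auto simp: PB_def\<close>)
  moreover have "(\<Sum>v | v \<in> verts 1 \<and> \<not> PB v. q * (real (b v) * real Big)) = q * real Big * bR"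
    by (simp add: bR_def sum_distrib_left ac_simps)
  moreover have "(\<Sum>v | v \<in> verts 1 \<and> PB v. ?mn v) \<ge> (\<Sum>v | v \<in> verts 1 \<and> PB v. q * ?l 1 v)"
    by (rule sum_mono) (use mn_cap le_less_trans[OF _ iT'] in \<open>auto simp: PB_def\<close>)
  moreover have "(\<Sum>v | v \<in> verts 1 \<and> PB v. q * ?l 1 v) = q * real (\<Sum>j | j < m \<and> PB (ep 1 j). ?x j)"
    unfolding sum_distrib_left[symmetric] of_nat_sum[symmetric] by (simp only: sum_load)
  ultimately have V1: "V \<ge> q * real Big * bR +
      q * (real Big * real cAB + q * real Big * bL - real (bad i) - 2 * real D * real m)"
    using mult_left_mono[OF Rload, of q] q by linarith
  let ?\<Delta> = "real (dual PA PB)"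
  have nonneg: "0 \<le> bL" "0 \<le> bR" by (auto simp: bL_def bR_def intro!: sum_nonneg)
  have "real D * V \<ge> real D * (q * real Big * bR +
      q * (real Big * real cAB + q * real Big * bL - real (bad i) - 2 * real D * real m))"
    using V1 by (intro mult_left_mono) auto
  moreover have "q * q * real Big * (bL + bR + real cAB) \<le> q * real Big * bR + q * (real Big * real cAB) + q * (q * real Big * bL)"
  proof -
    have "q * (q * (real Big * bR)) \<le> q * (1 * (real Big * bR))" "q * (q * (real Big * real cAB)) \<le> q * (1 * (real Big * real cAB))"
      by (intro mult_left_mono mult_right_mono; use q nonneg in simp)+
    then show ?thesis by (simp add: algebra_simps)
  qed
  then have "real D * (q * q * real Big * ?\<Delta>) \<le> real D * (q * real Big * bR + q * (real Big * real cAB) + q * (q * real Big * bL))"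
    unfolding dual by (intro mult_left_mono) auto
  ultimately have V2: "real D * V \<ge> real D * (q * q * real Big * ?\<Delta>) - q * real D * real (bad i) - q * (2 * real D * real D * real m)"
    by (simp add: algebra_simps)
  \<comment> \<open>The lower bound on \<open>Big\<close> enters here: a positive dual value is at
    least 1, so it outweighs the negligible edges.\<close>
  have "dual PA PB = 0 \<or> q * (2 * real D * real D * real m) \<le> real Big * ?\<Delta>"
  proof (cases "dual PA PB = 0")
    case False
    have "q * (2 * real D * real D * real m) \<le> 1 * (2 * real D * real D * real m)"
      using q by (intro mult_right_mono) auto
    also have "\<dots> = real (2 * D * D * m)" by simp
    also have "\<dots> \<le> real Big" using Big by (simp only: of_nat_le_iff)
    also have "\<dots> \<le> real Big * ?\<Delta>" using False mult_left_mono[of 1 ?\<Delta> "real Big"] by simp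
    finally show ?thesis by simp
  qed simp
  then have V3: "dual PA PB = 0 \<or> (real D + 1) * V \<ge> (real D * (q * q) - 1) * (real Big * ?\<Delta>)"
    using V2 i(2) by (auto simp: algebra_simps)
  have "(D - 5) * (Big * dual PA PB) \<le> D * clipped lev"
  proof (cases "dual PA PB = 0")
    case False
    \<comment> \<open>Two factors \<open>q\<close>, the band and the negligible edges lose about 1 /
      D each; the constant 5 also absorbs the terms of lower order.\<close>
    have r: "(real D + 1) * (real D - 5) \<le> real D * (real D * (q * q) - 1)"
      using D by (simp add: q_def field_simps)
    have "(real D + 1) * ((real D - 5) * (real Big * ?\<Delta>)) \<le> real D * ((real D * (q * q) - 1) * (real Big * ?\<Delta>))"
      using mult_right_mono[OF r, of "real Big * ?\<Delta>"] by (simp add: ac_simps)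
    also have "\<dots> \<le> real D * ((real D + 1) * V)" using V3 False by (intro mult_left_mono) auto
    also have "\<dots> = (real D + 1) * (real D * V)" by simp
    finally have "(real D - 5) * (real Big * ?\<Delta>) \<le> real D * V"
      by (rule mult_left_le_imp_le) simp
    moreover have "real D - 5 = real (D - 5)" using D by simp
    ultimately have "real ((D - 5) * (Big * dual PA PB)) \<le> real (D * clipped lev)"
      unfolding V_def by (simp only: of_nat_mult)
    then show ?thesis by (simp only: of_nat_le_iff)
  qed simp
  then show ?thesis by (rule that)
qed

end

section \<open>Integer geometric decay, orbits of two involutions, and halving of the unit\<close>

section \<open>Alternating colorings and halving\<close>

text \<open>Multiplication by 1 - 1/D with rounding up. Values below \<open>D\<close> are fixed by
  it, so the sequence need not tend to 0 and the tail is only bounded by 2 * D.\<close>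

fun decay :: "nat \<Rightarrow> nat \<Rightarrow> nat \<Rightarrow> nat" where
  "decay B D 0 = B"
| "decay B D (Suc k) = decay B D k - decay B D k div D"

lemma decay_Suc_le: "decay B D (Suc k) \<le> decay B D k"
  by simp

lemma decay_antimono: "i \<le> j \<Longrightarrow> decay B D j \<le> decay B D i"
  using decay_Suc_le by (rule lift_Suc_antimono_le)

lemma decay_le: "decay B D k \<le> B"
  using decay_antimono[of 0 k B D] by simp

lemma decay_near: "(D - 1) * decay B D k \<le> D * decay B D (Suc k)"
proof -
  have "D * (decay B D k div D) \<le> decay B D k" by simp
  from diff_le_mono2[OF this, of "D * decay B D k"] show ?thesis
    by (simp add: diff_mult_distrib diff_mult_distrib2)
qed

text \<open>Rounding adds less than 1 per step, and \<open>D\<close> solves x = (1 - 1/D) * x + 1,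
  so the accumulated rounding never exceeds \<open>D\<close>.\<close>

lemma decay_real:
  assumes "0 < D"
  shows "real (decay B D k) \<le> real D + (1 - 1 / real D) ^ k * real B"
proof (induction k)
  case (Suc k)
  let ?x = "decay B D k"
  have "real ?x = real D * real (?x div D) + real (?x mod D)"
    by (metis of_nat_add of_nat_mult mult_div_mod_eq)
  moreover have "real (?x mod D) \<le> real D - 1" using assms mod_less_divisor[of D ?x] by linarith
  ultimately have "real ?x / real D - 1 \<le> real (?x div D)" using assms by (simp add: field_simps)
  then have "real (decay B D (Suc k)) \<le> (1 - 1 / real D) * real ?x + 1"
    by (simp add: of_nat_diff algebra_simps)
  also have "\<dots> \<le> (1 - 1 / real D) * (real D + (1 - 1 / real D) ^ k * real B) + 1"
    using Suc assms by (intro add_right_mono mult_left_mono) (auto simp: field_simps)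
  also have "\<dots> = real D + (1 - 1 / real D) ^ Suc k * real B" using assms by (simp add: field_simps)
  finally show ?case .
qed simp

text \<open>As (1 - 1/D) ^ D \<le> 1/2, the first 6 * D * lg steps divide by at least N ^ 6. This
  takes 12 * D * N ^ 4 to 12 * D / N ^ 2, which is below \<open>D\<close> because N \<ge> 4;
  rounding contributes the other \<open>D\<close>.\<close>

lemma decay_small:
  assumes D: "1 < D" and N: "N = 2 ^ lg" "4 \<le> N" and k: "6 * D * lg \<le> k"
  shows "decay (12 * D * N ^ 4) D k \<le> 2 * D"
proof -
  let ?r = "1 - 1 / real D"
  have r: "0 \<le> ?r" "?r \<le> exp (- 1 / real D)" using D exp_ge_add_one_self[of "- 1 / real D"] by auto
  have "?r ^ D \<le> exp (- 1 / real D) ^ D" using r by (intro power_mono) auto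
  also have "\<dots> = exp (- 1)" using D by (simp flip: exp_of_nat_mult)
  also have "\<dots> \<le> 1 / 2" using exp_ge_add_one_self[of 1] by (simp add: exp_minus field_simps)
  finally have half: "?r ^ D \<le> 1 / 2" .
  have "?r ^ (6 * D * lg) = (?r ^ D) ^ (6 * lg)" by (simp add: power_mult[symmetric] ac_simps)
  also have "\<dots> \<le> (1 / 2) ^ (6 * lg)" using half r by (intro power_mono) auto
  also have "\<dots> = 1 / (real N) ^ 6" unfolding N by (simp add: power_one_over power_mult[symmetric] mult.commute)
  finally have "?r ^ (6 * D * lg) * real (12 * D * N ^ 4) \<le> 1 / real N ^ 6 * real (12 * D * N ^ 4)"
    by (intro mult_right_mono) auto
  also have "\<dots> = 12 * real D / real N ^ 2" using N(2) by (simp add: field_simps power_add[symmetric])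
  also have "\<dots> \<le> real D"
  proof -
    have "(4::real) ^ 2 \<le> real N ^ 2" using N(2) by (intro power_mono) auto
    then have "12 * real D \<le> real D * real N ^ 2" by (simp add: mult_mono mult.commute)
    then show ?thesis using N(2) by (simp add: field_simps)
  qed
  finally have "?r ^ (6 * D * lg) * real (12 * D * N ^ 4) \<le> real D" .
  moreover have "0 < D" using D by simp
  note decay_real[OF this, of "12 * D * N ^ 4" "6 * D * lg"]
  ultimately have "real (decay (12 * D * N ^ 4) D (6 * D * lg)) \<le> 2 * real D" by linarith
  then have "decay (12 * D * N ^ 4) D (6 * D * lg) \<le> 2 * D" by linarith
  with decay_antimono[OF k, of _ D] show ?thesis using order_trans by blast
qed

text \<open>\<open>t0\<close> and \<open>t1\<close> stand for the pairings at L and at R. Together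
  they form even cycles, and rounding needs a 2-coloring that alternates along each cycle. The
  rotation \<open>\<sigma>\<close> moves two steps along a cycle, so its orbits are the two color
  classes of the cycle, and comparing their minima breaks the symmetry. \<open>K\<close> iterates
  exhaust an orbit as \<open>card S \<le> K\<close>.\<close>

locale two_involutions =
  fixes S :: "nat set" and t0 t1 :: "nat \<Rightarrow> nat" and K :: nat
  assumes S: "finite S" "card S \<le> K"
    and t0: "x \<in> S \<Longrightarrow> t0 x \<in> S" "x \<in> S \<Longrightarrow> t0 (t0 x) = x" "x \<in> S \<Longrightarrow> t0 x \<noteq> x"
    and t1: "x \<in> S \<Longrightarrow> t1 x \<in> S" "x \<in> S \<Longrightarrow> t1 (t1 x) = x" "x \<in> S \<Longrightarrow> t1 x \<noteq> x"
begin

definition \<sigma> :: "nat \<Rightarrow> nat" where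
  "\<sigma> x = t1 (t0 x)"

definition orbit_min :: "nat \<Rightarrow> nat" where
  "orbit_min x = Min ((\<lambda>i. (\<sigma> ^^ i) x) ` {..<K})"

definition color :: "nat \<Rightarrow> bool" where
  "color x \<longleftrightarrow> orbit_min x < orbit_min (t0 x)"

lemma \<sigma>_in: "x \<in> S \<Longrightarrow> \<sigma> x \<in> S"
  by (simp add: \<sigma>_def t0 t1)

lemma pow_in: "x \<in> S \<Longrightarrow> (\<sigma> ^^ i) x \<in> S"
  by (induction i) (auto simp: \<sigma>_in)

lemma \<sigma>_inj: "x \<in> S \<Longrightarrow> y \<in> S \<Longrightarrow> \<sigma> x = \<sigma> y \<Longrightarrow> x = y"
  unfolding \<sigma>_def by (metis t0 t1(2))

lemma pow_inj: "x \<in> S \<Longrightarrow> y \<in> S \<Longrightarrow> (\<sigma> ^^ i) x = (\<sigma> ^^ i) y \<Longrightarrow> x = y"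
  by (induction i) (auto dest!: \<sigma>_inj[rotated 2] simp: pow_in)

text \<open>Pigeonhole makes two iterates coincide, and injectivity shifts the coincidence back to
  \<open>x\<close>.\<close>

lemma period:
  assumes "x \<in> S"
  obtains p where "0 < p" "p \<le> K" "(\<sigma> ^^ p) x = x"
proof -
  have "card ((\<lambda>i. (\<sigma> ^^ i) x) ` {..K}) \<le> card S"
    using pow_in[OF assms] S by (intro card_mono) auto
  also have "\<dots> < card {..K}" using S by simp
  finally have "\<not> inj_on (\<lambda>i. (\<sigma> ^^ i) x) {..K}" by (rule pigeonhole)
  then obtain i j where "i \<noteq> j" "i \<le> K" "j \<le> K" "(\<sigma> ^^ i) x = (\<sigma> ^^ j) x"
    by (auto simp: inj_on_def)
  then obtain i j where ij: "i < j" "j \<le> K" "(\<sigma> ^^ i) x = (\<sigma> ^^ j) x"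
    by (metis linorder_neqE_nat)
  then have "(\<sigma> ^^ i) x = (\<sigma> ^^ i) ((\<sigma> ^^ (j - i)) x)"
    by (metis comp_apply funpow_add le_add_diff_inverse less_imp_le)
  then have "x = (\<sigma> ^^ (j - i)) x" using pow_inj assms pow_in by blast
  with ij that[of "j - i"] show ?thesis by simp
qed

lemma pow_lt:
  assumes "x \<in> S"
  shows "\<exists>j<K. (\<sigma> ^^ i) x = (\<sigma> ^^ j) x"
proof -
  obtain p where p: "0 < p" "p \<le> K" "(\<sigma> ^^ p) x = x" using period[OF assms] by blast
  have "(\<sigma> ^^ i) x = (\<sigma> ^^ (i mod p)) x" using p(3) by (simp add: funpow_mod_eq)
  moreover have "i mod p < K" using p by (metis less_le_trans mod_less_divisor)
  ultimately show ?thesis by blast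
qed

definition orb :: "nat \<Rightarrow> nat set" where
  "orb x = range (\<lambda>i. (\<sigma> ^^ i) x)"

lemma \<sigma>_in_orb: "\<sigma> x \<in> orb x"
  unfolding orb_def by (rule range_eqI[of _ _ 1]) simp

lemma orb_eq: "x \<in> S \<Longrightarrow> orb x = (\<lambda>i. (\<sigma> ^^ i) x) ` {..<K}"
  unfolding orb_def using pow_lt by force

text \<open>Periodicity allows running an orbit backwards: \<open>x\<close> is reached from
  \<open>y\<close> by completing a multiple of the period.\<close>

lemma orb_same:
  assumes "x \<in> S" "y \<in> orb x"
  shows "orb y = orb x"
proof -
  obtain i where i: "y = (\<sigma> ^^ i) x" using assms by (auto simp: orb_def)
  have sub: "orb y \<subseteq> orb x" unfolding orb_def i by (auto simp flip: funpow_add comp_apply[of "_ ^^ _" "_ ^^ _"])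
  obtain p where p: "0 < p" "(\<sigma> ^^ p) x = x" using period[OF assms(1)] by blast
  have "(\<sigma> ^^ (p * i)) x = x" using p by (induction i) (simp_all add: funpow_add)
  moreover have "i \<le> p * i" using p by simp
  then obtain k where "p * i = k + i" by (metis add.commute le_Suc_ex)
  ultimately have "x = (\<sigma> ^^ k) y" by (simp add: i funpow_add)
  then have "orb x \<subseteq> orb y" unfolding orb_def by (auto simp flip: funpow_add comp_apply[of "_ ^^ _" "_ ^^ _"])
  with sub show ?thesis by blast
qed

lemma orbit_min_in: "x \<in> S \<Longrightarrow> orbit_min x \<in> orb x"
proof -
  assume x: "x \<in> S"
  obtain p where "0 < p" "p \<le> K" using period[OF x] by blast
  then have "(\<lambda>i. (\<sigma> ^^ i) x) ` {..<K} \<noteq> {}" by (auto simp: lessThan_empty_iff)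
  then show ?thesis unfolding orbit_min_def orb_eq[OF x] by (intro Min_in) auto
qed

lemma orbit_min_same: "x \<in> S \<Longrightarrow> y \<in> S \<Longrightarrow> orb x = orb y \<Longrightarrow> orbit_min x = orbit_min y"
  by (simp add: orbit_min_def orb_eq[symmetric])

text \<open>The dihedral relation: conjugation by the reflection \<open>t0\<close> inverts the
  rotation \<open>\<sigma>\<close>.\<close>

lemma t0_pow: "x \<in> S \<Longrightarrow> (\<sigma> ^^ i) (t0 ((\<sigma> ^^ i) x)) = t0 x"
proof (induction i)
  case (Suc i)
  let ?y = "(\<sigma> ^^ i) x"
  have y: "?y \<in> S" using pow_in Suc by blast
  have "\<sigma> (t0 (\<sigma> ?y)) = t0 ?y" using t0 t1 y by (simp add: \<sigma>_def)
  then show ?case using Suc by (simp add: funpow_swap1)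
qed simp

text \<open>A reflection of a dihedral action by two fixpoint-free involutions never coincides with a rotation.\<close>

lemma t0_notin_orb:
  assumes x: "x \<in> S"
  shows "t0 x \<notin> orb x"
proof
  assume "t0 x \<in> orb x"
  then obtain i where i: "t0 x = (\<sigma> ^^ i) x" by (auto simp: orb_def)
  \<comment> \<open>The midpoint of the way from \<open>x\<close> to \<open>t0 x\<close> yields a
    fixpoint: \<open>?y\<close> is fixed by \<open>t0\<close> if \<open>i\<close> is even, and
    \<open>t0 ?y\<close> by \<open>t1\<close> if \<open>i\<close> is odd.\<close>
  define k where "k = i div 2"
  let ?y = "(\<sigma> ^^ k) x"
  have y: "?y \<in> S" using pow_in x by blast
  have "(\<sigma> ^^ k) (t0 ?y) = (\<sigma> ^^ i) x" using t0_pow[OF x] i by simp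
  moreover have "i = k + (i - k)" by (simp add: k_def)
  then have "(\<sigma> ^^ i) x = (\<sigma> ^^ k) ((\<sigma> ^^ (i - k)) x)" by (metis comp_apply funpow_add)
  ultimately have e: "t0 ?y = (\<sigma> ^^ (i - k)) x"
    using pow_inj[of "t0 ?y" "(\<sigma> ^^ (i - k)) x" k] pow_in[OF x] t0(1)[OF y] by simp
  show False
  proof (cases "even i")
    case True
    then have "i - k = k" by (auto simp: k_def)
    with e t0(3)[OF y] show False by simp
  next
    case False
    then have "i - k = Suc k" by (auto simp: k_def elim: oddE)
    with e have "t0 ?y = t1 (t0 ?y)" by (simp add: \<sigma>_def)
    with t1(3)[OF t0(1)[OF y]] show False by simp
  qed
qed

lemma color_t0: "x \<in> S \<Longrightarrow> color (t0 x) \<longleftrightarrow> \<not> color x"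
proof -
  assume x: "x \<in> S"
  have "orbit_min x \<noteq> orbit_min (t0 x)"
  proof
    assume "orbit_min x = orbit_min (t0 x)"
    then have "orbit_min x \<in> orb x" "orbit_min x \<in> orb (t0 x)"
      using orbit_min_in[OF x] orbit_min_in[OF t0(1)[OF x]] by auto
    then have "orb x = orb (t0 x)" using orb_same x t0(1) by metis
    moreover have "t0 x \<in> orb (t0 x)" unfolding orb_def by (rule range_eqI[of _ _ 0]) simp
    ultimately show False using t0_notin_orb[OF x] by simp
  qed
  then show ?thesis using x by (auto simp: color_def t0)
qed

text \<open>Both orbits that the color compares stay the same: \<open>\<sigma>\<close> moves forward
  on the orbit of \<open>x\<close> and backward on that of \<open>t0 x\<close>.\<close>

lemma color_\<sigma>: "x \<in> S \<Longrightarrow> color (\<sigma> x) = color x"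
proof -
  assume x: "x \<in> S"
  have "orb (\<sigma> x) = orb x"
    using orb_same[OF x \<sigma>_in_orb] .
  then have "orbit_min (\<sigma> x) = orbit_min x" by (intro orbit_min_same) (auto simp: x \<sigma>_in)
  moreover have "\<sigma> (t0 (\<sigma> x)) = t0 x" using x by (simp add: \<sigma>_def t0 t1)
  then have "t0 x \<in> orb (t0 (\<sigma> x))" using \<sigma>_in_orb[of "t0 (\<sigma> x)"] by simp
  then have "orb (t0 x) = orb (t0 (\<sigma> x))" using orb_same[of "t0 (\<sigma> x)"] x by (simp add: \<sigma>_in t0)
  then have "orbit_min (t0 (\<sigma> x)) = orbit_min (t0 x)" by (intro orbit_min_same) (auto simp: x \<sigma>_in t0)
  ultimately show ?thesis by (simp add: color_def)
qed

lemma color_t1: "x \<in> S \<Longrightarrow> color (t1 x) \<longleftrightarrow> \<not> color x"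
  using color_\<sigma>[of "t0 x"] color_t0[of x] by (simp add: \<sigma>_def t0)

end

text \<open>Every element is doubled; a fixpoint of the pairing is matched with its own copy, which makes
  the involution fixpoint-free.\<close>

definition double :: "(nat \<Rightarrow> nat) \<Rightarrow> nat \<Rightarrow> nat" where
  "double p x = (if p (x div 2) \<noteq> x div 2 then 2 * p (x div 2) + x mod 2 else 2 * (x div 2) + (1 - x mod 2))"

lemma double_involution:
  assumes p: "\<And>e. e \<in> F \<Longrightarrow> p e \<in> F \<and> p (p e) = e" and x: "x div 2 \<in> F"
  shows "double p x div 2 \<in> F" "double p (double p x) = x" "double p x \<noteq> x"
proof -
  have m: "x mod 2 = 0 \<or> x mod 2 = 1" by auto
  have e: "x = 2 * (x div 2) + x mod 2" by simp
  show "double p x div 2 \<in> F" using m p[OF x] x by (auto simp: double_def)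
  show "double p x \<noteq> x"
  proof (cases "p (x div 2) = x div 2")
    case True
    have "double p x mod 2 = 1 - x mod 2" using True m by (auto simp: double_def)
    with m show ?thesis by auto
  next
    case False
    then have "double p x div 2 = p (x div 2)" using m by (auto simp: double_def)
    with False show ?thesis by auto
  qed
  show "double p (double p x) = x"
  proof (cases "p (x div 2) = x div 2")
    case True
    have "double p x div 2 = x div 2" "double p x mod 2 = 1 - x mod 2" using True m by (auto simp: double_def)
    moreover obtain k where "x = 2 * k \<or> x = 2 * k + 1"
      by (metis evenE oddE)
    ultimately show ?thesis using True by (auto simp: double_def)
  next
    case False
    then have "double p x div 2 = p (x div 2)" "double p x mod 2 = x mod 2" using m by (auto simp: double_def)
    moreover have "p (p (x div 2)) \<noteq> p (x div 2)" using p[OF x] False by simp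
    ultimately show ?thesis using p[OF x] by (simp add: double_def)
  qed
qed

context edges
begin

text \<open>The loads are integral multiples of the unit, so a vertex with an odd number of rounded
  edges has room for one more half unit.\<close>

lemma halving_fractional:
  assumes y: "fractional (2 * U) y"
    and pr: "\<And>s e. s < 2 \<Longrightarrow> e < m \<Longrightarrow> odd (y e) \<Longrightarrow> p s e < m \<and> odd (y (p s e)) \<and> ep s (p s e) = ep s e \<and> p s (p s e) = e"
    and fx: "\<And>s e f. s < 2 \<Longrightarrow> e < m \<Longrightarrow> f < m \<Longrightarrow> odd (y e) \<Longrightarrow> odd (y f) \<Longrightarrow> p s e = e \<Longrightarrow> p s f = f \<Longrightarrow>
       ep s e = ep s f \<Longrightarrow> e = f"
    and c: "\<And>s e. s < 2 \<Longrightarrow> e < m \<Longrightarrow> odd (y e) \<Longrightarrow> p s e \<noteq> e \<Longrightarrow> c (p s e) \<noteq> c e"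
  shows "fractional U (\<lambda>e. y e div 2 + of_bool (odd (y e) \<and> c e))"
  unfolding fractional_def
proof (intro conjI allI impI)
  fix e assume "e < m"
  then have "y e \<le> 2 * U" using y by (simp add: fractional_def)
  then show "y e div 2 + of_bool (odd (y e) \<and> c e) \<le> U"
    by (auto elim!: oddE)
next
  fix s v :: nat assume s: "s < 2"
  define Od where "Od = {e \<in> inc s v. odd (y e)}"
  define Pl where "Pl = {e \<in> Od. c e}"
  define Mi where "Mi = {e \<in> Od. \<not> c e}"
  have fin: "finite Od" "finite Pl" "finite Mi" by (auto simp: Od_def Pl_def Mi_def)
  have Od: "e < m \<and> odd (y e) \<and> ep s e = v" if "e \<in> Od" for e using that by (auto simp: Od_def inc_def)
  have pO: "p s e \<in> Od" if "e \<in> Od" for e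
    using Od[OF that] pr[OF s] by (auto simp: Od_def inc_def)
  \<comment> \<open>At most one edge that is rounded up is unpaired at the vertex; every other one
    has a partner that is rounded down.\<close>
  have "card Pl \<le> card Mi + 1"
  proof -
    have "card {e \<in> Pl. p s e = e} \<le> 1"
    proof -
      have "e = f" if "e \<in> {e \<in> Pl. p s e = e}" "f \<in> {e \<in> Pl. p s e = e}" for e f
        using that Od[of e] Od[of f] fx[OF s] by (auto simp: Pl_def)
      then show ?thesis using fin(2) unfolding One_nat_def by (subst card_le_Suc0_iff_eq) auto
    qed
    moreover have "card {e \<in> Pl. p s e \<noteq> e} \<le> card Mi"
    proof (rule card_inj_on_le[of "p s"])
      show "inj_on (p s) {e \<in> Pl. p s e \<noteq> e}"
        by (rule inj_on_inverseI[of _ "p s"]) (use Od pr[OF s] in \<open>auto simp: Pl_def\<close>)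
      show "p s ` {e \<in> Pl. p s e \<noteq> e} \<subseteq> Mi"
        using pO c[OF s] Od by (auto simp: Pl_def Mi_def)
    qed (use fin in auto)
    moreover have "card Pl \<le> card {e \<in> Pl. p s e = e} + card {e \<in> Pl. p s e \<noteq> e}"
      by (rule order_trans[OF card_mono card_Un_le]) (use fin in auto)
    ultimately show ?thesis by linarith
  qed
  moreover have "card Od = card Pl + card Mi"
  proof -
    have "Od = Pl \<union> Mi" "Pl \<inter> Mi = {}" by (auto simp: Pl_def Mi_def)
    then show ?thesis using card_Un_disjoint[of Pl Mi] fin by simp
  qed
  ultimately have Pl: "2 * card Pl \<le> card Od + 1" by linarith
  have "load s y v = (\<Sum>e\<in>inc s v. 2 * (y e div 2) + of_bool (odd (y e)))"
    unfolding load_def by (intro sum.cong) (auto simp: odd_iff_mod_2_eq_one[symmetric] elim!: oddE)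
  also have "\<dots> = 2 * (\<Sum>e\<in>inc s v. y e div 2) + card Od"
    by (simp add: sum.distrib sum_distrib_left Od_def Int_def)
  finally have eq: "load s y v = 2 * (\<Sum>e\<in>inc s v. y e div 2) + card Od" .
  have ld: "2 * (\<Sum>e\<in>inc s v. y e div 2) + card Od \<le> b v * (2 * U)"
    unfolding eq[symmetric] using y s unfolding fractional_def by blast
  have "load s (\<lambda>e. y e div 2 + of_bool (odd (y e) \<and> c e)) v = (\<Sum>e\<in>inc s v. y e div 2) + card Pl"
    unfolding load_def by (simp add: sum.distrib Pl_def Od_def Int_def conj_assoc)
  \<comment> \<open>The surplus of half a new unit vanishes because the capacity
    \<open>b v * U\<close> is an integer.\<close>
  also have "\<dots> \<le> b v * U"
  proof -
    have "a \<le> c" if "2 * a \<le> 2 * c + 1" for a c :: nat using that by arith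
    moreover have "2 * ((\<Sum>e\<in>inc s v. y e div 2) + card Pl) \<le> 2 * (b v * U) + 1" using ld Pl by simp
    ultimately show ?thesis by blast
  qed
  finally show "load s (\<lambda>e. y e div 2 + of_bool (odd (y e) \<and> c e)) v \<le> b v * U" .
qed

text \<open>Rounding up at least half of the odd edges compensates for the others, so the value does
  not drop; a coloring or its complement always achieves this.\<close>

lemma halving_sum:
  fixes y :: "nat \<Rightarrow> nat"
  assumes F: "F = {e. e < m \<and> odd (y e)}" and c: "card F \<le> 2 * card {e \<in> F. c e}"
  shows "sum y {..<m} \<le> 2 * (\<Sum>e<m. y e div 2 + of_bool (odd (y e) \<and> c e))"
proof -
  have "sum y {..<m} = (\<Sum>e<m. 2 * (y e div 2) + of_bool (odd (y e)))"
    by (intro sum.cong) (auto elim!: oddE)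
  also have "\<dots> = 2 * (\<Sum>e<m. y e div 2) + card F"
    by (simp add: sum.distrib sum_distrib_left F Int_def)
  also have "\<dots> \<le> 2 * ((\<Sum>e<m. y e div 2) + card {e \<in> F. c e})" using c by simp
  also have "\<dots> = 2 * (\<Sum>e<m. y e div 2 + of_bool (odd (y e) \<and> c e))"
    by (simp add: sum.distrib F Int_def conj_assoc)
  finally show ?thesis .
qed

end

section \<open>The program\<close>

text \<open>\<open>N\<close> is a power of two above the number of vertices and register \<open>p\<close> holds one above the
  number of edges. The arrays are: 0, 1 endpoints of the edges; 2, 3 budgets of these endpoints; 4, 5 edges
  sorted by endpoint; 6, 7 first and one past last position of a vertex in its sorted list; 8 levels
  (9 new levels); 10, 11 heaps of sums and of prefix sums, with the leaves from index \<open>p\<close> on;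
  12 powers of \<open>1 - 1/D\<close>; 13 current solution (14 new solution); 15 list of odd edges; 18, 19
  jump pointers and minima (20, 21 new ones); 22 new order while sorting; 23 denominators for
  clipping; 24, 25 partners of the odd edges.\<close>

definition psum :: "load list \<Rightarrow> exp \<Rightarrow> com" where
  "psum ls e = Seq (ParFor ''i'' (Reg ''m'') (body ls (Const 1, 10, Reg ''p'' \<oplus> Reg ''i'', e))) scan"

text \<open>One pass of a radix sort from the least significant bit, with \<open>t = 2 ^ k\<close>
  selecting bit k. The prefix sum counts the zeros before a position: zeros move to their rank, ones
  go behind all zeros, and each group keeps its order.\<close>

definition sort_pass :: "nat \<Rightarrow> com" where
  "sort_pass s =
    Seq (psum [(''e'', 4 + s, Reg ''i''), (''x'', s, Reg ''e'')] ((Reg ''x'' \<oslash> Reg ''t'') \<odot> Const 2 \<doteq> Const 0))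
    (Seq (ParFor ''i'' (Reg ''m'') (body [(''e'', 4 + s, Reg ''i''), (''x'', s, Reg ''e''),
            (''a'', 11, Reg ''p'' \<oplus> Reg ''i''), (''b'', 11, Reg ''p'' \<oplus> Reg ''m'')]
         (Const 1, 22, ((Reg ''x'' \<oslash> Reg ''t'') \<odot> Const 2 \<doteq> Const 0) \<otimes> Reg ''a'' \<oplus>
            ((Reg ''x'' \<oslash> Reg ''t'') \<odot> Const 2) \<otimes> (Reg ''b'' \<oplus> (Reg ''i'' \<ominus> Reg ''a'')), Reg ''e'')))
    (Seq (ParFor ''i'' (Reg ''m'') (body [(''e'', 22, Reg ''i'')] (Const 1, 4 + s, Reg ''i'', Reg ''e'')))
    (Assign ''t'' (Const 2 \<otimes> Reg ''t''))))"

definition sort_edges :: "nat \<Rightarrow> com" where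
  "sort_edges s =
    Seq (ParFor ''i'' (Reg ''m'') (body [] (Const 1, 4 + s, Reg ''i'', Reg ''i'')))
    (Seq (Assign ''t'' (Const 1)) (While (Reg ''t'' \<prec> Reg ''N'') (sort_pass s)))"

text \<open>Position 0 needs its own test because the predecessor 0 - 1 truncates to position 0
  itself, and the last position because the cell after it is outside the list.\<close>

definition find_segments :: "nat \<Rightarrow> com" where
  "find_segments s =
    Seq (ParFor ''i'' (Reg ''m'') (body [(''e'', 4 + s, Reg ''i''), (''x'', s, Reg ''e''), (''f'', 4 + s, Reg ''i'' \<ominus> Const 1), (''y'', s, Reg ''f'')]
         ((Reg ''i'' \<doteq> Const 0) \<oplus> (Const 1 \<ominus> (Reg ''x'' \<doteq> Reg ''y'')), 6, Reg ''x'', Reg ''i'')))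
    (ParFor ''i'' (Reg ''m'') (body [(''e'', 4 + s, Reg ''i''), (''x'', s, Reg ''e''), (''f'', 4 + s, Reg ''i'' \<oplus> Const 1), (''y'', s, Reg ''f'')]
         ((Reg ''i'' \<oplus> Const 1 \<doteq> Reg ''m'') \<oplus> (Const 1 \<ominus> (Reg ''x'' \<doteq> Reg ''y'')), 7, Reg ''x'', Reg ''i'' \<oplus> Const 1)))"

definition edge_vals :: "nat \<Rightarrow> nat \<Rightarrow> com" where
  "edge_vals s c = psum [(''e'', 4 + s, Reg ''i''), (''u'', 0, Reg ''e''), (''v'', 1, Reg ''e''), (''a'', 2, Reg ''e''),
     (''f'', 8, Reg ''u''), (''g'', 8, Reg ''v''), (''x'', 12, (Reg ''w'' \<oplus> Reg ''g'') \<ominus> (Reg ''f'' \<oplus> Const c))]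
     (Reg ''x'' \<otimes> (Const 0 \<prec> Reg ''a''))"

text \<open>Only the first edge of a segment writes, on behalf of its vertex. Comparing the overload
  test with \<open>s\<close> makes R go up when overloaded (s = 1), and L when the tentative load,
  with shift 1 - s, still fits (s = 0).\<close>

definition update_levels :: "nat \<Rightarrow> com" where
  "update_levels s =
    Seq (edge_vals s (1 - s))
    (Seq (ParFor ''i'' (Reg ''m'') (body [(''e'', 4 + s, Reg ''i''), (''x'', s, Reg ''e''), (''a'', 6, Reg ''x''), (''f'', 7, Reg ''x''),
            (''y'', 11, Reg ''p'' \<oplus> Reg ''f''), (''c'', 11, Reg ''p'' \<oplus> Reg ''a''), (''u'', 2 + s, Reg ''e''), (''g'', 8, Reg ''x'')]
         (Reg ''a'' \<doteq> Reg ''i'', 9, Reg ''x'', Reg ''g'' \<oplus> ((Reg ''u'' \<otimes> Reg ''B'' \<prec> Reg ''y'' \<ominus> Reg ''c'') \<doteq> Const s))))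
    (ParFor ''i'' (Reg ''m'') (body [(''e'', 4 + s, Reg ''i''), (''x'', s, Reg ''e''), (''a'', 6, Reg ''x''), (''g'', 9, Reg ''x'')]
         (Reg ''a'' \<doteq> Reg ''i'', 8, Reg ''x'', Reg ''g''))))"

definition level_rounds :: com where
  "level_rounds = Seq (Assign ''t'' (Const 0))
     (While (Reg ''t'' \<prec> Reg ''T'') (Seq (update_levels 1) (Seq (update_levels 0) (Assign ''t'' (Reg ''t'' \<oplus> Const 1)))))"

text \<open>Searches the first power of two \<open>o\<close> for which the clipped value, in units
  of 1 / o, reaches m * D. Replacing V = 0 by 1 lets the loop terminate on a zero solution.\<close>

definition pw_init :: com where
  "pw_init = Seq (Load ''V'' (arr 11 (Reg ''p'' \<oplus> Reg ''m'')))
     (Seq (Assign ''V'' (Reg ''V'' \<oplus> (Reg ''V'' \<doteq> Const 0)))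
     (Seq (Assign ''o'' (Const 1))
     (While (Reg ''o'' \<otimes> Reg ''V'' \<prec> Reg ''m'' \<otimes> Reg ''D'' \<otimes> Reg ''B'') (Assign ''o'' (Const 2 \<otimes> Reg ''o'')))))"

text \<open>With truncated subtraction, x + (y - x) is a maximum; in the same way
  \<open>fin_min\<close> obtains a minimum as y - (y - x).\<close>

definition fin_max :: com where
  "fin_max = ParFor ''i'' (Reg ''m'') (body [(''e'', 5, Reg ''i''), (''x'', 1, Reg ''e''), (''a'', 6, Reg ''x''), (''f'', 7, Reg ''x''),
            (''y'', 11, Reg ''p'' \<oplus> Reg ''f''), (''c'', 11, Reg ''p'' \<oplus> Reg ''a''), (''u'', 3, Reg ''e'')]
         (Reg ''a'' \<doteq> Reg ''i'', 23, Reg ''x'', Reg ''u'' \<otimes> Reg ''B'' \<oplus> (Reg ''y'' \<ominus> Reg ''c'' \<ominus> Reg ''u'' \<otimes> Reg ''B'')))"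

definition fin_min :: com where
  "fin_min = psum [(''e'', 5, Reg ''i''), (''x'', 1, Reg ''e''), (''a'', 6, Reg ''x''), (''f'', 7, Reg ''x''),
            (''y'', 11, Reg ''p'' \<oplus> Reg ''f''), (''c'', 11, Reg ''p'' \<oplus> Reg ''a''), (''u'', 3, Reg ''e'')]
         ((Reg ''a'' \<doteq> Reg ''i'') \<otimes> ((Reg ''y'' \<ominus> Reg ''c'') \<ominus> (Reg ''y'' \<ominus> Reg ''c'' \<ominus> Reg ''u'' \<otimes> Reg ''B'')))"

definition fin_clip :: com where
  "fin_clip = ParFor ''i'' (Reg ''m'') (body [(''u'', 0, Reg ''i''), (''v'', 1, Reg ''i''), (''a'', 2, Reg ''i''),
     (''f'', 8, Reg ''u''), (''g'', 8, Reg ''v''), (''x'', 12, (Reg ''w'' \<oplus> Reg ''g'') \<ominus> Reg ''f''), (''c'', 3, Reg ''i''), (''y'', 23, Reg ''v'')]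
     (Const 1, 13, Reg ''i'', ((Reg ''x'' \<otimes> (Const 0 \<prec> Reg ''a'')) \<otimes> Reg ''c'' \<otimes> Reg ''o'') \<oslash> Reg ''y''))"

definition finish_fractional :: com where
  "finish_fractional = Seq (edge_vals 1 0) (Seq fin_max (Seq fin_min (Seq pw_init fin_clip)))"

text \<open>Compression preserves the sorted order, so the odd edges at a vertex stay contiguous and
  are paired as neighbours by the parity of their rank in the group; the last one of an odd number
  becomes its own partner. The start of the group is the number of odd edges before the segment,
  read off the prefix sums.\<close>

definition pair_odd :: "nat \<Rightarrow> com" where
  "pair_odd s =
    Seq (psum [(''e'', 4 + s, Reg ''i''), (''y'', 13, Reg ''e'')] (Reg ''y'' \<odot> Const 2))
    (Seq (ParFor ''i'' (Reg ''m'') (body [(''e'', 4 + s, Reg ''i''), (''y'', 13, Reg ''e''), (''a'', 11, Reg ''p'' \<oplus> Reg ''i'')]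
       (Reg ''y'' \<odot> Const 2, 15, Reg ''a'', Reg ''e'')))
    (Seq (Load ''f'' (arr 11 (Reg ''p'' \<oplus> Reg ''m'')))
    (ParFor ''i'' (Reg ''f'') (body [(''e'', 15, Reg ''i''), (''x'', s, Reg ''e''), (''a'', 6, Reg ''x''), (''b'', 11, Reg ''p'' \<oplus> Reg ''a''),
        (''c'', 15, Reg ''i'' \<oplus> Const 1), (''d'', 15, Reg ''i'' \<ominus> Const 1), (''y'', s, Reg ''c'')]
       (Const 1, 24 + s, Reg ''e'', ((Reg ''i'' \<ominus> Reg ''b'') \<odot> Const 2) \<otimes> Reg ''d'' \<oplus>
          (Const 1 \<ominus> (Reg ''i'' \<ominus> Reg ''b'') \<odot> Const 2) \<otimes>
          ((Reg ''i'' \<oplus> Const 1 \<prec> Reg ''f'') \<otimes> (Reg ''y'' \<doteq> Reg ''x'') \<otimes> Reg ''c'' \<oplus>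
           (Const 1 \<ominus> (Reg ''i'' \<oplus> Const 1 \<prec> Reg ''f'') \<otimes> (Reg ''y'' \<doteq> Reg ''x'')) \<otimes> Reg ''e''))))))"

definition elem :: exp where
  "elem = Const 2 \<otimes> Reg ''e'' \<oplus> Reg ''i'' \<odot> Const 2"

text \<open>One thread per copy of an odd edge, so the work is proportional to the number
  \<open>f\<close> of odd edges and not to \<open>m\<close>; the geometric series of the rounding
  depends on this.\<close>

definition elems :: "nat \<Rightarrow> load list \<Rightarrow> exp \<Rightarrow> com" where
  "elems r ls e = ParFor ''i'' (Const 2 \<otimes> Reg ''f'') (body ((''e'', 15, Reg ''i'' \<oslash> Const 2) # ls) (Const 1, r, elem, e))"

text \<open>After j passes array 18 holds \<open>\<sigma>\<close> iterated 2 ^ j times and array 19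
  the minimum of the first 2 ^ j iterates. The bound 2 * p exceeds the number of copies, hence the
  length of every orbit.\<close>

definition jump :: com where
  "jump = Seq (Assign ''h'' (Const 1)) (While (Reg ''h'' \<prec> Const 2 \<otimes> Reg ''p'')
     (Seq (elems 21 [(''x'', 18, elem), (''y'', 19, elem), (''c'', 19, Reg ''x'')] (Reg ''y'' \<ominus> (Reg ''y'' \<ominus> Reg ''c'')))
     (Seq (elems 20 [(''x'', 18, elem), (''c'', 18, Reg ''x'')] (Reg ''c''))
     (Seq (elems 19 [(''x'', 21, elem)] (Reg ''x''))
     (Seq (elems 18 [(''x'', 20, elem)] (Reg ''x''))
     (Assign ''h'' (Const 2 \<otimes> Reg ''h'')))))))"

text \<open>\<open>k\<close> counts one color class; if it has less than half of the odd edges, the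
  other class is rounded up. The partner of copy 2 * i in the doubled pairing at L is 2 * c + (c =
  i), since a self-paired edge meets its own second copy.\<close>

definition decide :: com where
  "decide =
    Seq (psum [(''y'', 13, Reg ''i''), (''c'', 24, Reg ''i''), (''a'', 19, Const 2 \<otimes> Reg ''i''), (''d'', 19, Const 2 \<otimes> Reg ''c'' \<oplus> (Reg ''c'' \<doteq> Reg ''i''))]
      ((Reg ''y'' \<odot> Const 2) \<otimes> (Reg ''a'' \<prec> Reg ''d'')))
    (Seq (Load ''k'' (arr 11 (Reg ''p'' \<oplus> Reg ''m'')))
    (Seq (ParFor ''i'' (Reg ''m'') (body [(''y'', 13, Reg ''i''), (''c'', 24, Reg ''i''), (''a'', 19, Const 2 \<otimes> Reg ''i''), (''d'', 19, Const 2 \<otimes> Reg ''c'' \<oplus> (Reg ''c'' \<doteq> Reg ''i''))]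
      (Const 1, 14, Reg ''i'', Reg ''y'' \<oslash> Const 2 \<oplus> (Reg ''y'' \<odot> Const 2) \<otimes> ((Reg ''a'' \<prec> Reg ''d'') \<doteq> (Const 1 \<ominus> (Const 2 \<otimes> Reg ''k'' \<prec> Reg ''f''))))))
    (ParFor ''i'' (Reg ''m'') (body [(''y'', 14, Reg ''i'')] (Const 1, 13, Reg ''i'', Reg ''y'')))))"

text \<open>The value stored in array 18 is \<open>\<sigma>\<close> written out: the bit of a copy
  flips once for each of the two pairings that fixes the edge.\<close>

definition halve :: com where
  "halve = Seq (pair_odd 0) (Seq (pair_odd 1)
    (Seq (elems 18 [(''c'', 24, Reg ''e''), (''d'', 25, Reg ''c'')]
       (Const 2 \<otimes> Reg ''d'' \<oplus> (Reg ''i'' \<odot> Const 2 \<oplus> (Reg ''c'' \<doteq> Reg ''e'') \<oplus> (Reg ''d'' \<doteq> Reg ''c'')) \<odot> Const 2))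
    (Seq (elems 19 [] elem) (Seq jump decide))))"

definition roundoff :: com where
  "roundoff = While (Const 1 \<prec> Reg ''o'') (Seq halve (Assign ''o'' (Reg ''o'' \<oslash> Const 2)))"

definition setup_sizes :: com where
  "setup_sizes =
    Seq (Assign ''N'' (Const 1)) (Seq (Assign ''l'' (Const 0))
    (Seq (While (Reg ''N'' \<prec> Reg ''n'' \<oplus> Const 1) (Seq (Assign ''N'' (Const 2 \<otimes> Reg ''N'')) (Assign ''l'' (Reg ''l'' \<oplus> Const 1))))
    (Seq (Assign ''p'' (Const 1)) (While (Reg ''p'' \<prec> Reg ''m'' \<oplus> Const 1) (Assign ''p'' (Const 2 \<otimes> Reg ''p''))))))"

text \<open>The number 6 / \<epsilon> is not bounded in terms of n and need not fit into a word. So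
  it is not a constant of the text but is counted up by unrolled increments that stop at 6 * N ^
  2.\<close>

primrec increments :: "nat \<Rightarrow> com" where
  "increments 0 = Skip"
| "increments (Suc k) = Seq (increments k) (If (Reg ''D'' \<prec> Const 6 \<otimes> Reg ''N'' \<otimes> Reg ''N'') (Assign ''D'' (Reg ''D'' \<oplus> Const 1)) Skip)"

definition setup_params :: "nat \<Rightarrow> com" where
  "setup_params k =
    Seq (Assign ''D'' (Const 0)) (Seq (increments k)
    (Seq (Assign ''B'' (Const 12 \<otimes> Reg ''D'' \<otimes> ((Reg ''N'' \<otimes> Reg ''N'') \<otimes> (Reg ''N'' \<otimes> Reg ''N''))))
    (Seq (Assign ''w'' (Const 6 \<otimes> Reg ''D'' \<otimes> Reg ''l'')) (Assign ''T'' (Reg ''D'' \<otimes> Reg ''w'')))))"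

definition read_side :: "nat \<Rightarrow> com" where
  "read_side s =
    Seq (ParFor ''i'' (Reg ''m'') (body [(''a'', 32, Const 2 \<otimes> Reg ''i'' \<oplus> Const s)] (Const 1, s, Reg ''i'', Reg ''a'')))
    (ParFor ''i'' (Reg ''m'') (body [(''a'', s, Reg ''i''), (''c'', 32, Reg ''m'' \<oplus> Reg ''m'' \<oplus> Reg ''a'')] (Const 1, 2 + s, Reg ''i'', Reg ''c'')))"

text \<open>A sequential loop suffices, since its length is of the order of the number
  \<open>T\<close> of rounds.\<close>

definition power_table :: com where
  "power_table =
    Seq (ParFor ''i'' (Const 1) (body [] (Const 1, 12, Const 0, Reg ''B'')))
    (Seq (Assign ''t'' (Const 0))
    (While (Reg ''t'' \<prec> Reg ''w'' \<oplus> Reg ''T'')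
      (Seq (ParFor ''i'' (Const 1) (body [(''a'', 12, Reg ''t'')] (Const 1, 12, Reg ''t'' \<oplus> Const 1, Reg ''a'' \<ominus> Reg ''a'' \<oslash> Reg ''D'')))
      (Assign ''t'' (Reg ''t'' \<oplus> Const 1)))))"

definition write_output :: com where
  "write_output = ParFor ''i'' (Reg ''m'') (body [(''y'', 13, Reg ''i'')] (Const 1, 32, Reg ''m'' \<oplus> Reg ''m'' \<oplus> Reg ''n'' \<oplus> Reg ''i'', Reg ''y''))"

definition main_program :: "nat \<Rightarrow> com" where
  "main_program k =
    Seq setup_sizes (Seq (setup_params k)
    (Seq (read_side 0) (Seq (read_side 1) (Seq power_table
    (Seq (sort_edges 0) (Seq (sort_edges 1) (Seq (find_segments 0) (Seq (find_segments 1)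
    (Seq level_rounds (Seq finish_fractional (Seq roundoff write_output)))))))))))"

section \<open>Stable radix sorting of the edges by endpoint\<close>

section \<open>Sorting\<close>

text \<open>\<open>Z j\<close> positions with \<open>P\<close> and \<open>j - Z j\<close> without
  \<open>P\<close> precede \<open>j\<close>, and each counter increases strictly along its own
  class. Injectivity into a finite set of the same size gives bijectivity.\<close>

lemma stable_partition:
  fixes P :: "nat \<Rightarrow> bool" and m :: nat and Z pos :: "nat \<Rightarrow> nat"
  assumes Z_def: "Z = (\<lambda>j. \<Sum>i<j. of_bool (P i))"
    and pos_def: "pos = (\<lambda>j. if P j then Z j else Z m + (j - Z j))"
  shows "j < m \<Longrightarrow> pos j < m"
    and "i < j \<Longrightarrow> j < m \<Longrightarrow> P i = P j \<Longrightarrow> pos i < pos j"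
    and "i < m \<Longrightarrow> j < m \<Longrightarrow> P i \<Longrightarrow> \<not> P j \<Longrightarrow> pos i < pos j"
    and "bij_betw pos {..<m} {..<m}"
proof -
  define Y where "Y = (\<lambda>j. \<Sum>i<j. of_bool (\<not> P i) :: nat)"
  have ZY: "Z j + Y j = j" for j
    unfolding Z_def Y_def by (induction j) auto
  have mono: "Z i \<le> Z j" "Y i \<le> Y j" if "i \<le> j" for i j
    unfolding Z_def Y_def by (rule sum_mono2; use that in auto)+
  have Zs: "Z i < Z j" if "P i" "i < j" for i j
    using mono(1)[of "Suc i" j] that unfolding Z_def by (simp del: sum_of_bool_eq)
  have Ys: "Y i < Y j" if "\<not> P i" "i < j" for i j
    using mono(2)[of "Suc i" j] that unfolding Y_def by (simp del: sum_of_bool_eq)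
  have pos: "pos j = (if P j then Z j else Z m + Y j)" for j
    using ZY[of j] by (auto simp: pos_def)
  show lt: "pos j < m" if "j < m" for j
    using Zs[of j m] Ys[of j m] ZY[of m] that by (auto simp: pos)
  show same: "pos i < pos j" if "i < j" "j < m" "P i = P j" for i j
    using Zs[of i j] Ys[of i j] that by (auto simp: pos)
  show diff: "pos i < pos j" if "i < m" "j < m" "P i" "\<not> P j" for i j
    using Zs[of i m] that by (auto simp: pos)
  have "inj_on pos {..<m}"
  proof (rule linorder_inj_onI')
    fix i j assume "i \<in> {..<m}" "j \<in> {..<m}" "i < j"
    then show "pos i \<noteq> pos j" using same[of i j] diff[of i j] diff[of j i] by (cases "P i"; cases "P j") auto
  qed
  then show "bij_betw pos {..<m} {..<m}"
    unfolding bij_betw_def using endo_inj_surj[of "{..<m}" pos] lt by blast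
qed

text \<open>All sizes are tied to the power of two \<open>N\<close> above n, so every quantity is a
  constant times a power of \<open>N\<close>, and \<open>X = N ^ 20\<close> dominates them. Below
  \<open>z\<close> there is room for 2 * m endpoints, n budgets and m output cells.\<close>

locale alg = machine w X z + edges m ep b for w X z m ep b +
  fixes n q lg N D :: nat
  assumes m: "0 < m" "m < 2 ^ q" "2 ^ q \<le> 2 * m" "m \<le> N ^ 2" and n: "n < N" "1 < n" "N \<le> 2 * n"
    and ep_less: "\<And>s i. s < 2 \<Longrightarrow> i < m \<Longrightarrow> ep s i < n" and b_le: "\<And>v. b v \<le> n"
    and N: "N = 2 ^ lg" and D: "6 \<le> D" "D \<le> 6 * N ^ 2" and X: "X = N ^ 20" and z: "z = 3 * m + n"
begin

lemma N_ge: "4 \<le> N"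
proof -
  have "2 < N" using n by simp
  then have "lg \<noteq> 0" "lg \<noteq> 1" using N by (intro notI; simp)+
  then have "2 \<le> lg" by simp
  then have "(2::nat) ^ 2 \<le> 2 ^ lg" by (rule power_increasing) simp
  then show ?thesis using N by simp
qed

lemma le_X: "k \<le> 20 \<Longrightarrow> a \<le> N ^ k \<Longrightarrow> a \<le> X"
  unfolding X using N_ge by (metis le_trans power_increasing one_le_numeral)

lemma pow4: "c \<le> 4 ^ k \<Longrightarrow> c \<le> N ^ k"
  using N_ge by (meson le_trans power_mono zero_le)

lemma N_X: "N \<le> X" using le_X[of 1 N] by simp

lemma n_X: "n \<le> X" using n(1) N_X by linarith

lemma q_X: "2 * 2 ^ q \<le> X"
proof -
  have "2 * 2 ^ q \<le> 4 * N ^ 2" using m by simp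
  also have "\<dots> \<le> N * N ^ 2" using N_ge by simp
  also have "\<dots> = N ^ 3" by (simp add: power_numeral_reduce)
  finally show ?thesis by (rule le_X[rotated]) simp
qed

lemma m_X: "2 * m \<le> X" using q_X m(2) by linarith

text \<open>The padding leaves keep the 0 of the initial memory, so the sums over all
  \<open>2 ^ q\<close> leaves are sums over the \<open>m\<close> real ones.\<close>

definition heap_zero :: "(nat \<Rightarrow> nat \<Rightarrow> nat) \<Rightarrow> bool" where
  "heap_zero a \<longleftrightarrow> (\<forall>j. m \<le> j \<longrightarrow> j < 2 ^ q \<longrightarrow> a 10 (2 ^ q + j) = 0)"

text \<open>Since \<open>m < 2 ^ q\<close> is strict, the exclusive prefix sums have an entry for
  position \<open>m\<close>, from which the program reads totals.\<close>

lemma runs_psum: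
  assumes reg: "s ''m'' = m" "s ''p'' = 2 ^ q" and hz: "heap_zero a"
    and ok: "body_ok ls (Const 1, 10, Reg ''p'' \<oplus> Reg ''i'', e)"
    and ls: "list_all (\<lambda>(x, r, e). x \<noteq> ''i'' \<and> x \<noteq> ''p'' \<and> r \<noteq> 10 \<and> r \<noteq> 32) ls"
    and v: "\<And>i. i < m \<Longrightarrow> nval e (lsem ls (s(''i'' := i)) a) = v i"
    and vX: "sum v {..<m} \<le> X"
    and post: "\<And>a'. (\<And>i. i \<le> m \<Longrightarrow> a' 11 (2 ^ q + i) = sum v {..<i}) \<Longrightarrow>
       (\<And>i. i < m \<Longrightarrow> a' 10 (2 ^ q + i) = v i) \<Longrightarrow> heap_zero a' \<Longrightarrow>
       (\<And>r. r \<noteq> 10 \<Longrightarrow> r \<noteq> 11 \<Longrightarrow> a' r = a r) \<Longrightarrow> Q (s(''h'' := 2 ^ q)) a'"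
    and t: "8000 * m \<le> t" "1200 * (q + 1) \<le> d"
  shows "runs (psum ls e) s a t d Q"
proof -
  define f where "f = (\<lambda>i. if i < m then v i else 0)"
  have f: "sum f {..<i} = sum v {..<i}" if "i \<le> m" for i
    unfolding f_def using that by (intro sum.cong) auto
  have "sum f {..<2 ^ q} = sum f {..<m}"
    unfolding f_def using m(2) by (intro sum.mono_neutral_right) auto
  then have fX: "sum f {..<2 ^ q} \<le> X" using f[of m] vX by simp
  have keep: "lsem ls s' a x = s' x" if "list_all (\<lambda>(y, r, e). y \<noteq> x) ls" for s' x
    using that by (induction ls s' a rule: lsem.induct) auto
  have rd: "r \<noteq> 10 \<and> r \<noteq> 32" if "(r, l) \<in> set (lreads ls s' a)"
      "list_all (\<lambda>(x, r, e). x \<noteq> ''i'' \<and> x \<noteq> ''p'' \<and> r \<noteq> 10 \<and> r \<noteq> 32) ls" for s' r l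
    using that by (induction ls s' a rule: lreads.induct) auto
  have ki: "list_all (\<lambda>(y, r, e). y \<noteq> ''i'') ls" "list_all (\<lambda>(y, r, e). y \<noteq> ''p'') ls"
    using ls by (auto simp: list_all_iff)
  have idx: "nval (Reg ''p'' \<oplus> Reg ''i'') (lsem ls (s(''i'' := i)) a) = 2 ^ q + i" for i
    using keep[OF ki(1)] keep[OF ki(2)] reg by simp
  have viX: "v i \<le> X" if "i < m" for i
    using member_le_sum[of i "{..<m}" v] that vX by auto
  let ?P = "\<lambda>s' a'. s' = s \<and> (\<forall>i<2 ^ q. a' 10 (2 ^ q + i) = f i) \<and> (\<forall>r. r \<noteq> 10 \<longrightarrow> a' r = a r)"
  show ?thesis unfolding psum_def
  proof (rule runs_Seq[where P = ?P and ta = "100 * (m + 1)" and da = 200 and tb = "2000 * 2 ^ q + 3000"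
        and db = "1000 * (q + 1)"], goal_cases)
    case 1
    show ?case
    proof (rule runs_ParFor[where k = m and C = "\<lambda>_. True" and f = "\<lambda>i. 2 ^ q + i" and v = v])
      fix a' assume w: "\<And>i. i < m \<Longrightarrow> True \<Longrightarrow> a' 10 (2 ^ q + i) = v i"
        and o: "\<And>j. (\<And>i. i < m \<Longrightarrow> True \<Longrightarrow> 2 ^ q + i \<noteq> j) \<Longrightarrow> a' 10 j = a 10 j"
        and r: "\<And>r. r \<noteq> 10 \<Longrightarrow> a' r = a r"
      have "a' 10 (2 ^ q + i) = f i" if "i < 2 ^ q" for i
        using w[of i] o[of "2 ^ q + i"] hz that by (auto simp: f_def heap_zero_def)
      then show "?P s a'" using r by simp
    qed (use reg m_X ok v idx viX in \<open>auto simp: ok_simps dest!: rd[OF _ ls]\<close>)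
  next
    case A: (2 s1 a1)
    show ?case
    proof (rule runs_scan[where q = q and f = f])
      fix a' assume a': "\<And>i. i < 2 ^ q \<Longrightarrow> a' 11 (2 ^ q + i) = sum f {..<i}"
         "\<And>j. j < 2 ^ q \<Longrightarrow> a' 10 (2 ^ q + j) = f j" "\<And>r. r \<noteq> 10 \<Longrightarrow> r \<noteq> 11 \<Longrightarrow> a' r = a1 r"
      have "Q (s(''h'' := 2 ^ q)) a'"
        by (rule post) (use a' A m(2) f in \<open>auto simp: f_def heap_zero_def\<close>)
      then show "Q (s1(''h'' := 2 ^ q)) a'" using A by simp
    qed (use A reg q_X fX in auto)
  qed (use t m in auto)
qed

definition ord_ok :: "(nat \<Rightarrow> nat \<Rightarrow> nat) \<Rightarrow> nat \<Rightarrow> bool" where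
  "ord_ok a s \<longleftrightarrow> bij_betw (a (4 + s)) {..<m} {..<m} \<and>
     (\<forall>i j. i < j \<longrightarrow> j < m \<longrightarrow> ep s (a (4 + s) i) \<le> ep s (a (4 + s) j))"

lemma mod_pow_Suc: "x mod 2 ^ Suc k = 2 ^ k * (x div 2 ^ k mod 2) + x mod (2::nat) ^ k"
  using mod_mult2_eq[of x "2 ^ k" 2] by (simp add: mult.commute)

text \<open>Stability carries the order by the lower k bits over to edges that agree in bit k, and
  \<open>mod_pow_Suc\<close> merges both into the order by k + 1 bits.\<close>

lemma runs_sort_pass:
  assumes s: "s < 2" and reg: "r ''m'' = m" "r ''p'' = 2 ^ q" "r ''t'' = 2 ^ k" and hz: "heap_zero a"
    and k: "k < lg" and es: "\<And>i. i < m \<Longrightarrow> a s i = ep s i"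
    and bij: "bij_betw (a (4 + s)) {..<m} {..<m}"
    and srt: "\<And>i j. i < j \<Longrightarrow> j < m \<Longrightarrow> ep s (a (4 + s) i) mod 2 ^ k \<le> ep s (a (4 + s) j) mod 2 ^ k"
    and post: "\<And>a'. bij_betw (a' (4 + s)) {..<m} {..<m} \<Longrightarrow>
       (\<And>i j. i < j \<Longrightarrow> j < m \<Longrightarrow> ep s (a' (4 + s) i) mod 2 ^ Suc k \<le> ep s (a' (4 + s) j) mod 2 ^ Suc k) \<Longrightarrow>
       heap_zero a' \<Longrightarrow> (\<And>r. r \<noteq> 4 + s \<Longrightarrow> r \<noteq> 10 \<Longrightarrow> r \<noteq> 11 \<Longrightarrow> r \<noteq> 22 \<Longrightarrow> a' r = a r) \<Longrightarrow>
       Q (r(''h'' := 2 ^ q, ''t'' := 2 ^ Suc k)) a'"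
    and t: "9000 * m \<le> t" "2000 * (q + 1) \<le> d"
  shows "runs (sort_pass s) r a t d Q"
proof -
  let ?o = "a (4 + s)"
  have o: "?o i < m" if "i < m" for i using bij that by (auto simp: bij_betw_def)
  have o_X: "?o i \<le> X" if "i < m" for i using o[OF that] m_X by simp
  define P where "P = (\<lambda>i. (ep s (?o i) div 2 ^ k) mod 2 = 0)"
  define Z where "Z = (\<lambda>j. \<Sum>i<j. of_bool (P i) :: nat)"
  define pos where "pos = (\<lambda>j. if P j then Z j else Z m + (j - Z j))"
  note sp = stable_partition[OF Z_def pos_def]
  have inj: "inj_on pos {..<m}" and surj: "pos ` {..<m} = {..<m}" using sp(4) by (auto simp: bij_betw_def)
  have s01: "s = 0 \<or> s = 1" using s by auto
  have Zm: "Z m \<le> m" unfolding Z_def by (induction m) auto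
  have tX: "2 ^ Suc k \<le> X"
  proof -
    have "(2::nat) ^ Suc k \<le> 2 ^ lg" using k by (intro power_increasing) auto
    then show ?thesis using N N_X by simp
  qed
  let ?P1 = "\<lambda>r1 a1. r1 = r(''h'' := 2 ^ q) \<and> (\<forall>i\<le>m. a1 11 (2 ^ q + i) = Z i) \<and> heap_zero a1 \<and>
      (\<forall>r. r \<noteq> 10 \<longrightarrow> r \<noteq> 11 \<longrightarrow> a1 r = a r)"
  let ?P2 = "\<lambda>r1 a1. r1 = r(''h'' := 2 ^ q) \<and> (\<forall>i<m. a1 22 (pos i) = ?o i) \<and> heap_zero a1 \<and>
      (\<forall>r. r \<noteq> 10 \<longrightarrow> r \<noteq> 11 \<longrightarrow> r \<noteq> 22 \<longrightarrow> a1 r = a r)"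
  let ?P3 = "\<lambda>r1 a1. r1 = r(''h'' := 2 ^ q) \<and> (\<forall>i<m. a1 (4 + s) (pos i) = ?o i) \<and> heap_zero a1 \<and>
      (\<forall>r. r \<noteq> 4 + s \<longrightarrow> r \<noteq> 10 \<longrightarrow> r \<noteq> 11 \<longrightarrow> r \<noteq> 22 \<longrightarrow> a1 r = a r)"
  show ?thesis unfolding sort_pass_def
  proof (rule runs_Seq[where P = ?P1 and ta = "8000 * m" and da = "1200 * (q + 1)" and tb = "240 + 200 * m"
        and db = 440], goal_cases)
    case 1
    show ?case
    proof (rule runs_psum[where v = "\<lambda>i. of_bool (P i)"])
      show "(\<Sum>i<m. of_bool (P i)) \<le> X" using Zm m_X unfolding Z_def by linarith
    qed (use s01 reg hz o es in \<open>auto simp: ok_simps P_def Z_def\<close>)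
  next
    case A: (2 r1 a1)
    show ?case
    proof (rule runs_Seq[where P = ?P2 and ta = "100 * (m + 1)" and da = 200 and tb = "140 + 100 * m"
          and db = 240], goal_cases)
      case 1
      show ?case
      proof (rule runs_ParFor[where k = m and C = "\<lambda>_. True" and f = pos and v = ?o], goal_cases)
        case (8 i)
        then show ?case using s01 reg A o[of i] es by (auto simp: P_def pos_def)
      next
        case (12 i j)
        then show ?case using inj by (auto dest: inj_onD)
      next
        case (14 a')
        then show ?case using A s01 by (auto simp: heap_zero_def)
      qed (use s01 reg A m_X o_X in \<open>auto simp: ok_simps\<close>)
    next
      case A: (2 r1 a1)
      show ?case
      proof (rule runs_Seq[where P = ?P3 and ta = "100 * (m + 1)" and da = 200 and tb = 40
          and db = 40], goal_cases)
        case 1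
        have *: "a1 22 j \<le> X" if "j < m" for j
        proof -
          have "j \<in> pos ` {..<m}" unfolding surj using that by simp
          then obtain i where "i < m" "j = pos i" by blast
          then show ?thesis using A o[of i] m_X by auto
        qed
        show ?case
          by (rule runs_ParFor[where k = m and C = "\<lambda>_. True" and f = "\<lambda>i. i" and v = "a1 22"])
            (use s01 reg A m_X * sp(1) in \<open>auto simp: ok_simps heap_zero_def\<close>)
      next
        case A: (2 r1 a1)
        let ?o' = "a1 (4 + s)"
        have "bij_betw (?o' \<circ> pos) {..<m} {..<m}"
          using bij A by (subst bij_betw_cong[of _ _ ?o]) auto
        then have 1: "bij_betw ?o' {..<m} {..<m}"
          using bij_betw_comp_iff[OF sp(4)] by blast
        have 2: "ep s (?o' i) mod 2 ^ Suc k \<le> ep s (?o' j) mod 2 ^ Suc k" if ij: "i < j" "j < m" for i j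
        proof -
          have "i \<in> pos ` {..<m}" "j \<in> pos ` {..<m}" using ij unfolding surj by auto
          then obtain i' j' where i': "i' < m" "i = pos i'" and j': "j' < m" "j = pos j'" by auto
          have o': "?o' i = ?o i'" "?o' j = ?o j'" using A i' j' by auto
          show ?thesis
          proof (cases "P i' = P j'")
            case True
            then have "i' < j'" using sp(2)[of j' i'] i' j' ij by (metis linorder_neqE_nat order.asym)
            then have "ep s (?o i') mod 2 ^ k \<le> ep s (?o j') mod 2 ^ k" using srt j' by simp
            moreover have "ep s (?o i') div 2 ^ k mod 2 = ep s (?o j') div 2 ^ k mod 2"
              using True unfolding P_def by (metis mod2_eq_if)
            ultimately show ?thesis unfolding o' mod_pow_Suc by simp
          next
            case False
            then have "P i'" "\<not> P j'" using sp(3)[of j' i'] i' j' ij by auto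
            then have "ep s (?o i') div 2 ^ k mod 2 = 0" "ep s (?o j') div 2 ^ k mod 2 = 1"
              unfolding P_def by auto
            then show ?thesis unfolding o' mod_pow_Suc
              using mod_less_divisor[of "2 ^ k" "ep s (?o i')"] by (simp add: trans_le_add1 less_imp_le)
          qed
        qed
        show ?case
          by (rule runs_Assign) (use A reg tX post[of a1, OF 1 2] in \<open>auto simp: ok_simps\<close>)
      qed auto
    qed auto
  qed (use t m in auto)
qed

lemma runs_sort_edges:
  assumes s: "s < 2" and reg: "r ''m'' = m" "r ''p'' = 2 ^ q" "r ''N'' = N" and hz: "heap_zero a"
    and es: "\<And>i. i < m \<Longrightarrow> a s i = ep s i"
    and post: "\<And>r' a'. ord_ok a' s \<Longrightarrow> heap_zero a' \<Longrightarrow>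
       (\<And>r. r \<noteq> 4 + s \<Longrightarrow> r \<noteq> 10 \<Longrightarrow> r \<noteq> 11 \<Longrightarrow> r \<noteq> 22 \<Longrightarrow> a' r = a r) \<Longrightarrow>
       (\<And>x. x \<noteq> ''h'' \<Longrightarrow> x \<noteq> ''t'' \<Longrightarrow> r' x = r x) \<Longrightarrow> Q r' a'"
    and t: "10000 * m * (lg + 1) \<le> t" "3000 * (q + 1) * (lg + 1) \<le> d"
  shows "runs (sort_edges s) r a t d Q"
proof -
  have s01: "s = 0 \<or> s = 1" using s by auto
  let ?A = "\<lambda>r1 a1. r1 = r \<and> (\<forall>i<m. a1 (4 + s) i = i) \<and> (\<forall>q. q \<noteq> 4 + s \<longrightarrow> a1 q = a q)"
  let ?I = "\<lambda>k r1 a1. (\<exists>h. r1 = r(''h'' := h, ''t'' := 2 ^ k)) \<and> heap_zero a1 \<and>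
      bij_betw (a1 (4 + s)) {..<m} {..<m} \<and>
      (\<forall>i j. i < j \<longrightarrow> j < m \<longrightarrow> ep s (a1 (4 + s) i) mod 2 ^ k \<le> ep s (a1 (4 + s) j) mod 2 ^ k) \<and>
      (\<forall>q. q \<noteq> 4 + s \<longrightarrow> q \<noteq> 10 \<longrightarrow> q \<noteq> 11 \<longrightarrow> q \<noteq> 22 \<longrightarrow> a1 q = a q)"
  show ?thesis unfolding sort_edges_def
  proof (rule runs_Seq[where P = ?A and ta = "100 * (m + 1)" and da = 200 and tb = "9000 * m * lg + 40 * (lg + 1) + 40"
        and db = "2000 * (q + 1) * lg + 40 * (lg + 1) + 40"], goal_cases)
    case 1
    show ?case
      by (rule runs_ParFor[where k = m and C = "\<lambda>_. True" and f = "\<lambda>i. i" and v = "\<lambda>i. i"])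
        (use s01 reg m_X in \<open>auto simp: ok_simps\<close>)
  next
    case A: (2 r1 a1)
    show ?case
    proof (rule runs_Seq[where P = "?I 0" and ta = 40 and da = 40 and tb = "9000 * m * lg + 40 * (lg + 1)"
        and db = "2000 * (q + 1) * lg + 40 * (lg + 1)"], goal_cases)
      case 1
      have "bij_betw (a1 (4 + s)) {..<m} {..<m}"
        using A by (subst bij_betw_cong[of _ _ "\<lambda>i. i"]) (auto simp: bij_betw_def)
      moreover have "\<exists>h. r(''t'' := Suc 0) = r(''h'' := h, ''t'' := Suc 0)"
        by (rule exI[of _ "r ''h''"]) simp
      ultimately show ?case
        using A m_X m(1) s01 hz by (intro runs_Assign) (auto simp: ok_simps heap_zero_def)
    next
      case I0: (2 r1 a1)
      show ?case
      proof (rule runs_While[where k = lg and I = ?I and tb = "\<lambda>_. 9000 * m" and db = "\<lambda>_. 2000 * (q + 1)"], goal_cases)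
        case 2 then show ?case using I0 .
      next
        case (3 k r1 a1)
        then obtain h where h: "r1 = r(''h'' := h, ''t'' := 2 ^ k)" by blast
        have "(2::nat) ^ k < 2 ^ lg" using 3 by simp
        then have "nval (Reg ''t'' \<prec> Reg ''N'') r1 \<noteq> 0" using h reg N by simp
        moreover have "runs (sort_pass s) r1 a1 (9000 * m) (2000 * (q + 1)) (?I (Suc k))"
        proof (rule runs_sort_pass[OF s, where k = k], goal_cases)
          case (9 a')
          have "\<exists>h'. r1(''h'' := 2 ^ q, ''t'' := 2 ^ Suc k) = r(''h'' := h', ''t'' := 2 ^ Suc k)"
            unfolding h by (rule exI[of _ "2 ^ q"]) (simp add: fun_upd_twist)
          then show ?case using 3 9 by auto
        qed (use 3 h reg es s01 in auto)
        ultimately show ?case by blast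
      next
        case (4 r1 a1)
        \<comment> \<open>Keys are below \<open>N = 2 ^ lg\<close>, so \<open>lg\<close> bits are
          the whole key.\<close>
        have mod: "ep s (a1 (4 + s) i) mod 2 ^ lg = ep s (a1 (4 + s) i)" if "i < m" for i
        proof -
          have "a1 (4 + s) i < m" using 4 that by (auto simp: bij_betw_def)
          then have "ep s (a1 (4 + s) i) < N" using ep_less[OF s] n by (meson less_trans)
          then show ?thesis using N by simp
        qed
        have "ord_ok a1 s" unfolding ord_ok_def
        proof (intro conjI allI impI)
          fix i j assume ij: "i < j" "j < m"
          then have "ep s (a1 (4 + s) i) mod 2 ^ lg \<le> ep s (a1 (4 + s) j) mod 2 ^ lg" using 4 by blast
          then show "ep s (a1 (4 + s) i) \<le> ep s (a1 (4 + s) j)"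
            using mod[of i] mod[of j] ij by simp
        qed (use 4 in auto)
        then have "Q r1 a1" using 4 by (intro post) auto
        then show ?case using 4 reg N by auto
      qed (auto simp: ok_simps)
    qed auto
  next
    case 3
    have "9000 * m * lg + 40 * (lg + 1) + 40 + 100 * (m + 1) \<le> 10000 * m * (lg + 1)"
      using m(1) by (cases m) (auto simp: algebra_simps)
    then show ?case using t by linarith
  next
    case 4
    then show ?case using t by (simp add: algebra_simps)
  qed
qed

definition seg_ok :: "(nat \<Rightarrow> nat \<Rightarrow> nat) \<Rightarrow> nat \<Rightarrow> bool" where
  "seg_ok a s \<longleftrightarrow> (\<forall>v\<in>verts s. a 6 v < a 7 v \<and> a 7 v \<le> m \<and>
     (\<forall>i<m. ep s (a (4 + s) i) = v \<longleftrightarrow> a 6 v \<le> i \<and> i < a 7 v))"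

text \<open>Sortedness makes equal keys contiguous, so exactly one position per vertex has no equal
  predecessor and exactly one no equal successor; hence no two threads write the same entry. Entries
  of other vertices must be seen to survive because both sides share the arrays 6 and 7.\<close>

lemma runs_find_segments:
  assumes s: "s < 2" and reg: "r ''m'' = m" and ord: "ord_ok a s"
    and es: "\<And>i. i < m \<Longrightarrow> a s i = ep s i"
    and post: "\<And>a'. seg_ok a' s \<Longrightarrow> (\<And>v. v \<notin> verts s \<Longrightarrow> a' 6 v = a 6 v \<and> a' 7 v = a 7 v) \<Longrightarrow>
       (\<And>r. r \<noteq> 6 \<Longrightarrow> r \<noteq> 7 \<Longrightarrow> a' r = a r) \<Longrightarrow> Q r a'"
    and t: "400 * m \<le> t" "400 \<le> d"
  shows "runs (find_segments s) r a t d Q"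
proof -
  have s01: "s = 0 \<or> s = 1" using s by auto
  let ?o = "a (4 + s)"
  have o: "?o i < m" if "i < m" for i using ord that by (auto simp: bij_betw_def ord_ok_def)
  have surj: "?o ` {..<m} = {..<m}" using ord by (auto simp: bij_betw_def ord_ok_def)
  define key where "key = (\<lambda>i. ep s (?o i))"
  have srt: "key i \<le> key j" if "i \<le> j" "j < m" for i j
    using ord that unfolding key_def ord_ok_def by (cases "i = j") auto
  have key_v: "key i \<in> verts s" if "i < m" for i using o[OF that] by (auto simp: verts_def key_def)
  have keyv: "\<exists>i<m. v = key i" if "v \<in> verts s" for v
  proof -
    from that obtain e where e: "e < m" "v = ep s e" by (auto simp: verts_def)
    then have "e \<in> ?o ` {..<m}" using surj by simp
    then show ?thesis using e by (auto simp: key_def)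
  qed
  have ld: "a s (?o i) = key i" if "i < m" for i using es o that by (simp add: key_def)
  define F where "F = (\<lambda>i. i = 0 \<or> key i \<noteq> key (i - 1))"
  define E where "E = (\<lambda>i. i + 1 = m \<or> key i \<noteq> key (i + 1))"
  have Finj: "i = j" if "i < m" "j < m" "F i" "F j" "key i = key j" for i j
  proof (rule ccontr)
    have *: False if "i < j" "j < m" "F j" "key i = key j" for i j
    proof -
      have "i \<le> j - 1" "j - 1 < m" "j - 1 \<le> j" using that by auto
      then show False using srt[of i "j - 1"] srt[of "j - 1" j] that by (auto simp: F_def)
    qed
    assume "i \<noteq> j"
    then show False using *[of i j] *[of j i] that by (metis linorder_neqE_nat)
  qed
  have Einj: "i = j" if "i < m" "j < m" "E i" "E j" "key i = key j" for i j
  proof (rule ccontr)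
    have *: False if "i < j" "j < m" "E i" "key i = key j" for i j
    proof -
      have "i + 1 \<le> j" "i + 1 < m \<or> i + 1 = m" using that by auto
      then show False using srt[of "i + 1" j] srt[of i "i + 1"] that by (auto simp: E_def)
    qed
    assume "i \<noteq> j"
    then show False using *[of i j] *[of j i] that by (metis linorder_neqE_nat)
  qed
  let ?P = "\<lambda>r1 a1. r1 = r \<and> (\<forall>i<m. F i \<longrightarrow> a1 6 (key i) = i) \<and> (\<forall>v. v \<notin> verts s \<longrightarrow> a1 6 v = a 6 v) \<and>
       (\<forall>q. q \<noteq> 6 \<longrightarrow> a1 q = a q)"
  show ?thesis unfolding find_segments_def
  proof (rule runs_Seq[where P = ?P and ta = "100 * (m + 1)" and da = 200 and tb = "100 * (m + 1)" and db = 200], goal_cases)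
    case 1
    show ?case
    proof (rule runs_ParFor[where k = m and C = F and f = key and v = "\<lambda>i. i"], goal_cases)
      case (7 i)
      then have "i - Suc 0 < m" by simp
      with 7 show ?case using s01 ld[of i] ld[of "i - Suc 0"] by (auto simp: F_def)
    next
      case (12 i j) then show ?case using Finj by blast
    next
      case (14 a')
      have "a' 6 v = a 6 v" if "v \<notin> verts s" for v using 14(2)[of v] key_v that by auto
      then show ?case using 14 by auto
    qed (use s01 reg m_X ld in \<open>auto simp: ok_simps\<close>)
  next
    case A: (2 r1 a1)
    show ?case
    proof (rule runs_ParFor[where k = m and C = E and f = key and v = "\<lambda>i. i + 1"], goal_cases)
      case (7 i)
      then show ?case using s01 A ld[of i] ld[of "i + 1"] reg by (cases "i + 1 = m") (auto simp: E_def)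
    next
      case (12 i j) then show ?case using Einj by blast
    next
      case (14 a')
      have v: "a' 7 v = a 7 v" if "v \<notin> verts s" for v using 14(2)[of v] key_v that A by auto
      have "seg_ok a' s" unfolding seg_ok_def
      proof
        fix v assume "v \<in> verts s"
        then obtain j where j: "j < m" "v = key j" using keyv by blast
        define S where "S = {i. i < m \<and> key i = v}"
        have S: "finite S" "S \<noteq> {}" using j by (auto simp: S_def)
        have mn: "Min S \<in> S" and mx: "Max S \<in> S" using S by auto
        have "F (Min S)"
        proof (rule ccontr)
          assume "\<not> F (Min S)"
          then have "Min S - 1 \<in> S" "Min S \<noteq> 0" using mn by (auto simp: F_def S_def)
          then show False using Min_le[OF S(1), of "Min S - 1"] by simp
        qed
        then have 6: "a' 6 v = Min S" using A 14(3)[of 6] mn by (auto simp: S_def)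
        have "E (Max S)"
        proof (rule ccontr)
          assume "\<not> E (Max S)"
          then have "Max S + 1 \<in> S" using mx by (auto simp: E_def S_def)
          then show False using Max_ge[OF S(1), of "Max S + 1"] by simp
        qed
        then have 7: "a' 7 v = Max S + 1" using 14(1)[of "Max S"] mx by (auto simp: S_def)
        have "key i = v \<longleftrightarrow> Min S \<le> i \<and> i < Max S + 1" if "i < m" for i
        proof
          assume "key i = v"
          then have "i \<in> S" using that by (simp add: S_def)
          then show "Min S \<le> i \<and> i < Max S + 1" using S by (simp add: less_Suc_eq_le)
        next
          assume i: "Min S \<le> i \<and> i < Max S + 1"
          then have "key (Min S) \<le> key i" using srt that by blast
          moreover have "i \<le> Max S" "Max S < m" using i mx by (auto simp: S_def)
          then have "key i \<le> key (Max S)" by (rule srt)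
          ultimately show "key i = v" using mn mx by (auto simp: S_def)
        qed
        moreover have MM: "Max S < m" "Min S \<le> Max S" using mx S by (auto simp: S_def)
        moreover have "a' (4 + s) = ?o" using 14(3) A s01 by auto
        ultimately show "a' 6 v < a' 7 v \<and> a' 7 v \<le> m \<and>
            (\<forall>i<m. ep s (a' (4 + s) i) = v \<longleftrightarrow> a' 6 v \<le> i \<and> i < a' 7 v)"
          unfolding 6 7 using MM by (simp add: key_def less_Suc_eq_le Suc_le_eq)
      qed
      then have "Q r a'" using 14 A v by (intro post) auto
      then show ?case using A by simp
    qed (use s01 reg m_X ld A in \<open>auto simp: ok_simps\<close>)
  qed (use t m(1) in auto)
qed

end

section \<open>Running the levels and turning them into a feasible fixed-point solution\<close>

section \<open>The fractional solution\<close>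

lemma floor_sum_ge:
  fixes d :: nat
  assumes "0 < d"
  shows "(\<Sum>i\<in>A. f i) \<le> d * (\<Sum>i\<in>A. f i div d) + card A * d"
proof (induction A rule: infinite_finite_induct)
  case (insert x A)
  have "f x = d * (f x div d) + f x mod d" by simp
  moreover have "f x mod d < d" using assms by simp
  ultimately have "f x \<le> d * (f x div d) + d" by linarith
  then show ?case using insert by (simp add: algebra_simps)
qed auto

context alg
begin

text \<open>This is 2 * D * D * m with one \<open>D\<close> replaced by its bound 6 * N ^ 2 and
  \<open>m\<close> by N ^ 2. \<open>w0\<close> is the decay time of \<open>decay_small\<close>, and
  \<open>T\<close> provides \<open>D\<close> bands of width \<open>w0\<close>.\<close>

definition Big where "Big = 12 * D * N ^ 4"
definition w0 where "w0 = 6 * D * lg"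
definition T where "T = D * w0"

lemma lg_pos: "0 < lg"
  using N_ge N by (cases lg) auto

lemma Big_le: "Big \<le> 72 * N ^ 6"
proof -
  have "Big \<le> 12 * (6 * N ^ 2) * N ^ 4" unfolding Big_def using D by (intro mult_le_mono) auto
  also have "\<dots> = 72 * N ^ 6" by (simp add: power_add[symmetric])
  finally show ?thesis .
qed

lemma mBig_le: "m * Big \<le> 72 * N ^ 8"
proof -
  have "m * Big \<le> N ^ 2 * (72 * N ^ 6)" using m Big_le by (intro mult_le_mono) auto
  also have "\<dots> = 72 * N ^ 8" by (simp add: power_add[symmetric])
  finally show ?thesis .
qed

text \<open>Constant factors are paid for by extra powers of \<open>N\<close>, as N \<ge> 4.\<close>

lemma const_pow_X: "c \<le> 4 ^ j \<Longrightarrow> k + j \<le> 20 \<Longrightarrow> c * N ^ k \<le> X"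
proof -
  assume c: "c \<le> 4 ^ j" and kj: "k + j \<le> 20"
  have "c * N ^ k \<le> N ^ j * N ^ k" using pow4[OF c] by (intro mult_le_mono1)
  also have "\<dots> = N ^ (k + j)" by (simp add: power_add)
  finally show ?thesis by (rule le_X[OF kj])
qed

lemma mBig_X: "m * Big \<le> X"
  by (rule order_trans[OF mBig_le const_pow_X[of _ 4]]) auto

lemma mDBig_le: "2 * (m * D * Big) \<le> 864 * N ^ 10"
proof -
  have "2 * (m * D * Big) = 2 * D * (m * Big)" by simp
  also have "\<dots> \<le> 2 * (6 * N ^ 2) * (72 * N ^ 8)" using D by (intro mult_le_mono[OF _ mBig_le]) auto
  also have "\<dots> = 864 * N ^ 10" by (simp add: power_add[symmetric])
  finally show ?thesis .
qed

lemma lg_le: "lg \<le> N"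
  unfolding N by (rule le_pow2)

lemma w0_le: "w0 \<le> 36 * N ^ 3"
proof -
  have "w0 \<le> 6 * (6 * N ^ 2) * N" unfolding w0_def using D lg_le by (intro mult_le_mono) auto
  then show ?thesis by (simp add: power_numeral_reduce)
qed

lemma T_le: "T \<le> 216 * N ^ 5"
proof -
  have "T \<le> (6 * N ^ 2) * (36 * N ^ 3)" unfolding T_def using D w0_le by (intro mult_le_mono) auto
  also have "\<dots> = 216 * N ^ 5" by (simp add: power_add[symmetric])
  finally show ?thesis .
qed

lemma w0T_X: "2 * (w0 + T) \<le> X"
proof -
  have "N ^ 3 \<le> N ^ 5" using N_ge by (intro power_increasing) auto
  then have "2 * (w0 + T) \<le> 504 * N ^ 5" using w0_le T_le by simp
  also have "\<dots> \<le> X" by (rule const_pow_X[of _ 5]) auto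
  finally show ?thesis .
qed

sublocale levels m ep b "decay Big D" D Big w0
proof
  show "2 * D * D * m \<le> Big"
  proof -
    have "2 * D * D * m \<le> 2 * D * (6 * N ^ 2) * N ^ 2" using D m by (intro mult_le_mono) auto
    also have "\<dots> = Big" by (simp add: Big_def power_add[symmetric])
    finally show ?thesis .
  qed
  show "decay Big D k \<le> 2 * D" if "w0 \<le> k" for k
    unfolding Big_def by (rule decay_small[OF _ N N_ge]) (use D that w0_def in auto)
qed (use D decay_near lg_pos in \<open>auto simp: w0_def\<close>)

text \<open>The data that the level process and the rounding only read. The table reaches w0 + T,
  the largest exponent for levels up to \<open>T\<close>.\<close>

definition static :: "(nat \<Rightarrow> nat \<Rightarrow> nat) \<Rightarrow> bool" where
  "static a \<longleftrightarrow> (\<forall>s<2. (\<forall>i<m. a s i = ep s i \<and> a (2 + s) i = b (ep s i)) \<and> ord_ok a s \<and> seg_ok a s) \<and>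
     (\<forall>k\<le>w0 + T. a 12 k = decay Big D k)"

lemma static_cong: "static a \<Longrightarrow> (\<And>r. r < 8 \<Longrightarrow> a' r = a r) \<Longrightarrow> a' 12 = a 12 \<Longrightarrow> static a'"
  unfolding static_def ord_ok_def seg_ok_def by auto

definition key :: "(nat \<Rightarrow> nat \<Rightarrow> nat) \<Rightarrow> nat \<Rightarrow> nat \<Rightarrow> nat" where
  "key a s i = ep s (a (4 + s) i)"

lemma static_ep: "static a \<Longrightarrow> s < 2 \<Longrightarrow> i < m \<Longrightarrow> a s i = ep s i"
  by (auto simp: static_def)

lemma static_bud: "static a \<Longrightarrow> s < 2 \<Longrightarrow> i < m \<Longrightarrow> a (2 + s) i = b (ep s i)"
  by (auto simp: static_def)

lemma static_ord: "static a \<Longrightarrow> s < 2 \<Longrightarrow> i < m \<Longrightarrow> a (4 + s) i < m"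
  by (auto simp: static_def ord_ok_def dest!: bij_betwE)

lemma static_key: "static a \<Longrightarrow> s < 2 \<Longrightarrow> i < m \<Longrightarrow> a s (a (4 + s) i) = key a s i"
  by (simp add: static_ep static_ord key_def)

lemma key_verts: "static a \<Longrightarrow> s < 2 \<Longrightarrow> i < m \<Longrightarrow> key a s i \<in> verts s"
  by (auto simp: key_def verts_def static_ord)

lemma static_seg:
  assumes "static a" "s < 2" "v \<in> verts s"
  shows "a 6 v < a 7 v" "a 7 v \<le> m" "i < m \<Longrightarrow> key a s i = v \<longleftrightarrow> a 6 v \<le> i \<and> i < a 7 v"
  using assms by (auto simp: static_def seg_ok_def key_def)

lemma key_first: "static a \<Longrightarrow> s < 2 \<Longrightarrow> v \<in> verts s \<Longrightarrow> key a s (a 6 v) = v \<and> a 6 v < m"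
  using static_seg(1,2)[of a s v] static_seg(3)[of a s v "a 6 v"] by auto

text \<open>A segment of the sorted list consists of exactly the edges at \<open>v\<close>, so two
  prefix sums give its load whatever values \<open>x\<close> are summed.\<close>

lemma seg_load:
  assumes a: "static a" "s < 2" "v \<in> verts s"
  shows "(\<Sum>i<a 7 v. x (a (4 + s) i)) - (\<Sum>i<a 6 v. x (a (4 + s) i)) = load s x v"
proof -
  have bij: "bij_betw (a (4 + s)) {..<m} {..<m}" using a by (auto simp: static_def ord_ok_def)
  let ?S = "{a 6 v..<a 7 v}"
  have "(\<Sum>i<a 7 v. x (a (4 + s) i)) = (\<Sum>i<a 6 v. x (a (4 + s) i)) + (\<Sum>i\<in>?S. x (a (4 + s) i))"
    unfolding lessThan_atLeast0 using static_seg(1)[OF a] by (subst sum.atLeastLessThan_concat) auto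
  moreover have "(\<Sum>i\<in>?S. x (a (4 + s) i)) = sum x (a (4 + s) ` ?S)"
  proof (subst sum.reindex)
    show "inj_on (a (4 + s)) ?S"
    proof (rule inj_on_subset)
      show "inj_on (a (4 + s)) {..<m}" using bij by (simp add: bij_betw_def)
      show "?S \<subseteq> {..<m}" using static_seg(2)[OF a] by auto
    qed
  qed simp
  moreover have "a (4 + s) ` ?S = inc s v"
  proof
    show "a (4 + s) ` ?S \<subseteq> inc s v"
    proof
      fix e assume "e \<in> a (4 + s) ` ?S"
      then obtain i where i: "a 6 v \<le> i" "i < a 7 v" "e = a (4 + s) i" by auto
      then have "i < m" using static_seg(2)[OF a] by simp
      then show "e \<in> inc s v"
        using i static_seg(3)[OF a, of i] static_ord[OF a(1,2)] by (simp add: inc_def key_def)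
    qed
    show "inc s v \<subseteq> a (4 + s) ` ?S"
    proof
      fix e assume "e \<in> inc s v"
      then have e: "e \<in> {..<m}" "ep s e = v" by (auto simp: inc_def)
      then have "e \<in> a (4 + s) ` {..<m}" using bij by (simp add: bij_betw_def)
      then obtain i where "i < m" "e = a (4 + s) i" by auto
      with e static_seg(3)[OF a, of i] show "e \<in> a (4 + s) ` ?S" by (auto simp: key_def)
    qed
  qed
  ultimately show ?thesis by (simp add: load_def)
qed

definition env :: "regs \<Rightarrow> bool" where
  "env r \<longleftrightarrow> r ''n'' = n \<and> r ''m'' = m \<and> r ''N'' = N \<and> r ''p'' = 2 ^ q \<and> r ''D'' = D \<and> r ''B'' = Big \<and>
     r ''w'' = w0 \<and> r ''T'' = T"

definition lev_ok :: "(nat \<Rightarrow> nat \<Rightarrow> nat) \<Rightarrow> (nat \<Rightarrow> nat) \<Rightarrow> bool" where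
  "lev_ok a lev \<longleftrightarrow> (\<forall>s<2. \<forall>v\<in>verts s. a 8 v = lev v \<and> lev v \<le> T)"

lemma lev_okD:
  assumes "lev_ok a lev" "i < m"
  shows "a 8 (ep 0 i) = lev (ep 0 i)" "a 8 (ep 1 i) = lev (ep 1 i)" "lev (ep 1 i) \<le> T"
    "a 8 (ep (Suc 0) i) = lev (ep (Suc 0) i)"
  using assms unfolding lev_ok_def verts_def by (auto simp: numeral_2_eq_2)

lemma xval_le: "xval c lev i \<le> Big"
  using g_le by (simp add: xval_def)

lemma sum_xval_X:
  assumes "static a" "s < 2"
  shows "(\<Sum>i<m. xval c lev (a (4 + s) i)) \<le> X"
proof -
  have "(\<Sum>i<m. xval c lev (a (4 + s) i)) \<le> (\<Sum>i<m. Big)" by (intro sum_mono xval_le)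
  then show ?thesis using mBig_X by simp
qed

lemma xval_table:
  assumes "static a" "lev_ok a lev" "i < m"
  shows "(if 0 < b (ep 0 i) then a 12 ((w0 + lev (ep 1 i)) - (lev (ep 0 i) + c)) else 0) = xval c lev i"
proof -
  have "lev (ep 1 i) \<le> T" using lev_okD[OF assms(2,3)] by simp
  then have "(w0 + lev (ep 1 i)) - (lev (ep 0 i) + c) \<le> w0 + T" by simp
  then show ?thesis using assms(1) by (simp add: xval_def static_def)
qed

lemma runs_edge_vals:
  assumes s: "s < 2" and c: "c < 2" and env: "env r" and st: "static a" and hz: "heap_zero a" and lev: "lev_ok a lev"
    and post: "\<And>a'. (\<And>v. v \<in> verts s \<Longrightarrow> a' 11 (2 ^ q + a 7 v) - a' 11 (2 ^ q + a 6 v) = load s (xval c lev) v) \<Longrightarrow>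
       heap_zero a' \<Longrightarrow> (\<And>r. r \<noteq> 10 \<Longrightarrow> r \<noteq> 11 \<Longrightarrow> a' r = a r) \<Longrightarrow> Q (r(''h'' := 2 ^ q)) a'"
    and t: "8000 * m \<le> t" "1200 * (q + 1) \<le> d"
  shows "runs (edge_vals s c) r a t d Q"
  unfolding edge_vals_def
proof (rule runs_psum[where v = "\<lambda>i. xval c lev (a (4 + s) i)"], goal_cases)
  case (6 i)
  let ?e = "a (4 + s) i"
  have e: "?e < m" using static_ord[OF st s 6] .
  show ?case
    using lev_okD[OF lev e] static_ep[OF st _ e, of 0] static_ep[OF st _ e, of 1] static_bud[OF st _ e, of 0]
      xval_table[OF st lev e, of c] env by (auto simp: env_def)
next
  case (8 a')
  show ?case
  proof (rule post)
    fix v assume v: "v \<in> verts s"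
    have "a 7 v \<le> m" "a 6 v \<le> m" using static_seg[OF st s v] by auto
    then show "a' 11 (2 ^ q + a 7 v) - a' 11 (2 ^ q + a 6 v) = load s (xval c lev) v"
      using 8(1) seg_load[OF st s v] by simp
  qed (use 8 in auto)
qed (use s c env hz t sum_xval_X[OF st s] in \<open>auto simp: env_def ok_simps\<close>)

text \<open>One formula for both sides, so that \<open>update_levels\<close> is verified once; the
  shift 1 - s is the tentative step of L.\<close>

definition raise :: "nat \<Rightarrow> (nat \<Rightarrow> nat) \<Rightarrow> nat \<Rightarrow> nat" where
  "raise s lev v = lev v + of_bool (v \<in> verts s \<and> (b v * Big < load s (xval (1 - s) lev) v \<longleftrightarrow> s = 1))"

lemma raise_eq: "raise 1 lev = raise_R lev" "raise 0 lev = raise_L lev"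
  by (auto simp: raise_def raise_R_def raise_L_def fun_eq_iff)

lemma runs_update_levels:
  assumes s: "s < 2" and env: "env r" and st: "static a" and hz: "heap_zero a" and lev: "lev_ok a lev"
    and T: "\<And>v. v \<in> verts s \<Longrightarrow> lev v < T"
    and post: "\<And>a'. static a' \<Longrightarrow> heap_zero a' \<Longrightarrow> lev_ok a' (raise s lev) \<Longrightarrow>
       (\<And>r. r \<notin> {8, 9, 10, 11} \<Longrightarrow> a' r = a r) \<Longrightarrow> Q (r(''h'' := 2 ^ q)) a'"
    and t: "9000 * m \<le> t" "1700 * (q + 1) \<le> d"
  shows "runs (update_levels s) r a t d Q"
proof -
  let ?P1 = "\<lambda>r1 a1. r1 = r(''h'' := 2 ^ q) \<and>
     (\<forall>v\<in>verts s. a1 11 (2 ^ q + a 7 v) - a1 11 (2 ^ q + a 6 v) = load s (xval (1 - s) lev) v) \<and>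
     heap_zero a1 \<and> (\<forall>r. r \<noteq> 10 \<longrightarrow> r \<noteq> 11 \<longrightarrow> a1 r = a r)"
  let ?P2 = "\<lambda>r1 a1. r1 = r(''h'' := 2 ^ q) \<and> (\<forall>v\<in>verts s. a1 9 v = raise s lev v) \<and>
     heap_zero a1 \<and> (\<forall>r. r \<noteq> 9 \<longrightarrow> r \<noteq> 10 \<longrightarrow> r \<noteq> 11 \<longrightarrow> a1 r = a r)"
  have s01: "s = 0 \<or> s = 1" using s by auto
  have rg: "r ''m'' = m" "r ''p'' = 2 ^ q" "r ''B'' = Big" using env by (auto simp: env_def)
  have k[simp]: "a s (a (4 + s) i) = key a s i" "a (2 + s) (a (4 + s) i) = b (key a s i)"
    "a 8 (key a s i) = lev (key a s i)" "lev (key a s i) < T" if "i < m" for i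
    using static_key[OF st s that] static_bud[OF st s static_ord[OF st s that]] key_verts[OF st s that] lev T s
    by (auto simp: key_def lev_ok_def)
  have inj: "i = j" if "a 6 (key a s i) = i" "a 6 (key a s j) = j" "key a s i = key a s j" for i j
    using that by metis
  have raise_le: "raise s lev v \<le> T" if "v \<in> verts s" for v using T[OF that] by (simp add: raise_def)
  have TX: "T \<le> X" using w0T_X by simp
  show ?thesis unfolding update_levels_def
  proof (rule runs_Seq[where P = ?P1 and ta = "8000 * m" and da = "1200 * (q + 1)" and tb = "200 * (m + 1)" and db = 400], goal_cases)
    case 1
    show ?case by (rule runs_edge_vals[OF s _ env st hz lev]) auto
  next
    case A: (2 r1 a1)
    then have a1: "a1 (4 + s) = a (4 + s)" "a1 s = a s" "a1 6 = a 6" "a1 7 = a 7" "a1 (2 + s) = a (2 + s)" "a1 8 = a 8"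
      using s01 by auto
    show ?case
    proof (rule runs_Seq[where P = ?P2 and ta = "100 * (m + 1)" and da = 200 and tb = "100 * (m + 1)" and db = 200], goal_cases)
      case 1
      show ?case
      proof (rule runs_ParFor[where k = m and C = "\<lambda>i. a 6 (key a s i) = i" and f = "key a s" and v = "\<lambda>i. raise s lev (key a s i)"], goal_cases)
        case (7 i) then show ?case using A a1 s by simp
      next
        case (8 i) then show ?case using A a1 s by simp
      next
        case (9 i)
        have L: "a1 11 (2 ^ q + a 7 (key a s i)) - a1 11 (2 ^ q + i) = load s (xval (1 - s) lev) (key a s i)"
          using A key_verts[OF st s 9(1)] 9(2) by metis
        have r1: "r1 = r(''h'' := 2 ^ q)" using A by blast
        have "nval (Reg ''g'' \<oplus> ((Reg ''u'' \<otimes> Reg ''B'' \<prec> Reg ''y'' \<ominus> Reg ''c'') \<doteq> Const s))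
            (lsem [(''e'', 4 + s, Reg ''i''), (''x'', s, Reg ''e''), (''a'', 6, Reg ''x''), (''f'', 7, Reg ''x''),
            (''y'', 11, Reg ''p'' \<oplus> Reg ''f''), (''c'', 11, Reg ''p'' \<oplus> Reg ''a''), (''u'', 2 + s, Reg ''e''), (''g'', 8, Reg ''x'')]
            (r1(''i'' := i)) a1) =
          lev (key a s i) + (if (if b (key a s i) * Big < load s (xval (1 - s) lev) (key a s i) then 1 else 0) = s then 1 else 0)"
          unfolding lsem.simps a1 nval.simps apply_binop.simps by (simp add: r1 rg 9 L del: add_2_eq_Suc add_2_eq_Suc')
        then show ?case using s01 key_verts[OF st s 9(1)] by (auto simp: raise_def)
      next
        case (10 i) then show ?case using raise_le[OF key_verts[OF st s 10(1)]] TX by simp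
      next
        case (12 i j) then show ?case using inj by blast
      next
        case (14 a')
        have "a' 9 v = raise s lev v" if "v \<in> verts s" for v
          using 14(1)[of "a 6 v"] key_first[OF st s that] by simp
        then show ?case using 14 A by (auto simp: heap_zero_def)
      qed (use s01 A rg m_X in \<open>auto simp: ok_simps\<close>)
    next
      case A: (2 r1 a1)
      then have a1: "a1 (4 + s) = a (4 + s)" "a1 s = a s" "a1 6 = a 6" using s01 by auto
      show ?case
      proof (rule runs_ParFor[where k = m and C = "\<lambda>i. a 6 (key a s i) = i" and f = "key a s" and v = "\<lambda>i. raise s lev (key a s i)"], goal_cases)
        case (7 i) then show ?case using A a1 s by simp
      next
        case (8 i) then show ?case using A a1 s by simp
      next
        case (9 i) then show ?case using A a1 s key_verts[OF st s 9(1)] by simp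
      next
        case (10 i) then show ?case using raise_le[OF key_verts[OF st s 10(1)]] TX by simp
      next
        case (12 i j) then show ?case using inj by blast
      next
        case (14 a')
        have oth: "a' r = a r" if "r \<notin> {8, 9, 10, 11}" for r using 14(3)[of r] A that by auto
        have "lev_ok a' (raise s lev)" unfolding lev_ok_def
        proof (intro allI impI ballI)
          fix s' v :: nat assume s': "s' < 2" "v \<in> verts s'"
          show "a' 8 v = raise s lev v \<and> raise s lev v \<le> T"
          proof (cases "v \<in> verts s")
            case True
            then show ?thesis using 14(1)[of "a 6 v"] key_first[OF st s True] raise_le by simp
          next
            case False
            then have "a' 8 v = a1 8 v" using 14(2)[of v] key_verts[OF st s] by auto
            then show ?thesis using False A s' lev by (auto simp: raise_def lev_ok_def)
          qed
        qed
        moreover have "static a'" by (rule static_cong[OF st]) (auto intro: oth)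
        moreover have "heap_zero a'" using A 14(3)[of 10] by (simp add: heap_zero_def)
        ultimately have "Q (r(''h'' := 2 ^ q)) a'" using oth by (intro post)
        then show ?case using A by simp
      qed (use s01 A rg m_X in \<open>auto simp: ok_simps\<close>)
    qed auto
  qed (use t m in auto)
qed

lemma runs_level_rounds:
  assumes env: "env r" and st: "static a" and hz: "heap_zero a" and lev: "\<And>v. a 8 v = 0"
    and post: "\<And>r' a' lev. static a' \<Longrightarrow> heap_zero a' \<Longrightarrow> lev_ok a' lev \<Longrightarrow> invar T lev \<Longrightarrow>
       (\<And>r. r \<notin> {8, 9, 10, 11} \<Longrightarrow> a' r = a r) \<Longrightarrow> (\<And>x. x \<noteq> ''h'' \<Longrightarrow> x \<noteq> ''t'' \<Longrightarrow> r' x = r x) \<Longrightarrow> Q r' a'"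
    and t: "20000 * m * T + 100 \<le> t" "4000 * (q + 1) * T + 100 \<le> d"
  shows "runs level_rounds r a t d Q"
proof -
  let ?I = "\<lambda>k r1 a1. (\<exists>h. r1 = r(''h'' := h, ''t'' := k)) \<and> static a1 \<and> heap_zero a1 \<and>
     (\<exists>lev. lev_ok a1 lev \<and> invar k lev) \<and> (\<forall>r. r \<notin> {8, 9, 10, 11} \<longrightarrow> a1 r = a r)"
  show ?thesis unfolding level_rounds_def
  proof (rule runs_Seq[where P = "?I 0" and ta = 40 and da = 40 and tb = "20000 * m * T + 60" and db = "4000 * (q + 1) * T + 60"], goal_cases)
    case 1
    have "lev_ok a (\<lambda>_. 0)" using lev by (simp add: lev_ok_def)
    moreover have "\<exists>h. r(''t'' := 0) = r(''h'' := h, ''t'' := 0)" by (rule exI[of _ "r ''h''"]) simp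
    ultimately show ?case using st hz invar_0 by (intro runs_Assign) (auto simp: ok_simps)
  next
    case I0: (2 r1 a1)
    show ?case
    proof (rule runs_While[where k = T and I = ?I and tb = "\<lambda>_. 18000 * m + 40" and db = "\<lambda>_. 3400 * (q + 1) + 40"], goal_cases)
      case 2 then show ?case using I0 .
    next
      case (3 k r1 a1)
      then obtain h lev where h: "r1 = r(''h'' := h, ''t'' := k)" and lev: "lev_ok a1 lev" "invar k lev" by blast
      have e1: "env r1" using env by (simp add: h env_def)
      have lt: "lev v < T" if "v \<in> verts 0 \<or> v \<in> verts 1" for v
        using lev(2) that 3(1) by (auto simp: invar_def)
      have lt1: "raise_R lev v < T" if "v \<in> verts 0" for v
        using lt verts_disjoint[OF that] that by (simp add: raise_R_def)
      have "runs (Seq (update_levels 1) (Seq (update_levels 0) (Assign ''t'' (Reg ''t'' \<oplus> Const 1)))) r1 a1 (18000 * m + 40) (3400 * (q + 1) + 40) (?I (Suc k))"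
      proof (rule runs_Seq[where P = "\<lambda>r2 a2. r2 = r1(''h'' := 2 ^ q) \<and> static a2 \<and> heap_zero a2 \<and> lev_ok a2 (raise_R lev) \<and>
            (\<forall>r. r \<notin> {8, 9, 10, 11} \<longrightarrow> a2 r = a r)" and ta = "9000 * m" and da = "1700 * (q + 1)" and tb = "9000 * m + 40" and db = "1700 * (q + 1) + 40"], goal_cases)
        case 1
        show ?case
          by (rule runs_update_levels[OF _ e1 _ _ lev(1)]) (use 3 lt raise_eq in auto)
      next
        case A: (2 r2 a2)
        then have e2: "env r2" using e1 by (simp add: env_def)
        show ?case
        proof (rule runs_Seq[where P = "\<lambda>r3 a3. r3 = r1(''h'' := 2 ^ q) \<and> static a3 \<and> heap_zero a3 \<and> lev_ok a3 (raise_L (raise_R lev)) \<and>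
            (\<forall>r. r \<notin> {8, 9, 10, 11} \<longrightarrow> a3 r = a r)" and ta = "9000 * m" and da = "1700 * (q + 1)" and tb = 40 and db = 40], goal_cases)
          case 1
          show ?case
            by (rule runs_update_levels[OF _ e2, where lev = "raise_R lev"]) (use A lt1 raise_eq in auto)
        next
          case B: (2 r3 a3)
          have "\<exists>h'. r3(''t'' := Suc k) = r(''h'' := h', ''t'' := Suc k)"
            using B h by (intro exI[of _ "2 ^ q"]) (simp add: fun_upd_twist)
          moreover have "invar (Suc k) (raise_L (raise_R lev))" by (rule invar_step[OF lev(2)])
          moreover have "Suc k \<le> X" using 3(1) w0T_X by simp
          moreover have "r3 ''t'' = k" using B h by simp
          ultimately show ?case using B by (intro runs_Assign) (auto simp: ok_simps)
        qed auto
      qed auto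
      then show ?case using h env 3(1) by (simp add: env_def)
    next
      case (4 r1 a1)
      then have "r1 ''t'' = T" "r1 ''T'' = T" using env by (auto simp: env_def)
      moreover have "Q r1 a1" using 4 by (auto intro: post)
      ultimately show ?case by simp
    next
      case 5
      show ?case using m(1) by (cases m) (simp_all add: algebra_simps)
    next
      case 6
      show ?case by (simp add: algebra_simps)
    qed (auto simp: ok_simps)
  qed (use t in auto)
qed

text \<open>The value in units of 1 / pw. The single quotient merges the conversion from units of 1
  / Big with the clipping at R: without overload the factor is pw / Big, otherwise this times
  capacity over load. With budget 0 in R the numerator is 0.\<close>

definition clip :: "nat \<Rightarrow> (nat \<Rightarrow> nat) \<Rightarrow> nat \<Rightarrow> nat" where
  "clip pw lev i = (xval 0 lev i * b (ep 1 i) * pw) div max (load 1 (xval 0 lev) (ep 1 i)) (b (ep 1 i) * Big)"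

lemma Big_pos: "0 < Big"
  using D N_ge by (simp add: Big_def)

lemma clip_le: "clip pw lev i \<le> (xval 0 lev i * pw) div Big"
proof (cases "b (ep 1 i) = 0")
  case False
  let ?b = "b (ep 1 i)"
  have eq: "xval 0 lev i * ?b * pw = ?b * (xval 0 lev i * pw)" by simp
  have "clip pw lev i \<le> (?b * (xval 0 lev i * pw)) div (?b * Big)"
    unfolding clip_def eq using False Big_pos by (intro div_le_mono2) auto
  also have "\<dots> = (xval 0 lev i * pw) div Big" using False by simp
  finally show ?thesis .
qed (simp add: clip_def)

lemma clip_le_pw: "clip pw lev i \<le> pw"
proof -
  have "(xval 0 lev i * pw) div Big \<le> (Big * pw) div Big" by (intro div_le_mono mult_le_mono1 xval_le)
  then show ?thesis using clip_le[of pw lev i] Big_pos by simp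
qed

text \<open>At L clipping only lowers values, so feasibility is inherited from \<open>invar\<close>;
  at R the denominator is at least the load.\<close>

lemma clip_fractional:
  assumes "invar t lev"
  shows "fractional pw (clip pw lev)"
  unfolding fractional_def
proof (intro conjI allI impI)
  fix s v :: nat assume s: "s < 2"
  let ?x = "xval 0 lev"
  have sum_div: "(\<Sum>i\<in>A. f i div d) \<le> (\<Sum>i\<in>A. f i) div d" for A and f :: "nat \<Rightarrow> nat" and d
  proof (induction A rule: infinite_finite_induct)
    case (insert y A)
    have "f y div d + sum f A div d \<le> (f y + sum f A) div d"
      unfolding div_add1_eq[of "f y" "sum f A" d] by simp
    then show ?case using insert by simp
  qed auto
  have "s = 0 \<or> s = 1" using s by auto
  then consider "v \<in> verts s" "s = 0" | "v \<in> verts s" "s = 1" | "v \<notin> verts s" by blast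
  then show "load s (clip pw lev) v \<le> b v * pw"
  proof cases
    case 1
    have "load 0 (clip pw lev) v \<le> (\<Sum>i\<in>inc 0 v. (?x i * pw) div Big)"
      unfolding load_def by (intro sum_mono clip_le)
    also have "\<dots> \<le> (\<Sum>i\<in>inc 0 v. ?x i * pw) div Big" by (rule sum_div)
    also have "(\<Sum>i\<in>inc 0 v. ?x i * pw) = load 0 ?x v * pw" by (simp add: load_def sum_distrib_right)
    also have "load 0 ?x v * pw div Big \<le> (b v * Big) * pw div Big"
      using assms 1 by (intro div_le_mono mult_le_mono1) (auto simp: invar_def)
    also have "(b v * Big) * pw = Big * (b v * pw)" by simp
    also have "\<dots> div Big = b v * pw" using Big_pos by simp
    finally show ?thesis using 1 by simp
  next
    case 2
    let ?M = "max (load 1 ?x v) (b v * Big)"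
    have "load 1 (clip pw lev) v = (\<Sum>i\<in>inc 1 v. (?x i * b v * pw) div ?M)"
      unfolding load_def by (intro sum.cong) (auto simp: clip_def inc_def load_def)
    also have "\<dots> \<le> (\<Sum>i\<in>inc 1 v. ?x i * b v * pw) div ?M" by (rule sum_div)
    also have "(\<Sum>i\<in>inc 1 v. ?x i * b v * pw) = load 1 ?x v * (b v * pw)"
      unfolding load_def sum_distrib_right by (rule sum.cong) simp_all
    also have "\<dots> div ?M \<le> ?M * (b v * pw) div ?M" by (intro div_le_mono mult_le_mono1) simp
    also have "\<dots> \<le> b v * pw" by simp
    finally show ?thesis using 2 by simp
  next
    case 3
    then have "inc s v = {}" by (auto simp: inc_def verts_def)
    then show ?thesis by (simp add: load_def)
  qed
qed (rule clip_le_pw)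

text \<open>Truncation loses less than one unit per edge, hence the term \<open>m\<close>; apart
  from it the scaling at R yields exactly the clipped loads.\<close>

lemma clip_sum: "pw * clipped lev \<le> Big * (sum (clip pw lev) {..<m} + m)"
proof -
  let ?x = "xval 0 lev"
  have v: "pw * min (load 1 ?x v) (b v * Big) \<le> Big * (load 1 (clip pw lev) v + card (inc 1 v))" for v
  proof (cases "b v = 0")
    case False
    let ?M = "max (load 1 ?x v) (b v * Big)"
    have M: "0 < ?M" using False Big_pos by (simp add: max_def)
    have ld: "load 1 (clip pw lev) v = (\<Sum>i\<in>inc 1 v. (?x i * b v * pw) div ?M)"
      unfolding load_def by (intro sum.cong) (auto simp: clip_def inc_def load_def)
    have "load 1 ?x v * (b v * pw) = (\<Sum>i\<in>inc 1 v. ?x i * b v * pw)"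
      unfolding load_def sum_distrib_right by (rule sum.cong) simp_all
    also have "\<dots> \<le> ?M * load 1 (clip pw lev) v + card (inc 1 v) * ?M"
      unfolding ld by (rule floor_sum_ge[OF M])
    finally have *: "load 1 ?x v * (b v * pw) \<le> ?M * (load 1 (clip pw lev) v + card (inc 1 v))"
      by (simp add: algebra_simps)
    have "?M * (pw * min (load 1 ?x v) (b v * Big)) = Big * (load 1 ?x v * (b v * pw))"
      by (auto simp: max_def min_def)
    also have "\<dots> \<le> Big * (?M * (load 1 (clip pw lev) v + card (inc 1 v)))"
      using * by (rule mult_le_mono2)
    also have "\<dots> = ?M * (Big * (load 1 (clip pw lev) v + card (inc 1 v)))" by simp
    finally show ?thesis using M by simp
  qed simp
  have "pw * clipped lev \<le> (\<Sum>v\<in>verts 1. Big * (load 1 (clip pw lev) v + card (inc 1 v)))"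
    unfolding clipped_def sum_distrib_left by (intro sum_mono v)
  also have "\<dots> = Big * ((\<Sum>v\<in>verts 1. load 1 (clip pw lev) v) + (\<Sum>v\<in>verts 1. card (inc 1 v)))"
    by (simp only: sum.distrib sum_distrib_left distrib_left)
  also have "(\<Sum>v\<in>verts 1. card (inc 1 v)) = m"
    using sum_load_all[of 1 "\<lambda>_. 1"] by (simp add: load_def)
  finally show ?thesis by (simp add: sum_load_all)
qed

lemma clipped_le: "clipped lev \<le> m * Big"
proof -
  have "clipped lev \<le> (\<Sum>v\<in>verts 1. load 1 (xval 0 lev) v)" unfolding clipped_def by (intro sum_mono) auto
  also have "\<dots> \<le> (\<Sum>i<m. Big)" unfolding sum_load_all by (intro sum_mono xval_le)
  finally show ?thesis by simp
qed

text \<open>Sums over vertices are computed over edge positions, each vertex being represented by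
  the first position of its segment.\<close>

lemma sum_first:
  assumes "static a" "s < 2"
  shows "(\<Sum>i<m. of_bool (a 6 (key a s i) = i) * f (key a s i)) = (\<Sum>v\<in>verts s. f v :: nat)"
proof -
  have "(\<Sum>i<m. of_bool (a 6 (key a s i) = i) * f (key a s i)) = (\<Sum>i | i < m \<and> a 6 (key a s i) = i. f (key a s i))"
    by (rule sum.mono_neutral_cong_right) auto
  also have "\<dots> = (\<Sum>v\<in>verts s. f v)"
    by (rule sum.reindex_bij_witness[of _ "a 6" "key a s"])
       (use key_first[OF assms] key_verts[OF assms] in auto)
  finally show ?thesis .
qed

text \<open>The lower bound on \<open>2 ^ k\<close> makes the truncation loss a fraction 1 / D; the
  upper one, a factor 2 away by minimality, limits the odd edges during rounding.\<close>

lemma runs_pw_init: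
  assumes env: "env r" and V: "a 11 (2 ^ q + m) = V" "V \<le> m * Big"
    and post: "\<And>k r'. m * D * Big \<le> 2 ^ k * max V 1 \<Longrightarrow> k = 0 \<or> 2 ^ k * max V 1 \<le> 2 * (m * D * Big) \<Longrightarrow>
      2 ^ k \<le> N ^ 15 \<Longrightarrow> r' ''o'' = 2 ^ k \<Longrightarrow> (\<And>x. x \<noteq> ''V'' \<Longrightarrow> x \<noteq> ''o'' \<Longrightarrow> r' x = r x) \<Longrightarrow> Q r' a"
    and t: "2000 * lg \<le> t" "2000 * lg \<le> d"
  shows "runs pw_init r a t d Q"
proof -
  define W where "W = max V 1"
  define k where "k = (LEAST k. m * D * Big \<le> 2 ^ k * W)"
  have W: "1 \<le> W" "W \<le> X" using V mBig_X m_X m(1) by (auto simp: W_def)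
  have ex: "m * D * Big \<le> 2 ^ (m * D * Big) * W"
    using le_pow2[of "m * D * Big"] W by (metis le_trans mult.right_neutral mult_le_mono2)
  have k1: "m * D * Big \<le> 2 ^ k * W" unfolding k_def using ex by (rule LeastI)
  have k2: "2 ^ j * W < m * D * Big" if "j < k" for j
    using not_less_Least[of j "\<lambda>k. m * D * Big \<le> 2 ^ k * W"] that by (simp add: k_def)
  have k3: "k = 0 \<or> 2 ^ k * W \<le> 2 * (m * D * Big)"
  proof (cases k)
    case (Suc j)
    then show ?thesis using k2[of j] by simp
  qed simp
  have k4: "2 ^ k \<le> N ^ 15"
  proof (cases "k = 0")
    case False
    then have "2 ^ k * 1 \<le> 2 * (m * D * Big)" using k3 W by (meson le_trans mult_le_mono2)
    also have "\<dots> \<le> 864 * N ^ 10" by (rule mDBig_le)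
    also have "\<dots> \<le> N ^ 5 * N ^ 10" by (intro mult_le_mono1 pow4) simp
    also have "\<dots> = N ^ 15" by (simp add: power_add[symmetric])
    finally show ?thesis by simp
  qed (use N_ge in simp)
  \<comment> \<open>Since \<open>2 ^ k\<close> is polynomial in n, only O(log n) halvings are needed
    afterwards.\<close>
  have "(2::nat) ^ k \<le> 2 ^ (lg * 15)" using k4 unfolding N by (simp only: power_mult)
  then have k5: "k \<le> 15 * lg" by simp
  have X: "2 ^ k \<le> X" using k4 by (rule le_X[rotated]) simp
  let ?A = "\<lambda>v r1 a1. r1 = r(''V'' := v) \<and> a1 = a"
  let ?I = "\<lambda>j r1 a1. r1 = r(''V'' := W, ''o'' := 2 ^ j) \<and> a1 = a"
  have rg: "r ''m'' = m" "r ''D'' = D" "r ''B'' = Big" "r ''p'' = 2 ^ q" using env by (auto simp: env_def)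
  show ?thesis unfolding pw_init_def
  proof (rule runs_Seq[where P = "?A V" and ta = 40 and da = 40 and tb = "80 * k + 120" and db = "80 * k + 120"], goal_cases)
    case 1
    show ?case by (rule runs_Load) (auto simp: ok_simps rg V)
  next
    case A: (2 r1 a1)
    show ?case
    proof (rule runs_Seq[where P = "?A W" and ta = 40 and da = 40 and tb = "80 * k + 80" and db = "80 * k + 80"], goal_cases)
      case 1
      have "V + (if V = 0 then 1 else 0) = W" by (auto simp: W_def)
      then show ?case using A W by (intro runs_Assign) (auto simp: ok_simps)
    next
      case A: (2 r1 a1)
      show ?case
      proof (rule runs_Seq[where P = "?I 0" and ta = 40 and da = 40 and tb = "80 * k + 40" and db = "80 * k + 40"], goal_cases)
        case 1
        show ?case using A X_ge by (intro runs_Assign) (auto simp: ok_simps)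
      next
        case I0: (2 r1 a1)
        show ?case
        proof (rule runs_While[where k = k and I = ?I and tb = "\<lambda>_. 40" and db = "\<lambda>_. 40"], goal_cases)
          case 2 then show ?case using I0 .
        next
          case (3 j r1 a1)
          have "(2::nat) ^ Suc j \<le> 2 ^ k" using 3 by (intro power_increasing) auto
          then have "2 * 2 ^ j \<le> X" using X by simp
          then show ?case using 3 k2[of j] by (auto simp: rg ok_simps intro!: runs_Assign)
        next
          case (4 r1 a1)
          have "Q r1 a" by (rule post[of k]) (use 4 k1 k3 k4 in \<open>auto simp: W_def\<close>)
          then show ?case using 4 k1 by (auto simp: rg)
        qed (auto simp: ok_simps)
      qed auto
    qed auto
  qed (use t k5 lg_pos in auto)
qed

lemma runs_finish_fractional:
  assumes env: "env r" and st: "static a" and hz: "heap_zero a" and lev: "lev_ok a lev" and inv: "invar t0 lev"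
    and post: "\<And>k r' a'. m * D * Big \<le> 2 ^ k * max (clipped lev) 1 \<Longrightarrow>
      k = 0 \<or> 2 ^ k * max (clipped lev) 1 \<le> 2 * (m * D * Big) \<Longrightarrow> 2 ^ k \<le> N ^ 15 \<Longrightarrow>
      r' ''o'' = 2 ^ k \<Longrightarrow> env r' \<Longrightarrow> static a' \<Longrightarrow> heap_zero a' \<Longrightarrow>
      (\<And>i. i < m \<Longrightarrow> a' 13 i = clip (2 ^ k) lev i) \<Longrightarrow> Q r' a'"
    and t: "20000 * m + 2000 * lg \<le> t" "4000 * (q + 1) + 2000 * lg \<le> d"
  shows "runs finish_fractional r a t d Q"
proof -
  have rg: "r ''m'' = m" "r ''p'' = 2 ^ q" "r ''B'' = Big" "r ''w'' = w0" using env by (auto simp: env_def)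
  let ?ld = "load 1 (xval 0 lev)"
  let ?mx = "\<lambda>v. max (?ld v) (b v * Big)" and ?mn = "\<lambda>v. min (?ld v) (b v * Big)"
  let ?sum = "\<lambda>a1. \<forall>v\<in>verts 1. a1 11 (2 ^ q + a 7 v) - a1 11 (2 ^ q + a 6 v) = ?ld v"
  let ?keep = "\<lambda>a1. heap_zero a1 \<and> (\<forall>q. q \<noteq> 10 \<longrightarrow> q \<noteq> 11 \<longrightarrow> q \<noteq> 23 \<longrightarrow> a1 q = a q)"
  let ?P1 = "\<lambda>r1 a1. r1 = r(''h'' := 2 ^ q) \<and> ?sum a1 \<and> ?keep a1"
  let ?P2 = "\<lambda>r1 a1. r1 = r(''h'' := 2 ^ q) \<and> ?sum a1 \<and> ?keep a1 \<and> (\<forall>v\<in>verts 1. a1 23 v = ?mx v)"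
  let ?P3 = "\<lambda>r1 a1. r1 = r(''h'' := 2 ^ q) \<and> a1 11 (2 ^ q + m) = clipped lev \<and> ?keep a1 \<and> (\<forall>v\<in>verts 1. a1 23 v = ?mx v)"
  have one: "1 < (2::nat)" by simp
  have k: "a 1 (a 5 i) = key a 1 i" "a 3 (a 5 i) = b (key a 1 i)" if "i < m" for i
    using static_key[OF st one that] static_bud[OF st one static_ord[OF st one that]]
    by (simp_all add: key_def numeral_eq_Suc)
  have k': "a (Suc 0) (a 5 i) = key a 1 i" if "i < m" for i using k(1)[OF that] by simp
  have bB: "b v * Big \<le> X" for v
  proof -
    have "b v * Big \<le> N * (72 * N ^ 6)" using b_le[of v] n Big_le by (intro mult_le_mono) auto
    also have "\<dots> = 72 * N ^ 7" by (simp add: power_numeral_reduce)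
    also have "\<dots> \<le> X" by (rule const_pow_X[of _ 4]) auto
    finally show ?thesis .
  qed
  have ldX: "?ld v \<le> X" for v
  proof -
    have "?ld v \<le> sum (xval 0 lev) {..<m}" unfolding load_def by (rule sum_mono2) (auto simp: inc_def)
    also have "\<dots> \<le> (\<Sum>i<m. Big)" by (intro sum_mono xval_le)
    finally show ?thesis using mBig_X by simp
  qed
  show ?thesis unfolding finish_fractional_def
  proof (rule runs_Seq[where P = ?P1 and ta = "8000 * m" and da = "1200 * (q + 1)" and tb = "8000 * m + 200 * (m + 1) + 2000 * lg"
        and db = "1200 * (q + 1) + 400 + 2000 * lg"], goal_cases)
    case 1
    show ?case by (rule runs_edge_vals[OF one _ env st hz lev]) auto
  next
    case A: (2 r1 a1)
    show ?case
    proof (rule runs_Seq[where P = ?P2 and ta = "100 * (m + 1)" and da = 200 and tb = "8000 * m + 100 * (m + 1) + 2000 * lg"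
        and db = "1200 * (q + 1) + 200 + 2000 * lg"], goal_cases)
      case 1
      show ?case unfolding fin_max_def
      proof (rule runs_ParFor[where k = m and C = "\<lambda>i. a 6 (key a 1 i) = i" and f = "key a 1" and v = "\<lambda>i. ?mx (key a 1 i)"], goal_cases)
        case (9 i)
        have "a1 11 (2 ^ q + a 7 (key a 1 i)) - a1 11 (2 ^ q + i) = ?ld (key a 1 i)"
          using A key_verts[OF st one 9(1)] 9(2) by metis
        then show ?case using A 9 by (simp add: rg k k' max_def)
      next
        case (10 i) then show ?case using bB ldX by simp
      next
        case (12 i j) then show ?case by metis
      next
        case (14 a')
        have "a' 23 v = ?mx v" if "v \<in> verts 1" for v
          using 14(1)[of "a 6 v"] key_first[OF st one that] by simp
        then show ?case using 14 A by (auto simp: heap_zero_def)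
      qed (use A m_X in \<open>auto simp: ok_simps rg k k'\<close>)
    next
      case A: (2 r1 a1)
      show ?case
      proof (rule runs_Seq[where P = ?P3 and ta = "8000 * m" and da = "1200 * (q + 1)" and tb = "100 * (m + 1) + 2000 * lg"
          and db = "200 + 2000 * lg"], goal_cases)
        case 1
        show ?case unfolding fin_min_def
        proof (rule runs_psum[where v = "\<lambda>i. of_bool (a 6 (key a 1 i) = i) * ?mn (key a 1 i)"], goal_cases)
          case (6 i)
          have "a1 11 (2 ^ q + a 7 (key a 1 i)) - a1 11 (2 ^ q + a 6 (key a 1 i)) = ?ld (key a 1 i)"
            using A key_verts[OF st one 6] by blast
          then show ?case using A 6 by (auto simp: rg k k' min_def)
        next
          case 7
          show ?case using sum_first[OF st one, where f = ?mn, folded clipped_def] clipped_le[of lev] mBig_X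
            by (simp only: order_trans)
        next
          case (8 a')
          have "a' 11 (2 ^ q + m) = clipped lev"
            using 8(1)[of m] sum_first[OF st one, of ?mn] by (simp add: clipped_def)
          then show ?case using 8 A by simp
        qed (use A in \<open>auto simp: ok_simps rg\<close>)
      next
        case A: (2 r1 a1)
        let ?P4 = "\<lambda>r2 a2. a2 = a1 \<and> (\<exists>k. m * D * Big \<le> 2 ^ k * max (clipped lev) 1 \<and>
           (k = 0 \<or> 2 ^ k * max (clipped lev) 1 \<le> 2 * (m * D * Big)) \<and> 2 ^ k \<le> N ^ 15 \<and>
           r2 ''o'' = 2 ^ k) \<and> env r2"
        show ?case
        proof (rule runs_Seq[where P = ?P4 and ta = "2000 * lg" and da = "2000 * lg" and tb = "100 * (m + 1)"
            and db = "200"], goal_cases)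
          case 1
          show ?case
            by (rule runs_pw_init[where V = "clipped lev"]) (use A env clipped_le in \<open>auto simp: env_def\<close>)
        next
          case B: (2 r2 a2)
          then obtain k where kk: "m * D * Big \<le> 2 ^ k * max (clipped lev) 1"
            "k = 0 \<or> 2 ^ k * max (clipped lev) 1 \<le> 2 * (m * D * Big)" "2 ^ k \<le> N ^ 15" and o: "r2 ''o'' = 2 ^ k" by blast
          have e2: "r2 ''m'' = m" "r2 ''w'' = w0" using B by (auto simp: env_def)
          have a2: "a2 0 = a 0" "a2 1 = a 1" "a2 2 = a 2" "a2 3 = a 3" "a2 8 = a 8" "a2 12 = a 12" "a2 (Suc 0) = a 1" using A B by auto
          show ?case unfolding fin_clip_def
          proof (rule runs_ParFor[where k = m and C = "\<lambda>_. True" and f = "\<lambda>i. i" and v = "clip (2 ^ k) lev"], goal_cases)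
            case (9 i)
            have v1: "ep 1 i \<in> verts 1" using 9 by (simp add: verts_def)
            have ee: "a 0 i = ep 0 i" "a 1 i = ep 1 i" "a 2 i = b (ep 0 i)" "a 3 i = b (ep 1 i)"
              using static_ep[OF st _ 9(1), of 0] static_ep[OF st _ 9(1), of 1] static_bud[OF st _ 9(1), of 0]
                static_bud[OF st _ 9(1), of 1] by (simp_all add: numeral_eq_Suc)
            have mx: "a2 23 (ep 1 i) = ?mx (ep 1 i)" using A B v1 by simp
            have x: "(if 0 < b (ep 0 i) then a 12 ((w0 + lev (ep 1 i)) - lev (ep 0 i)) else 0) = xval 0 lev i"
              using xval_table[OF st lev 9(1), of 0] by (simp only: add_0_right)
            have l: "a 8 (ep 0 i) = lev (ep 0 i)" "a 8 (ep 1 i) = lev (ep 1 i)" using lev_okD[OF lev 9(1)] by auto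
            show ?case
              unfolding lsem.simps nval.simps apply_binop.simps clip_def x[symmetric] mx[symmetric]
              by (simp add: a2 e2 o ee l del: One_nat_def)
          next
            case (10 i)
            have "2 ^ k \<le> X" using kk(3) by (rule le_X[rotated]) simp
            then show ?case using clip_le_pw[of "2 ^ k" lev i] by simp
          next
            case (14 a')
            show ?case
            proof (rule post[OF kk])
              show "static a'" by (rule static_cong[OF st]) (use 14(3) A B in auto)
              show "heap_zero a'" using 14(3)[of 10] A B by (simp add: heap_zero_def)
            qed (use o B 14 in auto)
          qed (use m_X in \<open>auto simp: ok_simps e2\<close>)
        qed auto
      qed auto
    qed auto
  qed (use t m in auto)
qed

end

section \<open>Pairing of odd edges, pointer jumping and repeated halving\<close>

section \<open>Rounding\<close>

text \<open>\<open>\<kappa>\<close> is the vertex at a list position, and \<open>ps\<close>,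
  \<open>pe\<close> delimit its group. Odd offsets look back and even offsets look ahead, so only
  the last position of a group of odd size is left as a fixpoint.\<close>

lemma pair_up:
  fixes \<kappa> ps pe :: "nat \<Rightarrow> nat" and f :: nat
  assumes grp: "\<And>a a'. a < f \<Longrightarrow> a' < f \<Longrightarrow> \<kappa> a' = \<kappa> a \<longleftrightarrow> ps (\<kappa> a) \<le> a' \<and> a' < pe (\<kappa> a)"
    and \<pi>: "\<pi> = (\<lambda>a. if odd (a - ps (\<kappa> a)) then a - 1 else if a + 1 < f \<and> \<kappa> (a + 1) = \<kappa> a then a + 1 else a)"
  shows "a < f \<Longrightarrow> \<pi> a < f \<and> \<kappa> (\<pi> a) = \<kappa> a \<and> \<pi> (\<pi> a) = a"
    and "a < f \<Longrightarrow> c < f \<Longrightarrow> \<kappa> a = \<kappa> c \<Longrightarrow> \<pi> a = a \<Longrightarrow> \<pi> c = c \<Longrightarrow> a = c"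
proof -
  have p: "ps (\<kappa> a) \<le> a" if "a < f" for a using grp[OF that that] by simp
  show "\<pi> a < f \<and> \<kappa> (\<pi> a) = \<kappa> a \<and> \<pi> (\<pi> a) = a" if a: "a < f" for a
  proof (cases "odd (a - ps (\<kappa> a))")
    case True
    then have "a - ps (\<kappa> a) \<noteq> 0" by (intro notI) simp
    then have gt: "ps (\<kappa> a) < a" by simp
    have lt: "a - 1 < f" using a by simp
    have "a < pe (\<kappa> a)" using grp[OF a a] by simp
    then have same: "\<kappa> (a - 1) = \<kappa> a" using grp[OF a lt] gt by auto
    have "a - ps (\<kappa> a) = Suc (a - 1 - ps (\<kappa> a))" using gt by simp
    with True have "even (a - 1 - ps (\<kappa> (a - 1)))" unfolding same by simp
    then show ?thesis using True gt lt a same by (auto simp: \<pi>)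
  next
    case even: False
    show ?thesis
    proof (cases "a + 1 < f \<and> \<kappa> (a + 1) = \<kappa> a")
      case True
      have "a + 1 - ps (\<kappa> a) = Suc (a - ps (\<kappa> a))" using p[OF a] by simp
      then have "odd (a + 1 - ps (\<kappa> (a + 1)))" using even True by simp
      then show ?thesis using True even by (auto simp: \<pi>)
    qed (use even a in \<open>auto simp: \<pi>\<close>)
  qed
  have *: False if "a < c" "c < f" "\<kappa> a = \<kappa> c" "\<pi> a = a" for a c
  proof -
    have "a + 1 < f" "a < f" using that by auto
    moreover have "ps (\<kappa> a) \<le> a + 1" "a + 1 < pe (\<kappa> a)"
      using grp[of a a] grp[of a c] that by auto
    ultimately have "\<kappa> (a + 1) = \<kappa> a" using grp[of a "a + 1"] by simp
    moreover have "even (a - ps (\<kappa> a))"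
    proof (rule ccontr)
      assume odd: "odd (a - ps (\<kappa> a))"
      then have "a \<noteq> 0" by (intro notI) simp
      moreover have "\<pi> a = a - 1" using odd by (simp add: \<pi>)
      ultimately have "\<pi> a \<noteq> a" by simp
      then show False using that(4) by contradiction
    qed
    ultimately have "\<pi> a = a + 1" using \<open>a + 1 < f\<close> by (simp add: \<pi> del: even_diff_nat)
    then show False using that(4) by simp
  qed
  show unique: "a = c" if "a < f" "c < f" "\<kappa> a = \<kappa> c" "\<pi> a = a" "\<pi> c = c" for a c
    using *[of a c] *[of c a] that by (metis linorder_neqE_nat)
qed

text \<open>Counting the selected positions before j is the order isomorphism from them onto an
  initial segment.\<close>

lemma rank_bij:
  fixes P :: "nat \<Rightarrow> bool" and Z :: "nat \<Rightarrow> nat"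
  assumes Z: "Z = (\<lambda>j. \<Sum>i<j. of_bool (P i))"
  shows "i \<le> j \<Longrightarrow> Z i \<le> Z j" and "P i \<Longrightarrow> i < j \<Longrightarrow> Z i < Z j"
    and "bij_betw Z {i. i < m \<and> P i} {..<Z m}"
proof -
  show mono: "Z i \<le> Z j" if "i \<le> j" for i j
    unfolding Z by (rule sum_mono2; use that in auto)
  show strict: "Z i < Z j" if "P i" "i < j" for i j
    using mono[of "Suc i" j] that unfolding Z by (simp del: sum_of_bool_eq)
  have inj: "inj_on Z {i. i < m \<and> P i}"
    by (rule linorder_inj_onI') (use strict in \<open>metis mem_Collect_eq nless_le\<close>)
  have "Z ` {i. i < m \<and> P i} \<subseteq> {..<Z m}" using strict by auto
  moreover have "card (Z ` {i. i < m \<and> P i}) = Z m"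
    unfolding card_image[OF inj] by (simp add: Z Int_def conj_commute)
  ultimately have "Z ` {i. i < m \<and> P i} = {..<Z m}" by (intro card_subset_eq) auto
  with inj show "bij_betw Z {i. i < m \<and> P i} {..<Z m}" by (simp add: bij_betw_def)
qed

context alg
begin

definition odds :: "(nat \<Rightarrow> nat) \<Rightarrow> nat set" where
  "odds y = {e. e < m \<and> odd (y e)}"

definition pair_ok :: "(nat \<Rightarrow> nat \<Rightarrow> nat) \<Rightarrow> nat \<Rightarrow> (nat \<Rightarrow> nat) \<Rightarrow> bool" where
  "pair_ok a s y \<longleftrightarrow>
    (\<forall>e\<in>odds y. a (24 + s) e \<in> odds y \<and> ep s (a (24 + s) e) = ep s e \<and> a (24 + s) (a (24 + s) e) = e) \<and>
    (\<forall>e\<in>odds y. \<forall>f\<in>odds y. a (24 + s) e = e \<longrightarrow> a (24 + s) f = f \<longrightarrow> ep s e = ep s f \<longrightarrow> e = f)"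

lemma runs_pair_odd:
  assumes s: "s < 2" and env: "env r" and st: "static a" and hz: "heap_zero a"
    and y: "\<And>e. e < m \<Longrightarrow> a 13 e = y e" and yX: "\<And>e. e < m \<Longrightarrow> y e \<le> X"
    and post: "\<And>a'. pair_ok a' s y \<Longrightarrow> bij_betw (a' 15) {..<card (odds y)} (odds y) \<Longrightarrow> heap_zero a' \<Longrightarrow>
       (\<And>q. q \<notin> {10, 11, 15, 24 + s} \<Longrightarrow> a' q = a q) \<Longrightarrow>
       Q (r(''h'' := 2 ^ q, ''f'' := card (odds y))) a'"
    and t: "8500 * m \<le> t" "1700 * (q + 1) \<le> d"
  shows "runs (pair_odd s) r a t d Q"
proof -
  let ?o = "a (4 + s)"
  have s01: "s = 0 \<or> s = 1" using s by auto
  have rg: "r ''m'' = m" "r ''p'' = 2 ^ q" using env by (auto simp: env_def)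
  have o: "?o i < m" if "i < m" for i using static_ord[OF st s that] .
  have obij: "bij_betw ?o {..<m} {..<m}" using st s by (auto simp: static_def ord_ok_def)
  define P where "P = (\<lambda>i. odd (y (?o i)))"
  define Z where "Z = (\<lambda>j. \<Sum>i<j. of_bool (P i) :: nat)"
  note rk = rank_bij[OF Z_def]
  have PF: "bij_betw ?o {i. i < m \<and> P i} (odds y)"
  proof (rule bij_betw_subset[OF obij, of "{i. i < m \<and> P i}" "odds y", OF _ _])
    show "?o ` {i. i < m \<and> P i} = odds y"
    proof
      show "odds y \<subseteq> ?o ` {i. i < m \<and> P i}"
      proof
        fix e assume e: "e \<in> odds y"
        then have "e \<in> ?o ` {..<m}" using obij by (simp add: bij_betw_def odds_def)
        then show "e \<in> ?o ` {i. i < m \<and> P i}" using e by (auto simp: odds_def P_def)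
      qed
    qed (use o in \<open>auto simp: odds_def P_def\<close>)
  qed auto
  define f where "f = card (odds y)"
  have f: "Z m = f"
    using bij_betw_same_card[OF PF] bij_betw_same_card[OF rk(3)[of m]] by (simp add: f_def)
  have fm: "f \<le> m" unfolding f_def odds_def using card_mono[of "{..<m}" "{e. e < m \<and> odd (y e)}"] by auto
  have Zb: "bij_betw Z {i. i < m \<and> P i} {..<f}" using rk(3)[of m] f by simp
  \<comment> \<open>The inverse of the ranking: the sorted position of the c-th odd edge.\<close>
  define I where "I = the_inv_into {i. i < m \<and> P i} Z"
  have I: "I c < m" "P (I c)" "Z (I c) = c" if "c < f" for c
  proof -
    have c: "c \<in> Z ` {i. i < m \<and> P i}" using Zb that by (simp add: bij_betw_def)
    have inj: "inj_on Z {i. i < m \<and> P i}" using Zb by (simp add: bij_betw_def)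
    show "Z (I c) = c" unfolding I_def by (rule f_the_inv_into_f[OF inj c])
    have "I c \<in> {i. i < m \<and> P i}" unfolding I_def by (rule the_inv_into_into[OF inj c]) simp
    then show "I c < m" "P (I c)" by auto
  qed
  have Ib: "bij_betw I {..<f} {i. i < m \<and> P i}" unfolding I_def by (rule bij_betw_the_inv_into[OF Zb])
  define L where "L = ?o \<circ> I"
  have Lb: "bij_betw L {..<f} (odds y)" unfolding L_def by (rule bij_betw_trans[OF Ib PF])
  have L: "L c < m" "L c \<in> odds y" if "c < f" for c using Lb that by (auto simp: odds_def dest!: bij_betwE)
  define \<kappa> where "\<kappa> = (\<lambda>c. ep s (L c))"
  have \<kappa>: "\<kappa> c = key a s (I c)" for c by (simp add: \<kappa>_def L_def key_def)
  have \<kappa>v: "\<kappa> c \<in> verts s" if "c < f" for c unfolding \<kappa> using key_verts[OF st s I(1)[OF that]] .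
  \<comment> \<open>Ranking is monotone, so the bounds of a group in the compressed list are the
    ranks of the segment bounds.\<close>
  have grp: "\<kappa> c' = \<kappa> c \<longleftrightarrow> Z (a 6 (\<kappa> c)) \<le> c' \<and> c' < Z (a 7 (\<kappa> c))" if c: "c < f" "c' < f" for c c'
  proof -
    have "\<kappa> c' = \<kappa> c \<longleftrightarrow> a 6 (\<kappa> c) \<le> I c' \<and> I c' < a 7 (\<kappa> c)"
      unfolding \<kappa>[of c'] by (rule static_seg(3)[OF st s \<kappa>v[OF c(1)] I(1)[OF c(2)]])
    also have "a 6 (\<kappa> c) \<le> I c' \<longleftrightarrow> Z (a 6 (\<kappa> c)) \<le> c'"
      using rk(1)[of "a 6 (\<kappa> c)" "I c'"] rk(2)[of "I c'" "a 6 (\<kappa> c)"] I[OF c(2)] by (metis not_less)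
    also have "I c' < a 7 (\<kappa> c) \<longleftrightarrow> c' < Z (a 7 (\<kappa> c))"
      using rk(1)[of "a 7 (\<kappa> c)" "I c'"] rk(2)[of "I c'" "a 7 (\<kappa> c)"] I[OF c(2)] by (metis not_less)
    finally show ?thesis .
  qed
  define \<pi> where "\<pi> = (\<lambda>c. if odd (c - Z (a 6 (\<kappa> c))) then c - 1 else if c + 1 < f \<and> \<kappa> (c + 1) = \<kappa> c then c + 1 else c)"
  have pu1: "\<pi> c < f \<and> \<kappa> (\<pi> c) = \<kappa> c \<and> \<pi> (\<pi> c) = c" if "c < f" for c
    by (rule pair_up(1)[where f = f and \<kappa> = \<kappa> and ps = "\<lambda>x. Z (a 6 x)" and pe = "\<lambda>x. Z (a 7 x)"])
      (use grp \<pi>_def that in auto)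
  have pu2: "c = c'" if "c < f" "c' < f" "\<kappa> c = \<kappa> c'" "\<pi> c = c" "\<pi> c' = c'" for c c'
    by (rule pair_up(2)[where f = f and \<kappa> = \<kappa> and ps = "\<lambda>x. Z (a 6 x)" and pe = "\<lambda>x. Z (a 7 x)" and \<pi> = \<pi>])
      (use grp \<pi>_def that in auto)
  have st6: "a 6 (\<kappa> c) \<le> m" if "c < f" for c using static_seg(1,2)[OF st s \<kappa>v[OF that]] by simp
  let ?keep = "\<lambda>a1. heap_zero a1 \<and> (\<forall>q. q \<noteq> 10 \<longrightarrow> q \<noteq> 11 \<longrightarrow> q \<noteq> 15 \<longrightarrow> a1 q = a q) \<and> (\<forall>i\<le>m. a1 11 (2 ^ q + i) = Z i)"
  let ?P1 = "\<lambda>r1 a1. r1 = r(''h'' := 2 ^ q) \<and> ?keep a1"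
  let ?P2 = "\<lambda>r1 a1. r1 = r(''h'' := 2 ^ q) \<and> ?keep a1 \<and> (\<forall>c<f. a1 15 c = L c)"
  let ?P3 = "\<lambda>r1 a1. r1 = r(''h'' := 2 ^ q, ''f'' := f) \<and> ?keep a1 \<and> (\<forall>c<f. a1 15 c = L c)"
  have fX: "f \<le> X" using fm m_X by simp
  show ?thesis unfolding pair_odd_def
  proof (rule runs_Seq[where P = ?P1 and ta = "8000 * m" and da = "1200 * (q + 1)" and tb = "200 * (m + 1) + 40" and db = 440], goal_cases)
    case 1
    show ?case
    proof (rule runs_psum[where v = "\<lambda>i. of_bool (P i)"], goal_cases)
      case (6 i) then show ?case using y[OF o[OF 6]] s01 by (auto simp: P_def mod2_eq_if)
    next
      case 7 then show ?case using f fX by (simp only: Z_def)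
    next
      case (8 a') then show ?case using s01 by (auto simp: Z_def)
    qed (use s01 hz in \<open>auto simp: ok_simps rg\<close>)
  next
    case A: (2 r1 a1)
    then have a1: "a1 (4 + s) = ?o" "a1 13 = a 13" using s01 by auto
    show ?case
    proof (rule runs_Seq[where P = ?P2 and ta = "100 * (m + 1)" and da = 200 and tb = "100 * (m + 1) + 40" and db = 240], goal_cases)
      case 1
      show ?case
      proof (rule runs_ParFor[where k = m and C = P and f = Z and v = ?o], goal_cases)
        case (7 i) then show ?case using y[OF o[OF 7]] a1 by (simp add: P_def odd_iff_mod_2_eq_one)
      next
        case (9 i) then show ?case using a1 by simp
      next
        case (10 i) then show ?case using o[OF 10(1)] m_X by simp
      next
        case (12 i j) then show ?case using rk(2) by (metis linorder_neqE_nat nless_le)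
      next
        case (14 a')
        have "a' 15 c = L c" if "c < f" for c using 14(1)[OF I(1,2)[OF that]] I(3)[OF that] by (simp add: L_def)
        then show ?case using 14 A by (auto simp: heap_zero_def)
      qed (use s01 A m_X in \<open>auto simp: ok_simps rg\<close>)
    next
      case A: (2 r1 a1)
      show ?case
      proof (rule runs_Seq[where P = ?P3 and ta = 40 and da = 40 and tb = "100 * (m + 1)" and db = 200], goal_cases)
        case 1
        show ?case by (rule runs_Load) (use A f in \<open>auto simp: ok_simps rg\<close>)
      next
        case A: (2 r1 a1)
        have ea: "a s e = ep s e" if "e < m" for e using static_ep[OF st s that] .
        have a1: "a1 s = a s" "a1 6 = a 6" using A s01 by auto
        have r1: "r1 = r(''h'' := 2 ^ q, ''f'' := f)" using A by blast
        have L1: "a1 15 c = L c" if "c < f" for c using A that by blast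
        have Z1: "a1 11 (2 ^ q + a 6 (\<kappa> c)) = Z (a 6 (\<kappa> c))" if "c < f" for c using A st6[OF that] by blast
        show ?case
        proof (rule runs_ParFor[where k = f and C = "\<lambda>_. True" and f = L and v = "\<lambda>c. L (\<pi> c)"], goal_cases)
          case (9 c)
          then have c: "c < f" by simp
          have e: "a s (L c) = \<kappa> c" using ea[OF L(1)[OF c]] by (simp add: \<kappa>_def)
          have n: "a s (a1 15 (c + 1)) = \<kappa> (c + 1)" if "c + 1 < f" using ea[OF L(1)[OF that]] L1[OF that] by (simp add: \<kappa>_def)
          have step: "nval (((Reg ''i'' \<ominus> Reg ''b'') \<odot> Const 2) \<otimes> Reg ''d'' \<oplus>
          (Const 1 \<ominus> (Reg ''i'' \<ominus> Reg ''b'') \<odot> Const 2) \<otimes>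
          ((Reg ''i'' \<oplus> Const 1 \<prec> Reg ''f'') \<otimes> (Reg ''y'' \<doteq> Reg ''x'') \<otimes> Reg ''c'' \<oplus>
           (Const 1 \<ominus> (Reg ''i'' \<oplus> Const 1 \<prec> Reg ''f'') \<otimes> (Reg ''y'' \<doteq> Reg ''x'')) \<otimes> Reg ''e''))
            (lsem [(''e'', 15, Reg ''i''), (''x'', s, Reg ''e''), (''a'', 6, Reg ''x''), (''b'', 11, Reg ''p'' \<oplus> Reg ''a''),
        (''c'', 15, Reg ''i'' \<oplus> Const 1), (''d'', 15, Reg ''i'' \<ominus> Const 1), (''y'', s, Reg ''c'')] (r1(''i'' := c)) a1) =
            (let p = (c - Z (a 6 (\<kappa> c))) mod 2; g = of_bool (c + 1 < f \<and> a s (a1 15 (c + 1)) = \<kappa> c) in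
             p * a1 15 (c - 1) + (1 - p) * (g * a1 15 (c + 1) + (1 - g) * L c))"
            unfolding lsem.simps by (simp add: r1 rg a1 L1 Z1 c e Let_def)
          have "c - 1 < f" using c by simp
          moreover define dd where "dd = c - Z (a 6 (\<kappa> c))"
          moreover have "dd mod 2 = of_bool (odd dd)" by (simp add: mod2_eq_if)
          moreover have "\<pi> c = (if odd dd then c - 1 else if c + 1 < f \<and> \<kappa> (c + 1) = \<kappa> c then c + 1 else c)"
            by (simp add: \<pi>_def dd_def)
          ultimately show ?case unfolding step dd_def[symmetric] using n L1 by (auto simp: Let_def)
        next
          case (10 c) then show ?case using pu1[of c] L(1)[of "\<pi> c"] m_X by simp
        next
          case (12 i j) then show ?case using Lb by (auto simp: bij_betw_def dest: inj_onD)
        next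
          case (14 a')
          have w: "a' (24 + s) (L c) = L (\<pi> c)" if "c < f" for c using 14(1)[OF that] by simp
          have Lsurj: "\<exists>c<f. e = L c" if "e \<in> odds y" for e
          proof -
            have "e \<in> L ` {..<f}" using Lb that by (simp add: bij_betw_def)
            then show ?thesis by blast
          qed
          have "pair_ok a' s y" unfolding pair_ok_def
          proof (intro conjI ballI impI)
            fix e assume "e \<in> odds y"
            then obtain c where c: "c < f" "e = L c" using Lsurj by blast
            show "a' (24 + s) e \<in> odds y" using c pu1[OF c(1)] L by (simp add: w)
            show "ep s (a' (24 + s) e) = ep s e" using c pu1[OF c(1)] by (simp add: w \<kappa>_def)
            show "a' (24 + s) (a' (24 + s) e) = e" using c pu1[OF c(1)] by (simp add: w)
          next
            fix e e' assume *: "e \<in> odds y" "e' \<in> odds y" "a' (24 + s) e = e" "a' (24 + s) e' = e'" "ep s e = ep s e'"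
            obtain c c' where c: "c < f" "e = L c" and c': "c' < f" "e' = L c'" using * Lsurj by blast
            have inj: "inj_on L {..<f}" using Lb by (simp add: bij_betw_def)
            have "\<pi> c = c" "\<pi> c' = c'"
              using * c c' pu1[OF c(1)] pu1[OF c'(1)] inj_onD[OF inj] by (auto simp: w)
            then show "e = e'" using pu2[OF c(1) c'(1)] * c c' by (simp add: \<kappa>_def)
          qed
          moreover have "bij_betw (a' 15) {..<card (odds y)} (odds y)"
            using Lb L1 14(3)[of 15] s01 unfolding f_def[symmetric] by (subst bij_betw_cong[of _ _ L]) auto
          moreover have "heap_zero a'" using A 14(3)[of 10] s01 by (auto simp: heap_zero_def)
          ultimately have "Q (r(''h'' := 2 ^ q, ''f'' := card (odds y))) a'"
            using 14(3) A by (intro post) auto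
          then show ?case using A by (simp add: f_def)
        qed (use s01 fX fm L1 in \<open>auto simp: ok_simps r1\<close>)
      qed auto
    qed auto
  qed (use t m in auto)
qed

definition copies :: "nat set \<Rightarrow> nat set" where
  "copies F = {x. x div 2 \<in> F}"

lemma copies_less: "F \<subseteq> {..<m} \<Longrightarrow> x \<in> copies F \<Longrightarrow> x < 2 * m"
  by (auto simp: copies_def)

text \<open>Thread i of the 2 * f threads handles copy i mod 2 of the (i div 2)-th odd edge.\<close>

lemma copies_bij:
  assumes "bij_betw l {..<f} F"
  shows "bij_betw (\<lambda>i. 2 * l (i div 2) + i mod 2) {..<2 * f} (copies F)"
proof -
  have inj: "inj_on l {..<f}" and im: "l ` {..<f} = F" using assms by (auto simp: bij_betw_def)
  have d: "(2 * l (i div 2) + i mod 2) div 2 = l (i div 2)" "(2 * l (i div 2) + i mod 2) mod 2 = i mod 2" for i by auto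
  show ?thesis
  proof (rule bij_betwI')
    fix i j assume ij: "i \<in> {..<2 * f}" "j \<in> {..<2 * f}"
    show "(2 * l (i div 2) + i mod 2 = 2 * l (j div 2) + j mod 2) = (i = j)"
    proof
      assume *: "2 * l (i div 2) + i mod 2 = 2 * l (j div 2) + j mod 2"
      then have "l (i div 2) = l (j div 2)" "i mod 2 = j mod 2" using d by metis+
      moreover have "i div 2 < f" "j div 2 < f" using ij by auto
      ultimately have "i div 2 = j div 2" using inj by (auto dest: inj_onD)
      with \<open>i mod 2 = j mod 2\<close> show "i = j" by (metis mult_div_mod_eq)
    qed simp
  next
    fix i assume "i \<in> {..<2 * f}"
    then have "i div 2 < f" by auto
    then show "2 * l (i div 2) + i mod 2 \<in> copies F" using im d(1) by (auto simp: copies_def)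
  next
    fix x assume "x \<in> copies F"
    then obtain c where c: "c < f" "x div 2 = l c" using im by (auto simp: copies_def)
    have "(2 * c + x mod 2) div 2 = c" "(2 * c + x mod 2) mod 2 = x mod 2" by auto
    moreover have "x = 2 * l c + x mod 2" using c(2) mult_div_mod_eq[of 2 x] by simp
    moreover have "2 * c + x mod 2 < 2 * f" using c(1) mod_less_divisor[of 2 x] by linarith
    ultimately show "\<exists>i\<in>{..<2 * f}. x = 2 * l (i div 2) + i mod 2" by (intro bexI[of _ "2 * c + x mod 2"]) auto
  qed
qed

lemma runs_elems:
  assumes reg: "s ''f'' = f" "f \<le> m" and bij: "bij_betw (a 15) {..<f} F" and F: "F \<subseteq> {..<m}"
    and ok: "body_ok ((''e'', 15, Reg ''i'' \<oslash> Const 2) # ls) (Const 1, r, elem, e)" "r < 32" "r \<noteq> 15"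
    and ls: "list_all (\<lambda>(x, q, e). x \<noteq> ''i'' \<and> x \<noteq> ''e'' \<and> q \<noteq> r \<and> q \<noteq> 32) ls"
    and v: "\<And>i x. x \<in> copies F \<Longrightarrow> i mod 2 = x mod 2 \<Longrightarrow>
       nval e (lsem ls (s(''i'' := i, ''e'' := x div 2)) a) = v x"
    and vX: "\<And>x. x \<in> copies F \<Longrightarrow> v x \<le> X"
    and post: "\<And>a'. (\<And>x. x \<in> copies F \<Longrightarrow> a' r x = v x) \<Longrightarrow> (\<And>q. q \<noteq> r \<Longrightarrow> a' q = a q) \<Longrightarrow> Q s a'"
    and t: "200 * f + 100 \<le> t" "200 \<le> d"
  shows "runs (elems r ls e) s a t d Q"
proof -
  let ?el = "\<lambda>i. 2 * a 15 (i div 2) + i mod 2"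
  have b: "bij_betw ?el {..<2 * f} (copies F)" by (rule copies_bij[OF bij])
  have el: "?el i \<in> copies F" if "i < 2 * f" for i using b that by (auto dest!: bij_betwE)
  have keep: "lsem ls s' a x = s' x" if "list_all (\<lambda>(y, r, e). y \<noteq> x) ls" for s' x
    using that by (induction ls s' a rule: lsem.induct) auto
  have rd: "q \<noteq> r \<and> q \<noteq> 32" if "(q, l) \<in> set (lreads ls s' a)"
      "list_all (\<lambda>(x, q, e). x \<noteq> ''i'' \<and> x \<noteq> ''e'' \<and> q \<noteq> r \<and> q \<noteq> 32) ls" for s' q l
    using that by (induction ls s' a rule: lreads.induct) auto
  have ki: "list_all (\<lambda>(y, r, e). y \<noteq> ''i'') ls" "list_all (\<lambda>(y, r, e). y \<noteq> ''e'') ls"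
    using ls by (auto simp: list_all_iff)
  have d: "?el i div 2 = a 15 (i div 2)" "?el i mod 2 = i mod 2" for i by auto
  have mX: "2 * f \<le> X" using reg m_X by simp
  show ?thesis unfolding elems_def
  proof (rule runs_ParFor[where k = "2 * f" and C = "\<lambda>_. True" and f = ?el and v = "\<lambda>i. v (?el i)"], goal_cases)
    case (6 i q j) then show ?case using rd[OF _ ls] by auto
  next
    case (8 i) then show ?case using keep[OF ki(1)] keep[OF ki(2)] by (simp add: elem_def)
  next
    case (9 i)
    show ?case using v[OF el[OF 9(1)], of i] by (simp add: d)
  next
    case (10 i) then show ?case using vX el by blast
  next
    case (12 i j) then show ?case using b unfolding bij_betw_def inj_on_def by blast
  next
    case (13 i j) then show ?case using rd[OF _ ls] ok by auto
  next
    case (14 a')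
    show ?case
    proof (rule post)
      fix x assume "x \<in> copies F"
      then obtain i where "i < 2 * f" "x = ?el i" using b unfolding bij_betw_def by blast
      then show "a' r x = v x" using 14(1) by simp
    qed (use 14(3) in auto)
  qed (use reg mX ok t in \<open>auto simp: ok_simps\<close>)
qed

text \<open>The first 2 ^ Suc j iterates of \<open>x\<close> are the first 2 ^ j iterates of
  \<open>x\<close> and those of its 2 ^ j-th iterate, so a minimum over twice the range takes one
  lookup through the current pointer.\<close>

lemma runs_jump:
  fixes g :: "nat \<Rightarrow> nat"
  assumes reg: "s ''f'' = f" "f \<le> m" "s ''p'' = 2 ^ q" and bij: "bij_betw (a 15) {..<f} F" and F: "F \<subseteq> {..<m}"
    and g: "\<And>x. x \<in> copies F \<Longrightarrow> g x \<in> copies F"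
    and init: "\<And>x. x \<in> copies F \<Longrightarrow> a 18 x = g x" "\<And>x. x \<in> copies F \<Longrightarrow> a 19 x = x"
    and post: "\<And>a'. (\<And>x. x \<in> copies F \<Longrightarrow> a' 19 x = Min ((\<lambda>i. (g ^^ i) x) ` {..<2 ^ (q + 1)})) \<Longrightarrow>
      (\<And>r. r \<notin> {18, 19, 20, 21} \<Longrightarrow> a' r = a r) \<Longrightarrow> Q (s(''h'' := 2 ^ (q + 1))) a'"
    and t: "(q + 1) * (800 * f + 480) + 80 \<le> t" "1000 * (q + 1) \<le> d"
  shows "runs jump s a t d Q"
proof -
  have gp: "(g ^^ i) x \<in> copies F" if "x \<in> copies F" for i x
    using that by (induction i) (auto simp: g)
  define M where "M = (\<lambda>j x. Min ((\<lambda>i. (g ^^ i) x) ` {..<2 ^ j}))"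
  have M_in: "M j x \<in> copies F" if "x \<in> copies F" for j x
  proof -
    have "M j x \<in> (\<lambda>i. (g ^^ i) x) ` {..<2 ^ j}" unfolding M_def by (rule Min_in) (auto simp: lessThan_empty_iff)
    then show ?thesis using gp[OF that] by auto
  qed
  have M_Suc: "M (Suc j) x = min (M j x) (M j ((g ^^ (2 ^ j)) x))" for j x
  proof -
    have "{..<2 ^ Suc j} = {..<2 ^ j} \<union> (\<lambda>i. i + 2 ^ j) ` {..<(2::nat) ^ j}"
    proof (intro set_eqI iffI)
      fix i assume i: "i \<in> {..<(2::nat) ^ Suc j}"
      show "i \<in> {..<2 ^ j} \<union> (\<lambda>i. i + 2 ^ j) ` {..<(2::nat) ^ j}"
      proof (cases "i < 2 ^ j")
        case False
        then have "i = (i - 2 ^ j) + 2 ^ j" "i - 2 ^ j \<in> {..<2 ^ j}" using i by auto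
        then show ?thesis by blast
      qed simp
    qed auto
    then have "(\<lambda>i. (g ^^ i) x) ` {..<2 ^ Suc j} =
        (\<lambda>i. (g ^^ i) x) ` {..<2 ^ j} \<union> (\<lambda>i. (g ^^ i) ((g ^^ (2 ^ j)) x)) ` {..<2 ^ j}"
      by (simp only: image_Un image_image) (simp add: funpow_add)
    then show ?thesis unfolding M_def by (simp only:) (subst Min_Un; auto simp: lessThan_empty_iff)
  qed
  have inX: "x \<le> X" if "x \<in> copies F" for x using copies_less[OF F that] m_X by simp
  let ?I = "\<lambda>j s1 a1. s1 = s(''h'' := 2 ^ j) \<and> (\<forall>x\<in>copies F. a1 18 x = (g ^^ (2 ^ j)) x) \<and>
     (\<forall>x\<in>copies F. a1 19 x = M j x) \<and> (\<forall>r. r \<notin> {18, 19, 20, 21} \<longrightarrow> a1 r = a r)"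
  have el: "2 * (x div 2) + i mod 2 = x" if "i mod 2 = x mod 2" for x i :: nat using that by simp
  show ?thesis unfolding jump_def
  proof (rule runs_Seq[where P = "?I 0" and ta = 40 and da = 40 and tb = "(q + 1) * (800 * f + 440) + 40 * (q + 2)"
        and db = "(q + 1) * 840 + 40 * (q + 2)"], goal_cases)
    case 1
    show ?case using init X_ge by (intro runs_Assign) (auto simp: ok_simps M_def lessThan_Suc)
  next
    case I0: (2 s0 a0)
    show ?case
    proof (rule runs_While[where k = "q + 1" and I = ?I and tb = "\<lambda>_. 800 * f + 440" and db = "\<lambda>_. 840"], goal_cases)
      case 2 then show ?case using I0 .
    next
      case (3 j s1 a1)
      let ?g = "g ^^ (2 ^ j)"
      have b1: "bij_betw (a' 15) {..<f} F" if "a' 15 = a 15" for a' :: "nat \<Rightarrow> nat \<Rightarrow> nat" using bij that by simp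
      have a15: "a1 15 = a 15" using 3 by simp
      have lt: "2 ^ j < 2 * (2::nat) ^ q" using 3(1) power_strict_increasing[of j "q + 1" "2::nat"] by simp
      let ?P1 = "\<lambda>s2 a2. s2 = s1 \<and> (\<forall>x\<in>copies F. a2 21 x = M (Suc j) x) \<and> (\<forall>q. q \<noteq> 21 \<longrightarrow> a2 q = a1 q)"
      let ?P2 = "\<lambda>s2 a2. s2 = s1 \<and> (\<forall>x\<in>copies F. a2 21 x = M (Suc j) x) \<and> (\<forall>x\<in>copies F. a2 20 x = (g ^^ (2 ^ Suc j)) x) \<and>
          (\<forall>q. q \<noteq> 20 \<longrightarrow> q \<noteq> 21 \<longrightarrow> a2 q = a1 q)"
      let ?P3 = "\<lambda>s2 a2. s2 = s1 \<and> (\<forall>x\<in>copies F. a2 19 x = M (Suc j) x) \<and> (\<forall>x\<in>copies F. a2 20 x = (g ^^ (2 ^ Suc j)) x) \<and>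
          (\<forall>q. q \<noteq> 19 \<longrightarrow> q \<noteq> 20 \<longrightarrow> q \<noteq> 21 \<longrightarrow> a2 q = a1 q)"
      let ?P4 = "\<lambda>s2 a2. s2 = s1 \<and> (\<forall>x\<in>copies F. a2 19 x = M (Suc j) x) \<and> (\<forall>x\<in>copies F. a2 18 x = (g ^^ (2 ^ Suc j)) x) \<and>
          (\<forall>q. q \<noteq> 18 \<longrightarrow> q \<noteq> 19 \<longrightarrow> q \<noteq> 20 \<longrightarrow> q \<noteq> 21 \<longrightarrow> a2 q = a1 q)"
      have gg: "?g (?g x) = (g ^^ (2 ^ Suc j)) x" for x by (simp add: funpow_add[symmetric, THEN fun_cong, unfolded comp_def] mult_2)
      have n0: "nval (Reg ''h'' \<prec> Const 2 \<otimes> Reg ''p'') s1 \<noteq> 0" using 3 reg lt by simp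
      have s1f: "s1 ''f'' = f" "s1 ''h'' = 2 ^ j" using 3 reg by auto
      show ?case
      proof (intro conjI n0, rule runs_Seq[where P = ?P1 and ta = "200 * f + 100" and da = 200 and tb = "600 * f + 340" and db = 640], goal_cases)
        case 1
        show ?case
          by (rule runs_elems[where v = "M (Suc j)" and f = f and F = F])
             (use 3 M_in inX F gp in \<open>auto simp: s1f reg(1,2) a15 bij ok_simps elem_def el M_Suc min_def\<close>)
      next
        case A: (2 s2 a2)
        show ?case
        proof (rule runs_Seq[where P = ?P2 and ta = "200 * f + 100" and da = 200 and tb = "400 * f + 240" and db = 440], goal_cases)
          case 1
          show ?case
            by (rule runs_elems[where v = "g ^^ (2 ^ Suc j)" and f = f and F = F])
               (use 3 A inX F gp gg in \<open>auto simp: s1f reg(1,2) a15 bij ok_simps elem_def el simp del: power_Suc\<close>)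
        next
          case A: (2 s2 a2)
          show ?case
          proof (rule runs_Seq[where P = ?P3 and ta = "200 * f + 100" and da = 200 and tb = "200 * f + 140" and db = 240], goal_cases)
            case 1
            show ?case
              by (rule runs_elems[where v = "M (Suc j)" and f = f and F = F])
                (use A M_in inX F in \<open>auto simp: s1f reg(1,2) a15 bij ok_simps elem_def el\<close>)
          next
            case A: (2 s2 a2)
            show ?case
            proof (rule runs_Seq[where P = ?P4 and ta = "200 * f + 100" and da = 200 and tb = 40 and db = 40], goal_cases)
              case 1
              show ?case
                by (rule runs_elems[where v = "g ^^ (2 ^ Suc j)" and f = f and F = F])
                  (use A inX F gp in \<open>auto simp: s1f reg(1,2) a15 bij ok_simps elem_def el simp del: power_Suc\<close>)
            next
              case A: (2 s2 a2)
              have "(2::nat) ^ j \<le> 2 ^ q" using 3(1) by (intro power_increasing) auto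
              then have "2 * 2 ^ j \<le> X" using q_X by linarith
              then show ?case using A 3 by (intro runs_Assign) (auto simp: ok_simps s1f)
            qed auto
          qed auto
        qed auto
      qed auto
    next
      case (4 s1 a1)
      have "Q (s(''h'' := 2 ^ (q + 1))) a1" by (rule post) (use 4 in \<open>auto simp: M_def\<close>)
      then have "Q s1 a1" using 4 by (simp only:)
      then show ?case using 4 reg by simp
    qed (use reg in \<open>auto simp: ok_simps\<close>)
  qed (use t in \<open>auto simp: algebra_simps\<close>)
qed

lemma runs_decide:
  assumes env: "env r" "r ''f'' = f" and hz: "heap_zero a" and y: "\<And>e. e < m \<Longrightarrow> a 13 e = y e" and yX: "\<And>e. e < m \<Longrightarrow> y e \<le> X"
    and f: "f = card (odds y)"
    and c: "\<And>e. e \<in> odds y \<Longrightarrow> a 19 (2 * e) < a 19 (2 * a 24 e + of_bool (a 24 e = e)) \<longleftrightarrow> c e"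
    and post: "\<And>a' r' \<beta>. (\<And>e. e < m \<Longrightarrow> a' 13 e = y e div 2 + of_bool (odd (y e) \<and> c e = \<beta>)) \<Longrightarrow>
        f \<le> 2 * card {e \<in> odds y. c e = \<beta>} \<Longrightarrow> heap_zero a' \<Longrightarrow>
        (\<And>r. r \<notin> {10, 11, 13, 14} \<Longrightarrow> a' r = a r) \<Longrightarrow> (\<And>x. x \<notin> {''h'', ''k''} \<Longrightarrow> r' x = r x) \<Longrightarrow> Q r' a'"
    and t: "9000 * m \<le> t" "1700 * (q + 1) \<le> d"
  shows "runs decide r a t d Q"
proof -
  have rg: "r ''m'' = m" "r ''p'' = 2 ^ q" using env by (auto simp: env_def)
  define k where "k = card {e \<in> odds y. c e}"
  \<comment> \<open>\<open>\<beta>\<close> is the color that will be rounded up, chosen as a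
    majority among the odd edges.\<close>
  define \<beta> where "\<beta> = (\<not> 2 * k < f)"
  have fin: "finite (odds y)" by (simp add: odds_def)
  have km: "k \<le> m"
    unfolding k_def odds_def using card_mono[of "{..<m}" "{e \<in> {e. e < m \<and> odd (y e)}. c e}"] by auto
  have maj: "f \<le> 2 * card {e \<in> odds y. c e = \<beta>}"
  proof (cases "2 * k < f")
    case True
    have "card {e \<in> odds y. c e} + card {e \<in> odds y. \<not> c e} = f"
      using sum_cases[OF fin, where P = c and f = "\<lambda>_. 1 :: nat"] by (simp add: f)
    then show ?thesis using True by (simp add: k_def \<beta>_def)
  qed (simp add: k_def \<beta>_def)
  define v where "v = (\<lambda>e. (y e mod 2) * of_bool (a 19 (2 * e) < a 19 (2 * a 24 e + of_bool (a 24 e = e))))"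
  have v: "v e = of_bool (odd (y e) \<and> c e)" if "e < m" for e
    using c[of e] that by (auto simp: v_def odds_def mod2_eq_if)
  have vk: "sum v {..<m} = k"
  proof -
    have "sum v {..<m} = (\<Sum>e<m. of_bool (odd (y e) \<and> c e))" using v by (intro sum.cong) auto
    then show ?thesis by (simp add: k_def odds_def Int_def conj_assoc)
  qed
  let ?v = "\<lambda>e. y e div 2 + of_bool (odd (y e) \<and> c e = \<beta>)"
  have vX: "?v e \<le> X" if "e < m" for e using yX[OF that] X_ge by (auto elim!: oddE)
  let ?P1 = "\<lambda>r1 a1. r1 = r(''h'' := 2 ^ q) \<and> a1 11 (2 ^ q + m) = k \<and> heap_zero a1 \<and> (\<forall>q. q \<notin> {10, 11} \<longrightarrow> a1 q = a q)"
  let ?P2 = "\<lambda>r1 a1. r1 = r(''h'' := 2 ^ q, ''k'' := k) \<and> heap_zero a1 \<and> (\<forall>q. q \<notin> {10, 11} \<longrightarrow> a1 q = a q)"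
  let ?P3 = "\<lambda>r1 a1. r1 = r(''h'' := 2 ^ q, ''k'' := k) \<and> heap_zero a1 \<and> (\<forall>e<m. a1 14 e = ?v e) \<and> (\<forall>q. q \<notin> {10, 11, 14} \<longrightarrow> a1 q = a q)"
  show ?thesis unfolding decide_def
  proof (rule runs_Seq[where P = ?P1 and ta = "8000 * m" and da = "1200 * (q + 1)" and tb = "200 * (m + 1) + 40" and db = 440], goal_cases)
    case 1
    show ?case
      by (rule runs_psum[where v = v])
        (use hz vk km m_X y in \<open>auto simp: ok_simps rg v_def\<close>)
  next
    case A: (2 r1 a1)
    show ?case
    proof (rule runs_Seq[where P = ?P2 and ta = 40 and da = 40 and tb = "200 * (m + 1)" and db = 400], goal_cases)
      case 1
      show ?case by (rule runs_Load) (use A in \<open>auto simp: ok_simps rg\<close>)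
    next
      case A: (2 r1 a1)
      then have r1: "r1 ''m'' = m" "r1 ''k'' = k" "r1 ''f'' = f" and a1: "a1 13 = a 13" "a1 24 = a 24" "a1 19 = a 19" using rg env by auto
      show ?case
      proof (rule runs_Seq[where P = ?P3 and ta = "100 * (m + 1)" and da = 200 and tb = "100 * (m + 1)" and db = 200], goal_cases)
        case 1
        show ?case
        proof (rule runs_ParFor[where k = m and C = "\<lambda>_. True" and f = "\<lambda>i. i" and v = ?v], goal_cases)
          case (9 e)
          show ?case
          proof (cases "odd (y e)")
            case True
            then have "a 19 (2 * e) < a 19 (2 * a 24 e + of_bool (a 24 e = e)) \<longleftrightarrow> c e"
              using c[of e] 9 by (simp add: odds_def)
            then show ?thesis using y[OF 9(1)] True
              by (cases "a 24 e = e"; cases "c e") (simp_all add: r1 a1 \<beta>_def odd_iff_mod_2_eq_one)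
          next
            case False
            then show ?thesis using y[OF 9(1)] by (simp add: r1 a1)
          qed
        next
          case (10 e) then show ?case using vX by simp
        qed (use A m_X in \<open>auto simp: ok_simps r1 rg heap_zero_def\<close>)
      next
        case A: (2 r1 a1)
        then have r1: "r1 ''m'' = m" using rg by auto
        show ?case
        proof (rule runs_ParFor[where k = m and C = "\<lambda>_. True" and f = "\<lambda>i. i" and v = ?v], goal_cases)
          case (14 a')
          show ?case by (rule post[of _ \<beta>]) (use 14 A maj in \<open>auto simp: heap_zero_def\<close>)
        qed (use A m_X vX in \<open>auto simp: ok_simps r1 rg\<close>)
      qed auto
    qed auto
  qed (use t m in auto)
qed

text \<open>Finding the odd edges costs O(m), and only pointer jumping has the extra logarithm, on
  \<open>f\<close> edges. As odd values are at least 1, \<open>f\<close> is at most the sum of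
  \<open>y\<close>; in this form the costs of all rounds can be added up.\<close>

lemma runs_halve:
  assumes env: "env r" and st: "static a" and hz: "heap_zero a" and y: "\<And>e. e < m \<Longrightarrow> a 13 e = y e"
    and fr: "fractional (2 * U) y" and U: "2 * U \<le> X"
    and post: "\<And>a' r' y'. static a' \<Longrightarrow> heap_zero a' \<Longrightarrow> (\<And>e. e < m \<Longrightarrow> a' 13 e = y' e) \<Longrightarrow> fractional U y' \<Longrightarrow>
       sum y {..<m} \<le> 2 * sum y' {..<m} \<Longrightarrow> (\<And>x. x \<notin> {''h'', ''f'', ''k''} \<Longrightarrow> r' x = r x) \<Longrightarrow> Q r' a'"
    and t: "30000 * m + 2000 * (q + 1) * sum y {..<m} \<le> t" "8000 * (q + 1) \<le> d"
  shows "runs halve r a t d Q"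
proof -
  let ?F = "odds y"
  define f where "f = card ?F"
  have yX: "y e \<le> X" if "e < m" for e using fr U that by (auto simp: fractional_def)
  have Fm: "?F \<subseteq> {..<m}" and finF: "finite ?F" by (auto simp: odds_def)
  have fm: "f \<le> m" unfolding f_def using card_mono[OF _ Fm] by simp
  have fy: "f \<le> sum y {..<m}"
  proof -
    have "f = (\<Sum>e\<in>?F. 1)" by (simp add: f_def)
    also have "\<dots> \<le> sum y ?F" by (rule sum_mono) (auto simp: odds_def elim!: oddE)
    also have "\<dots> \<le> sum y {..<m}" by (rule sum_mono2) (use Fm in auto)
    finally show ?thesis .
  qed
  let ?P1 = "\<lambda>r1 a1. r1 = r(''h'' := 2 ^ q, ''f'' := f) \<and> pair_ok a1 0 y \<and> heap_zero a1 \<and>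
     (\<forall>q. q \<notin> {10, 11, 15, 24} \<longrightarrow> a1 q = a q)"
  show ?thesis unfolding halve_def
  proof (rule runs_Seq[where P = ?P1 and ta = "8500 * m" and da = "1700 * (q + 1)" and
        tb = "17500 * m + (q + 1) * (800 * f + 480) + 400 * f + 280" and db = "4400 * (q + 1) + 400"], goal_cases)
    case 1
    show ?case by (rule runs_pair_odd[OF _ env st hz y yX]) (auto simp: f_def)
  next
    case A1: (2 r1 a1)
    have env1: "env r1" using A1 env by (simp add: env_def)
    have st1: "static a1" by (rule static_cong[OF st]) (use A1 in auto)
    \<comment> \<open>The second pairing overwrites array 15 by another enumeration of the same odd
      edges, which serves all later steps.\<close>
    let ?P2 = "\<lambda>r2 a2. r2 = r1 \<and> pair_ok a2 0 y \<and> pair_ok a2 1 y \<and> bij_betw (a2 15) {..<f} ?F \<and> heap_zero a2 \<and>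
     (\<forall>q. q \<notin> {10, 11, 15, 24, 25} \<longrightarrow> a2 q = a q)"
    show ?case
    proof (rule runs_Seq[where P = ?P2 and ta = "8500 * m" and da = "1700 * (q + 1)" and
        tb = "9000 * m + (q + 1) * (800 * f + 480) + 400 * f + 280" and db = "2700 * (q + 1) + 400"], goal_cases)
      case 1
      show ?case
      proof (rule runs_pair_odd[where y = y], goal_cases)
        case (7 a')
        have "r1(''h'' := 2 ^ q, ''f'' := card ?F) = r1" using A1 by (auto simp: f_def)
        moreover have "pair_ok a' 0 y" using A1 7(4)[of 24] by (simp add: pair_ok_def)
        ultimately show ?case using 7 A1 by (auto simp: f_def)
      qed (use A1 env1 st1 y yX in auto)
    next
      case A2: (2 r2 a2)
      have reg2: "r2 ''f'' = f" using A2 A1 by simp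
      define p where "p = (\<lambda>s. a2 (24 + s))"
      have pk: "p s e \<in> ?F \<and> ep s (p s e) = ep s e \<and> p s (p s e) = e" if "s < 2" "e \<in> ?F" for s e
      proof -
        have "s = 0 \<or> s = 1" using that by auto
        then have "pair_ok a2 s y" using A2 by blast
        then show ?thesis using that by (simp add: pair_ok_def p_def)
      qed
      have pf: "e = e'" if "s < 2" "e \<in> ?F" "e' \<in> ?F" "p s e = e" "p s e' = e'" "ep s e = ep s e'" for s e e'
      proof -
        have "s = 0 \<or> s = 1" using that by auto
        then have "pair_ok a2 s y" using A2 by blast
        then show ?thesis using that unfolding pair_ok_def p_def by blast
      qed
      have card_copies: "card (copies ?F) = 2 * f"
        using bij_betw_same_card[OF copies_bij[of "a2 15" f ?F]] A2 by simp
      have "finite (copies ?F)" using copies_less[OF Fm] by (auto intro: finite_subset[of _ "{..<2 * m}"])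
      moreover have "2 * f \<le> 2 ^ (q + 1)" using fm m(2) by simp
      \<comment> \<open>There are 2 * f copies and f \<le> m < 2 ^ q, so q + 1 doublings exhaust
        every orbit.\<close>
      ultimately interpret ti: two_involutions "copies ?F" "double (p 0)" "double (p 1)" "2 ^ (q + 1)"
        using double_involution[of ?F "p 0"] double_involution[of ?F "p 1"] pk card_copies
        by unfold_locales (auto simp: copies_def)
      let ?\<sigma> = "ti.\<sigma>"
      have \<sigma>_in: "?\<sigma> x \<in> copies ?F" if "x \<in> copies ?F" for x using ti.\<sigma>_in[OF that] .
      have inX: "x \<le> X" if "x \<in> copies ?F" for x using copies_less[OF Fm that] m_X by simp
      have \<sigma>_eq: "2 * p 1 (p 0 (x div 2)) + (x mod 2 + of_bool (p 0 (x div 2) = x div 2) + of_bool (p 1 (p 0 (x div 2)) = p 0 (x div 2))) mod 2 = ?\<sigma> x" for x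
      proof -
        obtain k where "x = 2 * k \<or> x = 2 * k + 1" by (metis evenE oddE)
        then show ?thesis unfolding ti.\<sigma>_def double_def by auto
      qed
      let ?P3 = "\<lambda>r3 a3. r3 = r2 \<and> (\<forall>x\<in>copies ?F. a3 18 x = ?\<sigma> x) \<and> (\<forall>q. q \<noteq> 18 \<longrightarrow> a3 q = a2 q)"
      show ?case
      proof (rule runs_Seq[where P = ?P3 and ta = "200 * f + 100" and da = 200 and
        tb = "9000 * m + (q + 1) * (800 * f + 480) + 200 * f + 180" and db = "2700 * (q + 1) + 200"], goal_cases)
        case 1
        show ?case
        proof (rule runs_elems[where v = ?\<sigma> and f = f and F = ?F], goal_cases)
          case (9 i x)
          have "a2 24 = p 0" "a2 25 = p 1" by (simp_all add: p_def)
          then show ?case using \<sigma>_eq[of x] 9 by auto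
        qed (use A2 reg2 fm Fm \<sigma>_in inX in \<open>auto simp: ok_simps elem_def\<close>)
      next
        case A3: (2 r3 a3)
        let ?P4 = "\<lambda>r4 a4. r4 = r2 \<and> (\<forall>x\<in>copies ?F. a4 18 x = ?\<sigma> x) \<and> (\<forall>x\<in>copies ?F. a4 19 x = x) \<and> (\<forall>q. q \<noteq> 18 \<longrightarrow> q \<noteq> 19 \<longrightarrow> a4 q = a2 q)"
        show ?case
        proof (rule runs_Seq[where P = ?P4 and ta = "200 * f + 100" and da = 200 and
          tb = "9000 * m + (q + 1) * (800 * f + 480) + 80" and db = "2700 * (q + 1)"], goal_cases)
          case 1
          show ?case
            by (rule runs_elems[where v = "\<lambda>x. x" and f = f and F = ?F])
              (use A2 A3 reg2 fm Fm inX in \<open>auto simp: ok_simps elem_def\<close>)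
        next
          case A4: (2 r4 a4)
          let ?P5 = "\<lambda>r5 a5. r5 = r2(''h'' := 2 ^ (q + 1)) \<and> (\<forall>x\<in>copies ?F. a5 19 x = ti.orbit_min x) \<and> (\<forall>q. q \<notin> {18, 19, 20, 21} \<longrightarrow> a5 q = a2 q)"
          show ?case
          proof (rule runs_Seq[where P = ?P5 and ta = "(q + 1) * (800 * f + 480) + 80" and da = "1000 * (q + 1)" and
              tb = "9000 * m" and db = "1700 * (q + 1)"], goal_cases)
            case 1
            show ?case
            proof (rule runs_jump[where f = f and F = ?F and g = ?\<sigma>], goal_cases)
              case (9 a')
              have "\<forall>x\<in>copies ?F. a' 19 x = ti.orbit_min x" unfolding ti.orbit_min_def using 9(1) by blast
              then show ?case using A4 9(2) by auto
            qed (use A1 A2 A4 env1 reg2 fm Fm \<sigma>_in in \<open>auto simp: env_def\<close>)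
          next
            case A5: (2 r5 a5)
            have a524: "a5 24 = p 0" using A5 by (simp add: p_def)
            have cp: "2 * e \<in> copies ?F" if "e \<in> ?F" for e using that by (simp add: copies_def)
            have d0: "double (p 0) (2 * e) = 2 * p 0 e + of_bool (p 0 e = e)" for e by (simp add: double_def)
            \<comment> \<open>Only even copies decide: an edge and a different partner have even
              copies that the doubled pairing exchanges.\<close>
            have cN: "ti.color (2 * p s e) \<noteq> ti.color (2 * e)" if "s < 2" "e \<in> ?F" "p s e \<noteq> e" for s e
            proof -
              have "double (p s) (2 * e) = 2 * p s e" using that by (simp add: double_def)
              moreover have "s = 0 \<or> s = 1" using that by auto
              ultimately show ?thesis using ti.color_t0[OF cp[OF that(2)]] ti.color_t1[OF cp[OF that(2)]] by auto
            qed
            show ?case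
            proof (rule runs_decide[where y = y and f = f and c = "\<lambda>e. ti.color (2 * e)"], goal_cases)
              case (7 e)
              have "double (p 0) (2 * e) \<in> copies ?F" using ti.t0(1)[OF cp[OF 7]] .
              then show ?case using A5 cp[OF 7] unfolding a524 ti.color_def d0 by auto
            next
              case (8 a' r' \<beta>)
              let ?y' = "\<lambda>e. y e div 2 + of_bool (odd (y e) \<and> (ti.color (2 * e) = \<beta>))"
              have "fractional U ?y'"
              proof (rule halving_fractional[OF fr, where p = p])
                fix s e :: nat assume se: "s < 2" "e < m" "odd (y e)"
                then have eF: "e \<in> ?F" by (simp add: odds_def)
                show "p s e < m \<and> odd (y (p s e)) \<and> ep s (p s e) = ep s e \<and> p s (p s e) = e"
                  using pk[OF se(1) eF] by (simp add: odds_def)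
                show "(ti.color (2 * p s e) = \<beta>) \<noteq> (ti.color (2 * e) = \<beta>)" if "p s e \<noteq> e"
                  using cN[OF se(1) eF that] by blast
              next
                fix s e e' :: nat assume "s < 2" "e < m" "e' < m" "odd (y e)" "odd (y e')" "p s e = e" "p s e' = e'" "ep s e = ep s e'"
                then show "e = e'" using pf[of s e e'] by (simp add: odds_def)
              qed
              moreover have "sum y {..<m} \<le> 2 * sum ?y' {..<m}"
                by (rule halving_sum[where F = ?F]) (use 8(2) in \<open>auto simp: odds_def f_def\<close>)
              moreover have "static a'"
                by (rule static_cong[OF st]) (use 8(4) A5 A2 in auto)
              ultimately show ?case
                using 8 A1 A2 A5 by (intro post[where y' = ?y']) auto
            qed (use A1 A2 A5 env1 y yX reg2 in \<open>auto simp: f_def env_def heap_zero_def\<close>)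
          qed auto
        qed auto
      qed auto
    qed auto
  next
    case 3
    \<comment> \<open>This absorbs the part of the cost of a jump pass that does not depend on
      \<open>f\<close> into the linear term.\<close>
    have "q + 1 \<le> 2 * m" using le_pow2[of "q"] m less_exp[of q] by linarith
    then have "(q + 1) * 480 \<le> 960 * m" by simp
    moreover have "400 * f \<le> 400 * m" using fm by simp
    moreover have "(q + 1) * (800 * f) \<le> (q + 1) * (800 * sum y {..<m})" by (intro mult_le_mono fy order_refl)
    ultimately have "8500 * m + (17500 * m + (q + 1) * (800 * f + 480) + 400 * f + 280) \<le>
        30000 * m + 2000 * (q + 1) * sum y {..<m}"
      using m(1) by (simp add: algebra_simps)
    then show ?case using t by linarith
  qed (use t in auto)
qed

text \<open>In round j the solution is feasible in units of 1 / 2 ^ (k - j), so its value, and with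
  it the number of odd edges, is at most 2 ^ (k - j) * \<Delta>; these bounds sum to at most 2 * 2 ^
  k * \<Delta>.\<close>

lemma runs_roundoff:
  assumes env: "env r" and st: "static a" and hz: "heap_zero a" and y: "\<And>e. e < m \<Longrightarrow> a 13 e = y e"
    and fr: "fractional (2 ^ k) y" and o: "r ''o'' = 2 ^ k" and U: "2 ^ k \<le> X"
    and dl: "\<And>U y. fractional U y \<Longrightarrow> sum y {..<m} \<le> U * \<Delta>"
    and post: "\<And>a' r' y'. (\<And>e. e < m \<Longrightarrow> a' 13 e = y' e) \<Longrightarrow> fractional 1 y' \<Longrightarrow>
       sum y {..<m} \<le> 2 ^ k * sum y' {..<m} \<Longrightarrow> env r' \<Longrightarrow> Q r' a'"
    and t: "31000 * m * (k + 1) + 4000 * (q + 1) * 2 ^ k * \<Delta> \<le> t" "9000 * (q + 1) * (k + 1) \<le> d"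
  shows "runs roundoff r a t d Q"
proof -
  let ?I = "\<lambda>j r1 a1. env r1 \<and> static a1 \<and> heap_zero a1 \<and> r1 ''o'' = 2 ^ (k - j) \<and>
     (\<exists>y1. (\<forall>e<m. a1 13 e = y1 e) \<and> fractional (2 ^ (k - j)) y1 \<and> sum y {..<m} \<le> 2 ^ j * sum y1 {..<m})"
  show ?thesis unfolding roundoff_def
  proof (rule runs_While[where k = k and I = ?I and tb = "\<lambda>j. 30040 * m + 2000 * (q + 1) * (2 ^ (k - j) * \<Delta>)"
        and db = "\<lambda>_. 8040 * (q + 1)"], goal_cases)
    case 2 then show ?case using assms by auto
  next
    case (3 j r1 a1)
    then obtain y1 where y1: "\<forall>e<m. a1 13 e = y1 e" "fractional (2 ^ (k - j)) y1" "sum y {..<m} \<le> 2 ^ j * sum y1 {..<m}" by blast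
    define U where "U = (2::nat) ^ (k - Suc j)"
    have kj: "k - j = Suc (k - Suc j)" using 3(1) by simp
    then have UU: "2 ^ (k - j) = 2 * U" by (simp add: U_def)
    have "(2::nat) ^ (k - j) \<le> 2 ^ k" by (intro power_increasing) auto
    then have UX: "2 * U \<le> X" using U unfolding UU by linarith
    have Upos: "1 \<le> U" by (simp add: U_def)
    let ?P = "\<lambda>r2 a2. env r2 \<and> static a2 \<and> heap_zero a2 \<and> r2 ''o'' = 2 * U \<and>
      (\<exists>y2. (\<forall>e<m. a2 13 e = y2 e) \<and> fractional U y2 \<and> sum y {..<m} \<le> 2 ^ Suc j * sum y2 {..<m})"
    have "runs (Seq halve (Assign ''o'' (Reg ''o'' \<oslash> Const 2))) r1 a1 (30040 * m + 2000 * (q + 1) * (2 ^ (k - j) * \<Delta>)) (8040 * (q + 1)) (?I (Suc j))"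
    proof (rule runs_Seq[where P = ?P and ta = "30000 * m + 2000 * (q + 1) * (2 ^ (k - j) * \<Delta>)" and da = "8000 * (q + 1)" and tb = 40 and db = 40], goal_cases)
      case 1
      show ?case
      proof (rule runs_halve[where y = y1 and U = U], goal_cases)
        case (7 a' r' y')
        have "sum y {..<m} \<le> 2 ^ j * (2 * sum y' {..<m})" using y1(3) 7(5) by (meson le_trans mult_le_mono2)
        then show ?case using 7 3 by (auto simp: env_def UU)
      next
        case 8
        show ?case using dl[OF y1(2)] by simp
      qed (use 3 y1 UX in \<open>auto simp: UU\<close>)
    next
      case (2 r2 a2)
      then show ?case using UX by (intro runs_Assign) (auto simp: ok_simps env_def U_def)
    qed (use m in auto)
    moreover have "nval (Const 1 \<prec> Reg ''o'') r1 \<noteq> 0" using 3 Upos by (simp add: UU)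
    ultimately show ?case by blast
  next
    case (4 r1 a1)
    then obtain y1 where y1: "\<forall>e<m. a1 13 e = y1 e" "fractional 1 y1" "sum y {..<m} \<le> 2 ^ k * sum y1 {..<m}" by auto
    have "Q r1 a1" by (rule post[where y' = y1]) (use y1 4 in auto)
    then show ?case using 4 by simp
  next
    case 5
    have "(\<Sum>j<k. 2 ^ (k - j)) = (\<Sum>j<k. 2 * (2::nat) ^ (k - Suc j))"
      by (intro sum.cong) (auto simp flip: power_Suc simp: Suc_diff_Suc)
    also have "\<dots> \<le> 2 * 2 ^ k" unfolding sum_distrib_left[symmetric] sum_pow2 by simp
    finally have "2000 * (q + 1) * ((\<Sum>j<k. 2 ^ (k - j)) * \<Delta>) \<le> 2000 * (q + 1) * (2 * 2 ^ k * \<Delta>)"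
      by (intro mult_le_mono) auto
    moreover have "(\<Sum>j<k. 30040 * m + 2000 * (q + 1) * (2 ^ (k - j) * \<Delta>)) = 30040 * m * k + 2000 * (q + 1) * ((\<Sum>j<k. 2 ^ (k - j)) * \<Delta>)"
      by (simp only: sum.distrib sum_distrib_left[symmetric] sum_distrib_right[symmetric]) simp
    moreover have "30040 * m * k + 40 * (k + 1) \<le> 31000 * m * (k + 1)"
      using m(1) by (cases m) (auto simp: algebra_simps)
    moreover have "2000 * (q + 1) * (2 * 2 ^ k * \<Delta>) = 4000 * (q + 1) * 2 ^ k * \<Delta>" by simp
    ultimately show ?case using t(1) by linarith
  next
    case 6
    show ?case using t(2) by (simp add: algebra_simps)
  qed (auto simp: ok_simps)
qed

end

section \<open>Assembling the program, its approximation ratio and its costs\<close>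

section \<open>The whole program\<close>

context alg
begin

lemma all_less_2: "(\<forall>s<2. P s) \<longleftrightarrow> P (0::nat) \<and> P 1"
  by (auto simp: less_2_cases_iff)

lemma N_le_pow: "k \<le> lg \<Longrightarrow> (2::nat) ^ k \<le> N"
  unfolding N by (intro power_increasing) auto

lemma runs_setup_sizes:
  assumes r: "r ''n'' = n" "r ''m'' = m"
    and post: "\<And>r'. r' ''n'' = n \<Longrightarrow> r' ''m'' = m \<Longrightarrow> r' ''N'' = N \<Longrightarrow> r' ''l'' = lg \<Longrightarrow> r' ''p'' = 2 ^ q \<Longrightarrow> Q r' a"
    and lgm: "\<And>k. k < lg \<Longrightarrow> 2 ^ k \<le> n" and qm: "\<And>k. k < q \<Longrightarrow> 2 ^ k \<le> m"
    and t: "120 * (lg + q) + 200 \<le> t" "120 * (lg + q) + 200 \<le> d"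
  shows "runs setup_sizes r a t d Q"
proof -
  have X1: "1 \<le> X" using X_ge by simp
  let ?A = "\<lambda>r1 a1. a1 = a \<and> r1 = r(''N'' := 1)"
  let ?I = "\<lambda>j r1 a1. a1 = a \<and> r1 ''n'' = n \<and> r1 ''m'' = m \<and> r1 ''N'' = 2 ^ j \<and> r1 ''l'' = j"
  let ?B = "\<lambda>r1 a1. a1 = a \<and> r1 ''n'' = n \<and> r1 ''m'' = m \<and> r1 ''N'' = N \<and> r1 ''l'' = lg"
  let ?J = "\<lambda>j r1 a1. ?B r1 a1 \<and> r1 ''p'' = 2 ^ j"
  show ?thesis unfolding setup_sizes_def
  proof (rule runs_Seq[where P = ?A and ta = 40 and da = 40 and tb = "120 * (lg + q) + 160" and db = "120 * (lg + q) + 160"], goal_cases)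
    case 1 show ?case using X1 by (intro runs_Assign) (auto simp: ok_simps)
  next
    case A: (2 r1 a1)
    show ?case
    proof (rule runs_Seq[where P = "?I 0" and ta = 40 and da = 40 and tb = "120 * (lg + q) + 120" and db = "120 * (lg + q) + 120"], goal_cases)
      case 1 show ?case using A r by (intro runs_Assign) (auto simp: ok_simps)
    next
      case I0: (2 r1 a1)
      show ?case
      proof (rule runs_Seq[where P = ?B and ta = "120 * lg + 40" and da = "120 * lg + 40" and tb = "80 * q + 80" and db = "80 * q + 80"], goal_cases)
        case 1
        show ?case
        proof (rule runs_While[where I = ?I and k = lg and tb = "\<lambda>_. 80" and db = "\<lambda>_. 80"], goal_cases)
          case 2 then show ?case using I0 .
        next
          case (3 j r1 a1)
          have "2 ^ Suc j \<le> N" using 3(1) by (intro N_le_pow) simp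
          then have jX: "2 * 2 ^ j \<le> X" using N_X by simp
          have "Suc j \<le> X" using 3(1) lg_le N_X by simp
          then have "runs (Seq (Assign ''N'' (Const 2 \<otimes> Reg ''N'')) (Assign ''l'' (Reg ''l'' \<oplus> Const 1))) r1 a1 80 80 (?I (Suc j))"
            using 3 jX
            by (intro runs_Seq[where P = "\<lambda>r2 a2. a2 = a \<and> r2 = r1(''N'' := 2 ^ Suc j)" and ta = 40 and da = 40 and tb = 40 and db = 40] runs_Assign)
               (auto simp: ok_simps)
          then show ?case using 3 lgm[OF 3(1)] by simp
        next
          case (4 r1 a1)
          then show ?case using n N by simp
        qed (auto simp: ok_simps)
      next
        case B: (2 r1 a1)
        show ?case
        proof (rule runs_Seq[where P = "?J 0" and ta = 40 and da = 40 and tb = "80 * q + 40" and db = "80 * q + 40"], goal_cases)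
          case 1 show ?case using B X1 by (intro runs_Assign) (auto simp: ok_simps)
        next
          case J0: (2 r1 a1)
          show ?case
          proof (rule runs_While[where I = ?J and k = q and tb = "\<lambda>_. 40" and db = "\<lambda>_. 40"], goal_cases)
            case 2 then show ?case using J0 .
          next
            case (3 j r1 a1)
            have "2 ^ j \<le> m" using qm[OF 3(1)] .
            then have "2 * 2 ^ j \<le> X" using m_X by linarith
            then show ?case using 3 qm[OF 3(1)] by (auto simp: ok_simps intro!: runs_Assign)
          next
            case (4 r1 a1)
            then show ?case using m post[of r1] by simp
          qed (auto simp: ok_simps)
        qed auto
      qed auto
    qed auto
  qed (use t in auto)
qed

lemma runs_increments:
  assumes "r ''N'' = N" "r ''D'' = 0" "Q (r(''D'' := min k (6 * N ^ 2))) a" "100 * k \<le> t" "100 * k \<le> d"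
  shows "runs (increments k) r a t d Q"
  using assms(3-5)
proof (induction k arbitrary: Q t d)
  case 0
  then show ?case using assms(2) by (auto intro!: runs_Skip simp: fun_upd_idem)
next
  case (Suc k)
  have "6 * N ^ 2 \<le> X" by (rule const_pow_X[of _ 2]) auto
  then have X: "min k (6 * N ^ 2) < 6 * N ^ 2 \<Longrightarrow> Suc (min k (6 * N ^ 2)) \<le> X" by simp
  show ?case unfolding increments.simps
  proof (rule runs_Seq[where P = "\<lambda>r1 a1. r1 = r(''D'' := min k (6 * N ^ 2)) \<and> a1 = a" and ta = "100 * k" and da = "100 * k" and tb = 100 and db = 100], goal_cases)
    case 1 show ?case by (rule Suc.IH) auto
  next
    case A: (2 r1 a1)
    show ?case
    proof (rule runs_If[where t = 40 and d = 40], goal_cases)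
      case 2
      then have "k < 6 * N ^ 2" using A assms(1) by (auto simp: power2_eq_square split: if_splits)
      then show ?case using A X Suc.prems(1) by (intro runs_Assign) (auto simp: ok_simps min_def)
    next
      case 3
      then have "6 * N ^ 2 \<le> k" using A assms(1) by (auto simp: power2_eq_square min_def split: if_splits)
      then show ?case using A Suc.prems(1) by (intro runs_Skip) (auto simp: min_def)
    qed (auto simp: ok_simps)
  qed (use Suc.prems in auto)
qed

lemma runs_setup_params:
  assumes r: "r ''n'' = n" "r ''m'' = m" "r ''N'' = N" "r ''l'' = lg" "r ''p'' = 2 ^ q"
    and k: "D = min k (6 * N ^ 2)" and post: "\<And>r'. env r' \<Longrightarrow> Q r' a"
    and t: "100 * k + 160 \<le> t" "100 * k + 160 \<le> d"
  shows "runs (setup_params k) r a t d Q"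
proof -
  have Bi: "12 * D * ((N * N) * (N * N)) = Big" by (simp add: Big_def power_numeral_reduce)
  have BX: "Big \<le> X" using order_trans[OF Big_le const_pow_X[of 72 4 6]] by simp
  have wX: "w0 \<le> X" "T \<le> X" using w0T_X by auto
  let ?r1 = "r(''D'' := D)"
  let ?P = "\<lambda>r' r1 a1. r1 = r' \<and> a1 = a"
  show ?thesis unfolding setup_params_def
  proof (rule runs_Seq[where P = "?P (r(''D'' := 0))" and ta = 40 and da = 40 and tb = "100 * k + 120" and db = "100 * k + 120"], goal_cases)
    case 1 show ?case by (intro runs_Assign) (auto simp: ok_simps)
  next
    case A: (2 r1 a1)
    show ?case
    proof (rule runs_Seq[where P = "?P ?r1" and ta = "100 * k" and da = "100 * k" and tb = 120 and db = 120], goal_cases)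
      case 1 show ?case using A r k by (auto intro!: runs_increments)
    next
      case A: (2 r1 a1)
      show ?case
      proof (rule runs_Seq[where P = "?P (?r1(''B'' := Big))" and ta = 40 and da = 40 and tb = 80 and db = 80], goal_cases)
        case 1 show ?case using A r Bi BX by (intro runs_Assign) (auto simp: ok_simps)
      next
        case A: (2 r1 a1)
        show ?case
        proof (rule runs_Seq[where P = "?P (?r1(''B'' := Big, ''w'' := w0))" and ta = 40 and da = 40 and tb = 40 and db = 40], goal_cases)
          case 1 show ?case using A r wX by (intro runs_Assign) (auto simp: ok_simps w0_def)
        next
          case A: (2 r1 a1)
          have "env (?r1(''B'' := Big, ''w'' := w0, ''T'' := T))" using r by (simp add: env_def)
          then have "Q (?r1(''B'' := Big, ''w'' := w0, ''T'' := T)) a" by (rule post)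
          then show ?case using A r wX by (intro runs_Assign) (auto simp: ok_simps T_def)
        qed auto
      qed auto
    qed auto
  qed (use t in auto)
qed

lemma runs_read_side:
  assumes s: "s < 2" and env: "env r" and ep: "\<And>i. i < m \<Longrightarrow> a 32 (2 * i + s) = ep s i"
    and bud: "\<And>v. v < n \<Longrightarrow> a 32 (2 * m + v) = b v"
    and post: "\<And>a'. (\<And>i. i < m \<Longrightarrow> a' s i = ep s i \<and> a' (2 + s) i = b (ep s i)) \<Longrightarrow>
       (\<And>q. q \<noteq> s \<Longrightarrow> q \<noteq> 2 + s \<Longrightarrow> a' q = a q) \<Longrightarrow> Q r a'"
    and t: "400 * m \<le> t" "400 \<le> d"
  shows "runs (read_side s) r a t d Q"
proof -
  have s01: "s = 0 \<or> s = 1" using s by auto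
  have rg: "r ''m'' = m" using env by (simp add: env_def)
  have epn: "ep s i < n" if "i < m" for i using ep_less[OF s that] .
  have epX: "ep s i \<le> X" if "i < m" for i using epn[OF that] n_X by simp
  have bX: "b v \<le> X" for v using b_le[of v] n_X by simp
  let ?P = "\<lambda>r1 a1. r1 = r \<and> (\<forall>i<m. a1 s i = ep s i) \<and> (\<forall>q. q \<noteq> s \<longrightarrow> a1 q = a q)"
  show ?thesis unfolding read_side_def
  proof (rule runs_Seq[where P = ?P and ta = "100 * (m + 1)" and da = 200 and tb = "100 * (m + 1)" and db = 200], goal_cases)
    case 1
    show ?case
      by (rule runs_ParFor[where k = m and C = "\<lambda>_. True" and f = "\<lambda>i. i" and v = "ep s"])
        (use s01 m_X ep epX z in \<open>auto simp: ok_simps rg\<close>)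
  next
    case A: (2 r1 a1)
    have bb: "a1 32 (m + m + ep s i) = b (ep s i)" if "i < m" for i
    proof -
      have "a1 32 = a 32" using A s01 by auto
      then show ?thesis using bud[OF epn[OF that]] by (simp add: mult_2)
    qed
    show ?case
    proof (rule runs_ParFor[where k = m and C = "\<lambda>_. True" and f = "\<lambda>i. i" and v = "\<lambda>i. b (ep s i)"], goal_cases)
      case (6 i l j)
      then show ?case using A rg epn[OF 6(1)] z s01 by auto
    next
      case (9 i)
      then show ?case using A rg bb[OF 9(1)] s01 by auto
    next
      case (14 a')
      have "Q r a'" by (rule post) (use 14 A s01 in auto)
      then show ?case using A by simp
    qed (use s01 m_X A rg bX in \<open>auto simp: ok_simps\<close>)
  qed (use t m in auto)
qed

lemma runs_power_table:
  assumes env: "env r"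
    and post: "\<And>r' a'. env r' \<Longrightarrow> (\<And>k. k \<le> w0 + T \<Longrightarrow> a' 12 k = decay Big D k) \<Longrightarrow>
       (\<And>q. q \<noteq> 12 \<Longrightarrow> a' q = a q) \<Longrightarrow> Q r' a'"
    and t: "400 * (w0 + T) + 400 \<le> t" "400 * (w0 + T) + 400 \<le> d"
  shows "runs power_table r a t d Q"
proof -
  have BX: "Big \<le> X" using order_trans[OF Big_le const_pow_X[of 72 4 6]] by simp
  have X1: "1 \<le> X" using X_ge by simp
  let ?P = "\<lambda>r1 a1. r1 = r \<and> a1 12 0 = Big \<and> (\<forall>q. q \<noteq> 12 \<longrightarrow> a1 q = a q)"
  let ?I = "\<lambda>j r1 a1. r1 = r(''t'' := j) \<and> (\<forall>k\<le>j. a1 12 k = decay Big D k) \<and> (\<forall>q. q \<noteq> 12 \<longrightarrow> a1 q = a q)"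
  show ?thesis unfolding power_table_def
  proof (rule runs_Seq[where P = ?P and ta = 200 and da = 200 and tb = "400 * (w0 + T) + 200" and db = "400 * (w0 + T) + 200"], goal_cases)
    case 1
    show ?case
      by (rule runs_ParFor[where k = 1 and C = "\<lambda>_. True" and f = "\<lambda>_. 0" and v = "\<lambda>_. Big"])
        (use env BX X1 in \<open>auto simp: ok_simps env_def\<close>)
  next
    case A: (2 r1 a1)
    show ?case
    proof (rule runs_Seq[where P = "?I 0" and ta = 40 and da = 40 and tb = "400 * (w0 + T) + 80" and db = "400 * (w0 + T) + 80"], goal_cases)
      case 1 show ?case using A by (intro runs_Assign) (auto simp: ok_simps)
    next
      case I0: (2 r1 a1)
      show ?case
      proof (rule runs_While[where I = ?I and k = "w0 + T" and tb = "\<lambda>_. 240" and db = "\<lambda>_. 240"], goal_cases)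
        case 2 then show ?case using I0 .
      next
        case (3 j r1 a1)
        have rg: "r1 ''t'' = j" "r1 ''w'' = w0" "r1 ''T'' = T" "r1 ''D'' = D" using 3 env by (auto simp: env_def)
        have dX: "decay Big D k \<le> X" for k using decay_le[of Big D k] BX by simp
        have "runs (Seq (ParFor ''i'' (Const 1) (body [(''a'', 12, Reg ''t'')] (Const 1, 12, Reg ''t'' \<oplus> Const 1, Reg ''a'' \<ominus> Reg ''a'' \<oslash> Reg ''D'')))
            (Assign ''t'' (Reg ''t'' \<oplus> Const 1))) r1 a1 240 240 (?I (Suc j))"
        proof (rule runs_Seq[where P = "\<lambda>r2 a2. r2 = r1 \<and> (\<forall>k\<le>Suc j. a2 12 k = decay Big D k) \<and> (\<forall>q. q \<noteq> 12 \<longrightarrow> a2 q = a q)"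
              and ta = 200 and da = 200 and tb = 40 and db = 40], goal_cases)
          case 1
          show ?case
          proof (rule runs_ParFor[where k = 1 and C = "\<lambda>_. True" and f = "\<lambda>_. Suc j" and v = "\<lambda>_. decay Big D (Suc j)"], goal_cases)
            case (10 i) show ?case by (rule dX)
          next
            case (14 a')
            have "\<forall>l\<le>Suc j. a' 12 l = decay Big D l"
            proof (intro allI impI)
              fix l assume l: "l \<le> Suc j"
              show "a' 12 l = decay Big D l"
              proof (cases "l = Suc j")
                case False
                then have "a' 12 l = a1 12 l" by (intro 14(2)) auto
                then show ?thesis using 3 False l by auto
              qed (use 14(1)[of 0] in simp)
            qed
            then show ?case using 14(3) 3 by auto
          qed (use 3 X1 rg in \<open>auto simp: ok_simps\<close>)
        next
          case (2 r2 a2)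
          have "Suc j \<le> X" using 3(1) w0T_X by simp
          then show ?case using 2 3 rg by (intro runs_Assign) (auto simp: ok_simps)
        qed auto
        then show ?case using rg 3(1) by simp
      next
        case (4 r1 a1)
        have "env r1" using 4 env by (simp add: env_def)
        moreover from this have "r1 ''w'' = w0" "r1 ''T'' = T" by (auto simp: env_def)
        moreover have "r1 ''t'' = w0 + T" using 4 by simp
        ultimately show ?case using 4 post[of r1 a1] by simp
      qed (auto simp: ok_simps)
    qed auto
  qed (use t in auto)
qed

lemma runs_write_output:
  assumes env: "env r" and y: "\<And>e. e < m \<Longrightarrow> a 13 e = y e \<and> y e \<le> 1"
    and post: "\<And>a'. (\<And>e. e < m \<Longrightarrow> a' 32 (2 * m + n + e) = y e) \<Longrightarrow> Q r a'"
    and t: "200 * m \<le> t" "200 \<le> d"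
  shows "runs write_output r a t d Q"
proof -
  have rg: "r ''m'' = m" "r ''n'' = n" using env by (auto simp: env_def)
  have yX: "y e \<le> X" if "e < m" for e using y[OF that] X_ge by simp
  show ?thesis unfolding write_output_def
  proof (rule runs_ParFor[where k = m and C = "\<lambda>_. True" and f = "\<lambda>i. 2 * m + n + i" and v = y], goal_cases)
    case (14 a')
    show ?case by (rule post) (use 14 in auto)
  qed (use y yX z m m_X t in \<open>auto simp: ok_simps rg\<close>)
qed

text \<open>The levels contribute the factor (D - 5) / D and truncation (D - 1) / D, the latter
  because the scaled value is at least \<open>D\<close> times the loss m * Big; finally (D - 1) * (D
  - 5) \<ge> D * (D - 6). A clipped value of 0 forces the dual value to be 0.\<close>

lemma final_ratio:
  assumes dl: "(D - 5) * (Big * \<Delta>) \<le> D * V" and big: "m * D * Big \<le> 2 ^ k * max V 1"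
    and y: "2 ^ k * V \<le> Big * (Y + m)" and S: "Y \<le> 2 ^ k * S"
  shows "(D - 6) * \<Delta> \<le> D * S"
proof (cases "V = 0")
  case True
  then have "(D - 5) * (Big * \<Delta>) = 0" using dl by simp
  then have "\<Delta> = 0" using D Big_pos by simp
  then show ?thesis by simp
next
  case False
  define d B K v s \<delta> where "d = real D" "B = real Big" "K = (2::real) ^ k" "v = real V" "s = real S" "\<delta> = real \<Delta>"
  note defs = this
  have pos: "6 \<le> d" "0 < B" "0 < K" "0 \<le> \<delta>" "0 \<le> s" using D Big_pos by (auto simp: defs)
  have "real ((D - 5) * (Big * \<Delta>)) \<le> real (D * V)" using dl by (simp only: of_nat_le_iff)
  then have 1: "(d - 5) * (B * \<delta>) \<le> d * v" using D by (simp add: defs of_nat_diff)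
  have "max V 1 = V" using False by simp
  then have "real (m * D * Big) \<le> real (2 ^ k * V)" using big by (simp only: of_nat_le_iff)
  then have 2: "real m * d * B \<le> K * v" by (simp add: defs)
  have "2 ^ k * V \<le> Big * (2 ^ k * S + m)" using y S by (meson le_trans mult_le_mono2 add_le_mono1)
  then have "real (2 ^ k * V) \<le> real (Big * (2 ^ k * S + m))" by (simp only: of_nat_le_iff)
  then have 3: "K * v \<le> B * (K * s + real m)" by (simp add: defs)
  have "d * (K * v) \<le> d * (B * (K * s + real m))" using 3 pos by (intro mult_left_mono) auto
  then have "d * (K * v) \<le> d * B * K * s + K * v" using 2 by (simp add: algebra_simps)
  then have "K * ((d - 1) * v) \<le> K * (d * B * s)" by (simp add: algebra_simps)
  then have 4: "(d - 1) * v \<le> d * B * s" using pos by simp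
  have "(d - 1) * ((d - 5) * (B * \<delta>)) \<le> (d - 1) * (d * v)" using 1 pos by (intro mult_left_mono) auto
  also have "\<dots> = d * ((d - 1) * v)" by simp
  also have "\<dots> \<le> d * (d * B * s)" using 4 pos by (intro mult_left_mono) auto
  finally have 5: "(d - 1) * (d - 5) * \<delta> * B \<le> d * d * s * B" by (simp add: ac_simps)
  then have "(d - 1) * (d - 5) * \<delta> \<le> d * d * s" using pos by simp
  moreover have "d * (d - 6) * \<delta> \<le> (d - 1) * (d - 5) * \<delta>"
    using pos by (intro mult_right_mono) (auto simp: algebra_simps)
  ultimately have "d * ((d - 6) * \<delta>) \<le> d * (d * s)" by (simp add: ac_simps)
  then have "(d - 6) * \<delta> \<le> d * s" using pos by simp
  then have "real ((D - 6) * \<Delta>) \<le> real (D * S)" using D by (simp add: defs of_nat_diff)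
  then show ?thesis by (simp only: of_nat_le_iff)
qed

text \<open>\<open>m\<close> is at most quadratic in \<open>N\<close>, so scans over edges also have
  depth O(log n).\<close>

lemma q_le: "q + 1 \<le> 4 * lg"
proof -
  have "(2::nat) ^ q \<le> 2 * N ^ 2" using m by linarith
  also have "\<dots> = 2 ^ (1 + lg * 2)" unfolding N power_add power_mult by simp
  finally have "q \<le> 1 + lg * 2" by (rule power_le_imp_le_exp[rotated]) simp
  then show ?thesis using lg_pos by linarith
qed

text \<open>\<open>W\<close> is the order of \<open>T\<close> rounds of linear work, and
  \<open>H\<close> that of \<open>T\<close> rounds of logarithmic depth; every phase is measured
  against these two.\<close>

definition W where "W = m * (D * D * lg)"
definition H where "H = D * D * lg * lg"

lemma cost_facts:
  "m * lg \<le> W" "m * T \<le> 6 * W" "w0 + T \<le> 12 * W" "m * D * lg \<le> W" "m \<le> W" "lg \<le> W" "1 \<le> W"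
  "lg \<le> H" "lg * lg \<le> H" "lg * T \<le> 6 * H" "w0 + T \<le> 12 * H" "1 \<le> H"
proof -
  have 1: "1 \<le> m" "1 \<le> D" "1 \<le> lg" using m D lg_pos by auto
  have DD: "1 \<le> D * D" using 1 by simp
  show "m * lg \<le> W" unfolding W_def using DD by (simp add: mult_le_mono)
  then show "m \<le> W" "lg \<le> W" using 1 by (auto intro: le_trans[rotated])
  show "m * T \<le> 6 * W" unfolding W_def T_def w0_def by simp
  have w: "w0 \<le> 6 * (D * D * lg)" unfolding w0_def using 1 by simp
  have T: "T = 6 * (D * D * lg)" by (simp add: T_def w0_def)
  have DW: "D * D * lg \<le> W" unfolding W_def using 1 by simp
  then show "w0 + T \<le> 12 * W" using w T by linarith
  show "m * D * lg \<le> W" unfolding W_def using 1 by simp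
  show "1 \<le> W" using \<open>m \<le> W\<close> 1 by linarith
  have DH: "D * D * lg \<le> H" unfolding H_def using 1 by simp
  show "lg * lg \<le> H" unfolding H_def using DD by simp
  then show "lg \<le> H" using 1 by (auto intro: le_trans[rotated])
  show "lg * T \<le> 6 * H" unfolding H_def T by simp
  show "w0 + T \<le> 12 * H" using w T DH by linarith
  show "1 \<le> H" using \<open>lg \<le> H\<close> 1 by linarith
qed

lemma runs_main_program:
  assumes r: "r ''n'' = n" "r ''m'' = m" and k: "D = min k (6 * N ^ 2)"
    and lgm: "\<And>k. k < lg \<Longrightarrow> 2 ^ k \<le> n" and qm: "\<And>k. k < q \<Longrightarrow> 2 ^ k \<le> m"
    and inp: "\<And>s i. s < 2 \<Longrightarrow> i < m \<Longrightarrow> a 32 (2 * i + s) = ep s i" "\<And>v. v < n \<Longrightarrow> a 32 (2 * m + v) = b v"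
      "\<And>r i. r < 32 \<Longrightarrow> a r i = 0"
    and post: "\<And>r' a' y \<Delta>. (\<And>e. e < m \<Longrightarrow> a' 32 (2 * m + n + e) = y e) \<Longrightarrow> fractional 1 y \<Longrightarrow>
       (\<And>U y. fractional U y \<Longrightarrow> sum y {..<m} \<le> U * \<Delta>) \<Longrightarrow> (D - 6) * \<Delta> \<le> D * sum y {..<m} \<Longrightarrow> Q r' a'"
    and t: "1000000 * W + 100 * k \<le> t" "1000000 * H + 100 * k \<le> d"
  shows "runs (main_program k) r a t d Q"
proof -
  note cf = cost_facts
  let ?side = "\<lambda>a1 s. \<forall>i<m. a1 s i = ep s i \<and> a1 (2 + s) i = b (ep s i)"
  let ?sides = "\<lambda>a1. \<forall>s<2. ?side a1 s"
  let ?tab = "\<lambda>a1. \<forall>k\<le>w0 + T. a1 12 k = decay Big D k"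
  \<comment> \<open>What the rounding must know about its input: a dual bound that limits its cost,
    and the promise that any rounding which keeps the value reaches the ratio.\<close>
  let ?good = "\<lambda>y pw. \<exists>k' \<Delta>. pw = (2 :: nat) ^ k' \<and> 2 ^ k' \<le> N ^ 15 \<and> fractional (2 ^ k') y \<and>
     (\<forall>U y. fractional U y \<longrightarrow> sum y {..<m} \<le> U * \<Delta>) \<and> 2 ^ k' * \<Delta> \<le> 12 * (m * D) \<and>
     (\<forall>S. sum y {..<m} \<le> 2 ^ k' * S \<longrightarrow> (D - 6) * \<Delta> \<le> D * S)"
  let ?best = "\<lambda>y. fractional 1 y \<and> (\<exists>\<Delta>. (\<forall>U y. fractional U y \<longrightarrow> sum y {..<m} \<le> U * \<Delta>) \<and> (D - 6) * \<Delta> \<le> D * sum y {..<m})"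
  have good: "?good (clip (2 ^ k') lev) (2 ^ k')" if inv: "invar T lev" and
    kk: "m * D * Big \<le> 2 ^ k' * max (clipped lev) 1" "k' = 0 \<or> 2 ^ k' * max (clipped lev) 1 \<le> 2 * (m * D * Big)" "2 ^ k' \<le> N ^ 15"
    for k' lev
  proof -
    obtain PA PB where dl: "(D - 5) * (Big * dual PA PB) \<le> D * clipped lev"
      using clipped_ge_dual[of lev] inv unfolding T_def by blast
    define \<Delta> where "\<Delta> = dual PA PB"
    \<comment> \<open>For the cost analysis a constant factor between dual and clipped value is
      enough, and D \<ge> 6 gives D \<le> 6 * (D - 5).\<close>
    have "D * (Big * \<Delta>) \<le> 6 * ((D - 5) * (Big * \<Delta>))" 
  proof -
    have "D \<le> 6 * (D - 5)" using D(1) by linarith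
    then have "D * (Big * \<Delta>) \<le> 6 * (D - 5) * (Big * \<Delta>)" by (rule mult_le_mono1)
    then show ?thesis by (simp only: mult.assoc)
  qed
    also have "\<dots> \<le> D * (6 * clipped lev)" using dl by (simp add: \<Delta>_def)
    finally have BD: "Big * \<Delta> \<le> 6 * clipped lev" using D(1) by simp
    \<comment> \<open>The dual bound in the initial unit is O(m * D) units; times the logarithm of
      pointer jumping this stays within \<open>W\<close>.\<close>
    have "Big * (2 ^ k' * \<Delta>) \<le> Big * (12 * (m * D))"
    proof (cases "k' = 0")
      case True
      have "Big * \<Delta> \<le> 6 * (m * Big)" using BD clipped_le[of lev] by linarith
      also have "\<dots> \<le> 12 * D * (m * Big)" using D(1) by (intro mult_le_mono1) simp
      finally show ?thesis using True by (simp add: ac_simps)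
    next
      case False
      have "Big * (2 ^ k' * \<Delta>) = 2 ^ k' * (Big * \<Delta>)" by simp
      also have "\<dots> \<le> 2 ^ k' * (6 * max (clipped lev) 1)" using BD by (intro mult_le_mono2) simp
      also have "\<dots> = 6 * (2 ^ k' * max (clipped lev) 1)" by simp
      also have "\<dots> \<le> 6 * (2 * (m * D * Big))" using kk(2) False by (intro mult_le_mono2) auto
      finally show ?thesis by (simp add: ac_simps)
    qed
    then have "2 ^ k' * \<Delta> \<le> 12 * (m * D)" using Big_pos by simp
    moreover have "(D - 6) * \<Delta> \<le> D * S" if "sum (clip (2 ^ k') lev) {..<m} \<le> 2 ^ k' * S" for S
      by (rule final_ratio[OF dl[folded \<Delta>_def] kk(1) clip_sum that])
    moreover have "fractional (2 ^ k') (clip (2 ^ k') lev)" by (rule clip_fractional[OF inv])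
    moreover have "sum y {..<m} \<le> U * \<Delta>" if "fractional U y" for U y
      unfolding \<Delta>_def by (rule weak_duality[OF that])
    ultimately show ?thesis using kk(3) by blast
  qed
  have inp0: "a 32 (2 * i) = ep 0 i" "a 32 (Suc (2 * i)) = ep (Suc 0) i" if "i < m" for i
    using inp(1)[of 0 i] inp(1)[of 1 i] that by simp_all
  have "10000 * (m * (lg + 1)) \<le> 20000 * W" using cf by simp
  then have sw: "10000 * m * (lg + 1) \<le> 20000 * W" by (simp only: mult.assoc)
  have "(q + 1) * (lg + 1) \<le> (4 * lg) * (2 * lg)" using q_le lg_pos by (intro mult_le_mono) auto
  then have "3000 * ((q + 1) * (lg + 1)) \<le> 24000 * H" using cf by simp
  then have sh: "3000 * (q + 1) * (lg + 1) \<le> 24000 * H" by (simp only: mult.assoc)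
  show ?thesis unfolding main_program_def
  proof (rule runs_Seq[where P = "\<lambda>r1 a1. a1 = a \<and> r1 ''n'' = n \<and> r1 ''m'' = m \<and> r1 ''N'' = N \<and> r1 ''l'' = lg \<and> r1 ''p'' = 2 ^ q" and ta = "1000 * W" and da = "1000 * H"
      and tb = "900000 * W + 100 * k" and db = "774000 * H + 100 * k"], goal_cases)
    case 1
    show ?case
      by (rule runs_setup_sizes[OF r _ lgm qm]) (use q_le cf in auto)
  next
    case A: (2 r1 a1)
    show ?case
    proof (rule runs_Seq[where P = "\<lambda>r1 a1. a1 = a \<and> env r1" and ta = "200 * W + 100 * k" and da = "200 * H + 100 * k"
      and tb = "899800 * W" and db = "773800 * H"], goal_cases)
      case 1
      show ?case
      using A by (intro runs_setup_params[OF _ _ _ _ _ k]) (use cf in auto)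
    next
      case A: (2 r1 a1)
      show ?case
      proof (rule runs_Seq[where P = "\<lambda>r1 a1. env r1 \<and> ?side a1 0 \<and> (\<forall>q. q \<notin> {0, 2} \<longrightarrow> a1 q = a q)" and ta = "400 * W" and da = "400 * H"
      and tb = "899400 * W" and db = "773400 * H"], goal_cases)
        case 1
        show ?case
    proof (rule runs_read_side[where s = 0], goal_cases)
      case (5 a') then show ?case using A by auto
    qed (use A inp0 inp(2) cf in auto)
      next
        case A: (2 r1 a1)
        show ?case
        proof (rule runs_Seq[where P = "\<lambda>r1 a1. env r1 \<and> ?sides a1 \<and> (\<forall>q. q \<notin> {0, 1, 2, 3} \<longrightarrow> a1 q = a q)" and ta = "400 * W" and da = "400 * H"
      and tb = "899000 * W" and db = "773000 * H"], goal_cases)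
          case 1
          show ?case
    proof (rule runs_read_side[where s = 1], goal_cases)
      case (5 a')
      have "?side a' 0" using A 5(2) by auto
      then have "?sides a'" using 5(1) by (auto simp: all_less_2 simp del: add_2_eq_Suc add_2_eq_Suc')
      then show ?case using A 5(2) by auto
    qed (use A inp0 inp(2) cf in auto)
        next
          case A: (2 r1 a1)
          show ?case
          proof (rule runs_Seq[where P = "\<lambda>r1 a1. env r1 \<and> ?sides a1 \<and> ?tab a1 \<and> heap_zero a1 \<and> (\<forall>v. a1 8 v = 0)" and ta = "6000 * W" and da = "6000 * H"
      and tb = "893000 * W" and db = "767000 * H"], goal_cases)
            case 1
            show ?case
    proof (rule runs_power_table, goal_cases)
      case (2 r' a')
      have "?sides a'" using A 2(3) by (auto simp: all_less_2 simp del: add_2_eq_Suc add_2_eq_Suc')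
      moreover have "heap_zero a'" "\<forall>v. a' 8 v = 0" using A 2(3) inp(3) by (auto simp: heap_zero_def)
      ultimately show ?case using 2 by auto
    qed (use A cf in auto)
          next
            case A: (2 r1 a1)
            show ?case
            proof (rule runs_Seq[where P = "\<lambda>r1 a1. env r1 \<and> ?sides a1 \<and> ?tab a1 \<and> heap_zero a1 \<and> (\<forall>v. a1 8 v = 0) \<and> ord_ok a1 0" and ta = "20000 * W" and da = "24000 * H"
      and tb = "873000 * W" and db = "743000 * H"], goal_cases)
              case 1
              show ?case
    proof (rule runs_sort_edges[where s = 0], goal_cases)
      case (7 r' a')
      have "env r'" using A 7(4) by (auto simp: env_def)
      moreover have "?sides a'" using A 7(3) by (auto simp: all_less_2 simp del: add_2_eq_Suc add_2_eq_Suc')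
      
      ultimately show ?case using A 7 by auto
    next
      case 8 show ?case using sw by simp
    next
      case 9 show ?case using sh by simp
    qed (use A in \<open>auto simp: env_def\<close>)
            next
              case A: (2 r1 a1)
              show ?case
              proof (rule runs_Seq[where P = "\<lambda>r1 a1. env r1 \<and> ?sides a1 \<and> ?tab a1 \<and> heap_zero a1 \<and> (\<forall>v. a1 8 v = 0) \<and> ord_ok a1 0 \<and> ord_ok a1 1" and ta = "20000 * W" and da = "24000 * H"
      and tb = "853000 * W" and db = "719000 * H"], goal_cases)
                case 1
                show ?case
    proof (rule runs_sort_edges[where s = 1], goal_cases)
      case (7 r' a')
      have "env r'" using A 7(4) by (auto simp: env_def)
      moreover have "?sides a'" using A 7(3) by (auto simp: all_less_2 simp del: add_2_eq_Suc add_2_eq_Suc')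
      moreover have "ord_ok a' 0" using A 7(3) by (simp add: ord_ok_def)
      ultimately show ?case using A 7 by auto
    next
      case 8 show ?case using sw by simp
    next
      case 9 show ?case using sh by simp
    qed (use A in \<open>auto simp: env_def\<close>)
              next
                case A: (2 r1 a1)
                show ?case
                proof (rule runs_Seq[where P = "\<lambda>r1 a1. env r1 \<and> ?sides a1 \<and> ?tab a1 \<and> heap_zero a1 \<and> (\<forall>v. a1 8 v = 0) \<and> ord_ok a1 0 \<and> ord_ok a1 1 \<and> seg_ok a1 0" and ta = "400 * W" and da = "400 * H"
      and tb = "852600 * W" and db = "718600 * H"], goal_cases)
                  case 1
                  show ?case
    proof (rule runs_find_segments[where s = 0], goal_cases)
      case (5 a')
      have "?sides a'" using A 5(3) by (auto simp: all_less_2 simp del: add_2_eq_Suc add_2_eq_Suc')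
      moreover have "ord_ok a' 0" "ord_ok a' 1" "heap_zero a'" using A 5(3) by (simp_all add: ord_ok_def heap_zero_def)
      ultimately show ?case using A 5 by auto
    qed (use A cf in \<open>auto simp: env_def\<close>)
                next
                  case A: (2 r1 a1)
                  show ?case
                  proof (rule runs_Seq[where P = "\<lambda>r1 a1. env r1 \<and> static a1 \<and> heap_zero a1 \<and> (\<forall>v. a1 8 v = 0)" and ta = "400 * W" and da = "400 * H"
      and tb = "852200 * W" and db = "718200 * H"], goal_cases)
                    case 1
                    show ?case
    proof (rule runs_find_segments[where s = 1], goal_cases)
      case (5 a')
      have "?sides a'" using A 5(3) by (auto simp: all_less_2 simp del: add_2_eq_Suc add_2_eq_Suc')
      moreover have "ord_ok a' 0" "ord_ok a' 1" "heap_zero a'" using A 5(3) by (simp_all add: ord_ok_def heap_zero_def)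
      moreover have "a' 6 v = a1 6 v" "a' 7 v = a1 7 v" if "v \<in> verts 0" for v
        using 5(2) verts_disjoint[OF that] by auto
      then have "seg_ok a' 0" using A 5(3) by (simp add: seg_ok_def)
      ultimately have "static a'" using A 5 by (auto simp: static_def all_less_2 simp del: add_2_eq_Suc add_2_eq_Suc')
      then show ?case using A 5(3) by (auto simp: heap_zero_def)
    qed (use A cf in \<open>auto simp: env_def\<close>)
                  next
                    case A: (2 r1 a1)
                    show ?case
                    proof (rule runs_Seq[where P = "\<lambda>r1 a1. env r1 \<and> static a1 \<and> heap_zero a1 \<and> (\<exists>lev. lev_ok a1 lev \<and> invar T lev)" and ta = "130000 * W" and da = "100000 * H"
      and tb = "722200 * W" and db = "618200 * H"], goal_cases)
                      case 1
                      show ?case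
    proof (rule runs_level_rounds, goal_cases)
      case (5 r' a' lev)
      then show ?case using A by (auto simp: env_def)
    next
      case 6 show ?case using cf by simp
    next
      case 7
      have "(q + 1) * T \<le> 4 * lg * T" using q_le by (rule mult_le_mono1)
      then have "(q + 1) * T \<le> 24 * H" using cf by simp
      then have "4000 * ((q + 1) * T) + 100 \<le> 100000 * H" using cf by linarith
      then show ?case by (simp only: mult.assoc)
    qed (use A in auto)
                    next
                      case A: (2 r1 a1)
                      show ?case
                      proof (rule runs_Seq[where P = "\<lambda>r1 a1. env r1 \<and> static a1 \<and> heap_zero a1 \<and> (\<exists>y. (\<forall>e<m. a1 13 e = y e) \<and> ?good y (r1 ''o''))" and ta = "22000 * W" and da = "18000 * H"
      and tb = "700200 * W" and db = "600200 * H"], goal_cases)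
                        case 1
                        show ?case
    proof -
      obtain lev where lev: "lev_ok a1 lev" "invar T lev" using A by blast
      show ?thesis
      proof (rule runs_finish_fractional[OF _ _ _ lev], goal_cases)
        case (4 k' r' a')
        have "?good (clip (2 ^ k') lev) (2 ^ k')" using good[OF lev(2) 4(1,2,3)] .
        then have "?good (clip (2 ^ k') lev) (r' ''o'')" using 4(4) by simp
        then show ?case using 4 by blast
      qed (use A cf q_le in auto)
    qed
                      next
                        case A: (2 r1 a1)
                        show ?case
                        proof (rule runs_Seq[where P = "\<lambda>r1 a1. env r1 \<and> (\<exists>y. (\<forall>e<m. a1 13 e = y e) \<and> ?best y)" and ta = "700000 * W" and da = "600000 * H"
      and tb = "200 * W" and db = "200 * H"], goal_cases)
                          case 1
                          show ?case
    proof -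
      obtain y where y: "\<forall>e<m. a1 13 e = y e" "?good y (r1 ''o'')" using A by blast
      then obtain k' \<Delta> where g: "r1 ''o'' = 2 ^ k'" "2 ^ k' \<le> N ^ 15" "fractional (2 ^ k') y"
        "\<And>U y. fractional U y \<Longrightarrow> sum y {..<m} \<le> U * \<Delta>" "2 ^ k' * \<Delta> \<le> 12 * (m * D)"
        "\<And>S. sum y {..<m} \<le> 2 ^ k' * S \<Longrightarrow> (D - 6) * \<Delta> \<le> D * S" by blast
      have kX: "2 ^ k' \<le> X" using g(2) by (rule le_X[rotated]) simp
      have "(2::nat) ^ k' \<le> 2 ^ (lg * 15)" using g(2) unfolding N by (simp only: power_mult)
      then have kl: "k' + 1 \<le> 16 * lg" using lg_pos by simp
      have "m * (k' + 1) \<le> m * (16 * lg)" using kl by (rule mult_le_mono2)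
      then have w1: "m * (k' + 1) \<le> 16 * W" using cf by simp
      have "(q + 1) * (2 ^ k' * \<Delta>) \<le> (4 * lg) * (12 * (m * D))" using q_le g(5) by (rule mult_le_mono)
      also have "\<dots> = 48 * (m * D * lg)" by simp
      also have "\<dots> \<le> 48 * W" using cf by (intro mult_le_mono2) blast
      finally have w2: "(q + 1) * (2 ^ k' * \<Delta>) \<le> 48 * W" .
      have "(q + 1) * (k' + 1) \<le> (4 * lg) * (16 * lg)" using q_le kl by (rule mult_le_mono)
      then have h1: "(q + 1) * (k' + 1) \<le> 64 * H" using cf by simp
      show ?thesis
      proof (rule runs_roundoff[where k = k' and y = y and \<Delta> = \<Delta>], goal_cases)
        case (9 a' r' y')
        then have "?best y'" using g(4) g(6)[OF 9(3)] by blast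
        then show ?case using 9 by blast
      next
        case 10
        have "31000 * (m * (k' + 1)) + 4000 * ((q + 1) * (2 ^ k' * \<Delta>)) \<le> 700000 * W" using w1 w2 by linarith
        then show ?case by (simp only: mult.assoc)
      next
        case 11
        have "9000 * ((q + 1) * (k' + 1)) \<le> 600000 * H" using h1 by linarith
        then show ?case by (simp only: mult.assoc)
      qed (use A y g kX in auto)
    qed
                        next
                          case A: (2 r1 a1)
                          show ?case
    proof -
      obtain y where y: "\<forall>e<m. a1 13 e = y e" "?best y" using A by blast
      show ?thesis
      proof (rule runs_write_output[where y = y], goal_cases)
        case (3 a')
        from y(2) obtain \<Delta> where "fractional 1 y" "\<And>U y. fractional U y \<Longrightarrow> sum y {..<m} \<le> U * \<Delta>"
          "(D - 6) * \<Delta> \<le> D * sum y {..<m}" by blast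
        then show ?case using 3 by (intro post[where y = y and \<Delta> = \<Delta>])
      qed (use A y cf in \<open>auto simp: fractional_def\<close>)
    qed
                        qed simp_all
                      qed simp_all
                    qed simp_all
                  qed simp_all
                qed simp_all
              qed simp_all
            qed simp_all
          qed simp_all
        qed simp_all
      qed simp_all
    qed simp_all
  qed (use t in simp_all)
qed

end

text \<open>For \<epsilon> \<ge> 1 or without edges the empty set qualifies, and the untouched
  output cells already denote it.\<close>

definition program :: "real \<Rightarrow> com" where
  "program \<epsilon> = (if \<epsilon> < 1
     then If (Reg ''m'') (Seq (Assign ''z'' (Reg ''m'' \<oplus> Reg ''m'' \<oplus> Reg ''m'' \<oplus> Reg ''n'')) (main_program (nat \<lceil>6 / \<epsilon>\<rceil>))) Skip
     else Skip)"

lemma ex_maximum_b_matching: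
  assumes "finite E"
  shows "\<exists>M. maximum_b_matching L R E b M"
proof -
  let ?S = "{M. b_matching L R E b M}"
  have "?S \<subseteq> Pow E" by (auto simp: b_matching_def)
  then have "finite ?S" using assms finite_subset by blast
  moreover have "{} \<in> ?S" by (simp add: b_matching_def)
  ultimately have "Max (card ` ?S) \<in> card ` ?S" by (intro Max_in) auto
  then obtain M where M: "M \<in> ?S" "card M = Max (card ` ?S)" by auto
  have "card M' \<le> card M" if "b_matching L R E b M'" for M'
    unfolding M(2) using \<open>finite ?S\<close> that by (intro Max_ge) auto
  with M(1) show ?thesis unfolding maximum_b_matching_def by blast
qed

lemma approx_ge_1:
  assumes "finite E" "1 \<le> \<epsilon>"
  shows "approx_maximum_b_matching \<epsilon> L R E b {}"
proof -
  obtain M where "maximum_b_matching L R E b M" using ex_maximum_b_matching[OF assms(1)] by blast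
  moreover have "(1 - \<epsilon>) * real (card M) \<le> 0" using assms(2) by (intro mult_nonpos_nonneg) auto
  ultimately show ?thesis unfolding approx_maximum_b_matching_def
    by (auto simp: b_matching_def)
qed

lemma approx_no_edges: "approx_maximum_b_matching \<epsilon> L R {} b {}"
proof -
  obtain M where M: "maximum_b_matching L R {} b M" using ex_maximum_b_matching by blast
  then have "M = {}" by (simp add: maximum_b_matching_def b_matching_def)
  with M show ?thesis unfolding approx_maximum_b_matching_def maximum_b_matching_def by auto
qed

lemma power_eq_powr_log: "0 < x \<Longrightarrow> x ^ k = 2 powr (real k * log 2 x)"
  by (subst mult.commute) (simp add: powr_powr[symmetric] powr_realpow)

lemma least_pow2:
  fixes x :: nat
  obtains k where "x < 2 ^ k" "\<And>j. j < k \<Longrightarrow> 2 ^ j \<le> x"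
proof
  show "x < 2 ^ (LEAST k. x < 2 ^ k)" by (rule LeastI[of _ x]) simp
  show "2 ^ j \<le> x" if "j < (LEAST k. x < 2 ^ k)" for j using not_less_Least[OF that] by simp
qed

section \<open>From edge lists to numbered edges, and from 0-1 solutions to b-matchings\<close>

definition endpoint :: "(nat \<times> nat) list \<Rightarrow> nat \<Rightarrow> nat \<Rightarrow> nat" where
  "endpoint es s i = (if s = 0 then fst (es ! i) else snd (es ! i))"

locale instance_data =
  fixes n :: nat and L R :: "nat set" and E :: "(nat \<times> nat) set" and b :: "nat \<Rightarrow> nat" and es :: "(nat \<times> nat) list"
  assumes graph: "bipartite_graph L R E" and vertices: "L \<union> R = {..<n}" and budget: "\<And>v. v \<in> L \<union> R \<Longrightarrow> b v \<le> card R"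
    and list: "distinct es" "set es = E"
begin

abbreviation m where "m \<equiv> length es"

text \<open>Budget 0 outside the vertex set makes the bound by n hold for all natural numbers, as
  the locale \<open>alg\<close> demands.\<close>

definition bud :: "nat \<Rightarrow> nat" where
  "bud v = (if v < n then b v else 0)"

lemma finE: "finite E" and LR: "finite L" "finite R" "L \<inter> R = {}" "E \<subseteq> L \<times> R"
  using graph unfolding bipartite_graph_def by (auto intro: finite_subset)

lemma card_E: "card E = m"
  using distinct_card[OF list(1)] list(2) by simp

lemma edge: "i < m \<Longrightarrow> fst (es ! i) \<in> L \<and> snd (es ! i) \<in> R"
  using nth_mem[of i es] list(2) LR(4) by (metis SigmaE2 prod.collapse subsetD)

lemma vertex_less: "v \<in> L \<Longrightarrow> v < n" "v \<in> R \<Longrightarrow> v < n"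
  using vertices by auto

lemma bud_le: "bud v \<le> n"
proof -
  have "card R \<le> n" using card_mono[of "{..<n}" R] vertices by auto
  then show ?thesis using budget[of v] vertices by (auto simp: bud_def intro: order_trans)
qed

sublocale edges m "endpoint es" bud
proof
  fix i j assume "i < m" "j < m"
  then show "endpoint es 0 i \<noteq> endpoint es 1 j"
    using edge[of i] edge[of j] LR(3) by (auto simp: endpoint_def)
qed

lemma m_less: "0 < m \<Longrightarrow> 1 < n \<and> m \<le> n * n"
proof -
  assume "0 < m"
  then have "fst (es ! 0) < n" "snd (es ! 0) < n" "fst (es ! 0) \<noteq> snd (es ! 0)"
    using edge[of 0] vertex_less LR(3) by auto
  moreover have "E \<subseteq> {..<n} \<times> {..<n}" using LR(4) vertex_less by auto
  then have "card E \<le> n * n" using card_mono[of "{..<n} \<times> {..<n}" E] by (simp add: card_cartesian_product)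
  ultimately show ?thesis using card_E by auto
qed

lemma inc_eq: "v \<in> L \<Longrightarrow> i < m \<Longrightarrow> incident v (es ! i) \<longleftrightarrow> i \<in> inc 0 v"
  "v \<in> R \<Longrightarrow> i < m \<Longrightarrow> incident v (es ! i) \<longleftrightarrow> i \<in> inc 1 v"
  using edge[of i] LR(3) by (auto simp: incident_def inc_def endpoint_def)

lemma inj_es: "inj_on ((!) es) {..<m}"
  using list(1) by (simp add: inj_on_nth)

text \<open>With unit 1 all values are 0 or 1, so a solution is the indicator of a set of positions;
  distinctness of the list transfers cardinalities to edges.\<close>

lemma b_matching_selected:
  assumes "fractional 1 y"
  shows "b_matching L R E b {es ! i | i. i < m \<and> y i \<noteq> 0}" "card {es ! i | i. i < m \<and> y i \<noteq> 0} = sum y {..<m}"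
proof -
  have y1: "y i \<le> 1" if "i < m" for i using assms that by (auto simp: fractional_def)
  let ?M = "{es ! i | i. i < m \<and> y i \<noteq> 0}"
  have cardI: "card ((!) es ` S) = card S" if "S \<subseteq> {..<m}" for S
    using card_image[OF inj_on_subset[OF inj_es that]] .
  have sumI: "sum y S = card {i \<in> S. y i \<noteq> 0}" if "S \<subseteq> {..<m}" for S
  proof -
    have "sum y S = (\<Sum>i\<in>S. of_bool (y i \<noteq> 0))"
    proof (rule sum.cong)
      fix i assume "i \<in> S"
      then have "y i \<le> 1" using y1 that by auto
      then show "y i = of_bool (y i \<noteq> 0)" by (cases "y i") auto
    qed simp
    moreover have "finite S" using that finite_subset by blast
    ultimately show ?thesis by (simp add: Int_def)
  qed
  have M: "?M = (!) es ` {i \<in> {..<m}. y i \<noteq> 0}" by auto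
  show "card ?M = sum y {..<m}" unfolding M sumI[OF order_refl] by (rule cardI) auto
  show "b_matching L R E b ?M" unfolding b_matching_def
  proof (intro conjI ballI)
    show "?M \<subseteq> E" using list(2) nth_mem by auto
    fix v assume v: "v \<in> L \<union> R"
    then obtain s where s: "s < 2" "\<And>i. i < m \<Longrightarrow> incident v (es ! i) \<longleftrightarrow> i \<in> inc s v"
      using inc_eq[of v] by (metis Un_iff one_less_numeral_iff pos2 semiring_norm(76))
    have sub: "inc s v \<subseteq> {..<m}" by (auto simp: inc_def)
    have "{e \<in> ?M. incident v e} = (!) es ` {i \<in> inc s v. y i \<noteq> 0}" using s(2) sub by auto
    then have "card {e \<in> ?M. incident v e} = load s y v"
      using cardI[of "{i \<in> inc s v. y i \<noteq> 0}"] sumI[OF sub] sub by (auto simp: load_def)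
    also have "\<dots> \<le> bud v" using assms s(1) by (auto simp: fractional_def)
    finally show "card {e \<in> ?M. incident v e} \<le> b v" using v vertices by (simp add: bud_def split: if_splits)
  qed
qed

text \<open>Makes weak duality applicable to a maximum b-matching, whose size is then bounded by the
  dual value.\<close>

lemma fractional_matching:
  assumes "b_matching L R E b M"
  shows "fractional 1 (\<lambda>i. of_bool (es ! i \<in> M))" "(\<Sum>i<m. of_bool (es ! i \<in> M)) = card M"
proof -
  have ME: "M \<subseteq> E" using assms by (simp add: b_matching_def)
  have finM: "finite M" using ME finE finite_subset by blast
  show "fractional 1 (\<lambda>i. of_bool (es ! i \<in> M))" unfolding fractional_def
  proof (intro conjI allI impI)
    fix s v :: nat assume s: "s < 2"
    show "load s (\<lambda>i. of_bool (es ! i \<in> M)) v \<le> bud v * 1"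
    proof (cases "inc s v = {}")
      case False
      then obtain j where j: "j < m" "endpoint es s j = v" by (auto simp: inc_def)
      then have v: "v \<in> L \<union> R" using edge[of j] by (auto simp: endpoint_def)
      have "load s (\<lambda>i. of_bool (es ! i \<in> M)) v = card {i \<in> inc s v. es ! i \<in> M}"
        by (simp add: load_def Int_def)
      also have "\<dots> \<le> card {e \<in> M. incident v e}"
      proof (rule card_inj_on_le[of "(!) es"])
        show "inj_on ((!) es) {i \<in> inc s v. es ! i \<in> M}"
          by (rule inj_on_subset[OF inj_es]) (auto simp: inc_def)
        show "(!) es ` {i \<in> inc s v. es ! i \<in> M} \<subseteq> {e \<in> M. incident v e}"
          by (auto simp: inc_def endpoint_def incident_def)
      qed (use finM in auto)
      also have "\<dots> \<le> b v" using assms v by (simp add: b_matching_def)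
      finally show ?thesis using v vertices by (simp add: bud_def)
    qed (simp add: load_def)
  qed simp
  have "M = (!) es ` {i. i < m \<and> es ! i \<in> M}"
  proof
    show "M \<subseteq> (!) es ` {i. i < m \<and> es ! i \<in> M}"
    proof
      fix e assume "e \<in> M"
      then have "e \<in> set es" using ME list(2) by auto
      then obtain i where "i < m" "es ! i = e" by (auto simp: in_set_conv_nth)
      then show "e \<in> (!) es ` {i. i < m \<and> es ! i \<in> M}" using \<open>e \<in> M\<close> by auto
    qed
  qed auto
  then have "card M = card {i. i < m \<and> es ! i \<in> M}"
    using card_image[OF inj_on_subset[OF inj_es, of "{i. i < m \<and> es ! i \<in> M}"]] by auto
  then show "(\<Sum>i<m. of_bool (es ! i \<in> M)) = card M" by (simp add: Int_def)
qed

lemma exec_program: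
  assumes w: "1601 * log 2 (real n + 2) \<le> real w" and \<epsilon>: "0 < \<epsilon>" "\<epsilon> < 1" and m: "0 < m"
  shows "\<exists>s' mem' A B work depth.
           exec w (program \<epsilon>) (input_regs n es) (input_mem n es b) s' mem' A B work depth \<and>
           approx_maximum_b_matching \<epsilon> L R E b (output_edges n es mem') \<and>
           real depth \<le> 10 ^ 9 * (log 2 (real n) ^ 3 / \<epsilon>\<^sup>2) \<and>
           real work \<le> 10 ^ 9 * (real m * log 2 (real n) / \<epsilon>\<^sup>2)"
proof -
  obtain lg where lg: "n < 2 ^ lg" "\<And>j. j < lg \<Longrightarrow> 2 ^ j \<le> n" using least_pow2 by blast
  obtain q where q: "m < 2 ^ q" "\<And>j. j < q \<Longrightarrow> 2 ^ j \<le> m" using least_pow2 by blast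
  have n: "1 < n" "m \<le> n * n" using m_less m by auto
  have lg0: "lg \<noteq> 0" using lg(1) n by (intro notI) simp
  have q0: "q \<noteq> 0" using q(1) m by (intro notI) simp
  define N where "N = (2::nat) ^ lg"
  define k where "k = nat \<lceil>6 / \<epsilon>\<rceil>"
  define D where "D = min k (6 * N ^ 2)"
  define z where "z = 3 * m + n"
  define X where "X = N ^ 20"
  have N2n: "N \<le> 2 * n" using lg(2)[of "lg - 1"] lg0 by (cases lg) (auto simp: N_def)
  have p2m: "2 ^ q \<le> 2 * m" using q(2)[of "q - 1"] q0 by (cases q) auto
  have nN: "n < N" using lg by (simp add: N_def)
  have mN: "m < N ^ 2"
  proof -
    have "n * n < N * N" using nN by (intro mult_strict_mono) auto
    then show ?thesis using n by (simp add: power2_eq_square)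
  qed
  have k6: "6 / \<epsilon> \<le> real k" "real k \<le> 7 / \<epsilon>"
  proof -
    have e: "0 \<le> 6 / \<epsilon>" using \<epsilon> by simp
    then show "6 / \<epsilon> \<le> real k" unfolding k_def by linarith
    have "real k \<le> 6 / \<epsilon> + 1" unfolding k_def using e by linarith
    also have "\<dots> \<le> 7 / \<epsilon>" using \<epsilon> by (simp add: field_simps)
    finally show "real k \<le> 7 / \<epsilon>" .
  qed
  have "6 < 6 / \<epsilon>" using \<epsilon> by (simp add: field_simps)
  then have k6': "6 \<le> k" using k6 by linarith
  have N1: "1 \<le> N" using nN by simp
  then have D6: "6 \<le> D" using k6' by (simp add: D_def)
  have X64: "64 \<le> X"
  proof -
    have "(2::nat) ^ 20 \<le> N ^ 20" using nN n by (intro power_mono) auto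
    then show ?thesis by (simp add: X_def)
  qed
  \<comment> \<open>X ^ 40 = N ^ 800 and N \<le> 2 * n \<le> (n + 2) ^ 2 give (n + 2) ^ 1600; one
    more power makes the bound strict, whence 1601.\<close>
  have Xw: "X ^ 40 < 2 ^ w"
  proof -
    have "2 * n \<le> (n + 2) ^ 2" by (simp add: power2_eq_square)
    then have "N ^ 800 \<le> ((n + 2) ^ 2) ^ 800" using N2n by (intro power_mono) auto
    also have "((n + 2) ^ 2) ^ 800 = (n + 2) ^ 1600" by (simp only: power_mult[symmetric]) simp
    finally have "X ^ 40 \<le> (n + 2) ^ 1600" unfolding X_def power_mult[symmetric] by simp
    also have "\<dots> < (n + 2) ^ 1601" by (intro power_strict_increasing) auto
    finally have "real (X ^ 40) < real ((n + 2) ^ 1601)" by (simp only: of_nat_less_iff)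
    also have "real ((n + 2) ^ 1601) = (real n + 2) ^ 1601" by (simp only: of_nat_power of_nat_add of_nat_numeral)
    also have "\<dots> = 2 powr (real 1601 * log 2 (real n + 2))" by (rule power_eq_powr_log) simp
    also have "real 1601 * log 2 (real n + 2) = 1601 * log 2 (real n + 2)" by (simp only: of_nat_numeral)
    also have "2 powr (1601 * log 2 (real n + 2)) \<le> 2 powr real w" using w by simp
    also have "\<dots> = real (2 ^ w)" by (simp add: powr_realpow)
    finally show ?thesis by (simp only: of_nat_less_iff)
  qed
  interpret alg w X z m "endpoint es" bud n q lg N D
  proof unfold_locales
    show "endpoint es s i < n" if "s < 2" "i < m" for s i
      using edge[OF that(2)] vertex_less by (simp add: endpoint_def)
  qed (use m q p2m mN nN n N2n bud_le D6 X64 Xw in \<open>auto simp: N_def X_def z_def D_def\<close>)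
  let ?s0 = "input_regs n es" and ?m0 = "input_mem n es b"
  let ?s1 = "?s0(''z'' := z)"
  have nX: "n \<le> X" "m \<le> X" "z \<le> X"
  proof -
    show "n \<le> X" by (rule n_X)
    show "m \<le> X" using m_X by simp
    have "z \<le> 4 * N ^ 2 + N ^ 2" using mN nN self_le_power[of N 2] N1 by (simp add: z_def)
    also have "\<dots> \<le> 5 * N ^ 2" by simp
    also have "\<dots> \<le> X" by (rule const_pow_X[of _ 2]) auto
    finally show "z \<le> X" .
  qed
  have s0: "?s0 x \<le> X" for x using nX by (simp add: input_regs_def)
  have bn: "b v \<le> n" if "v < n" for v using bud_le[of v] that by (simp add: bud_def)
  have m0: "?m0 c \<le> X" for c
  proof -
    have "fst (es ! i) \<le> n" "snd (es ! i) \<le> n" if "i < m" for i using edge[OF that] vertex_less by (auto intro: less_imp_le)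
    moreover have "c div 2 < m" if "c < 2 * m" using that by auto
    moreover have "b (c - 2 * m) \<le> n" if "\<not> c < 2 * m" "c < 2 * m + n" using bn[of "c - 2 * m"] that by simp
    ultimately have "?m0 c \<le> n" by (auto simp: input_mem_def)
    then show ?thesis using nX by simp
  qed
  have bd: "bounded ?s1 ?m0" using s0 m0 nX by (auto simp: bounded_def)
  have vin: "view z ?m0 32 (2 * i + s) = endpoint es s i" if "s < 2" "i < m" for s i
    using that by (auto simp: view_def adr_def input_mem_def endpoint_def z_def less_2_cases_iff)
  have vbud: "view z ?m0 32 (2 * m + v) = bud v" if "v < n" for v
    using that by (auto simp: view_def adr_def input_mem_def bud_def z_def)
  have vzero: "view z ?m0 r i = 0" if "r < 32" for r i
    using that by (auto simp: view_def adr_def input_mem_def z_def)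
  let ?Q = "\<lambda>r' a'. \<exists>y \<Delta>. (\<forall>e<m. a' 32 (2 * m + n + e) = y e) \<and> fractional 1 y \<and>
       (\<forall>U y. fractional U y \<longrightarrow> sum y {..<m} \<le> U * \<Delta>) \<and> (D - 6) * \<Delta> \<le> D * sum y {..<m}"
  have "runs (main_program k) ?s1 (view z ?m0) (1000000 * W + 100 * k) (1000000 * H + 100 * k) ?Q"
  proof (rule runs_main_program, goal_cases)
    case (9 r' a' y \<Delta>)
    then show ?case by blast
  qed (use lg q vin vbud vzero in \<open>auto simp: input_regs_def D_def\<close>)
  then obtain s' m' A B t d where ex: "exec w (main_program k) ?s1 ?m0 s' m' A B t d"
    and t: "t \<le> 1000000 * W + 100 * k" and d: "d \<le> 1000000 * H + 100 * k" and Q: "?Q s' (view z m')"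
    using bd unfolding runs_def by blast
  let ?e = "Reg ''m'' \<oplus> Reg ''m'' \<oplus> Reg ''m'' \<oplus> Reg ''n''"
  have ve: "val w ?e ?s0 = z"
    by (subst val_eq_aux[OF s0]) (simp_all add: input_regs_def z_def)
  have "exec w (Assign ''z'' ?e) ?s0 ?m0 ?s1 ?m0 {} {} 4 4"
    using exec_Assign[of w "''z''" ?e ?s0 ?m0] unfolding ve by (simp add: eval_nat_numeral)
  from exec_Seq[OF this ex] have "exec w (Seq (Assign ''z'' ?e) (main_program k)) ?s0 ?m0 s' m' A B (4 + t) (4 + d)" by simp
  then have "exec w (If (Reg ''m'') (Seq (Assign ''z'' ?e) (main_program k)) Skip) ?s0 ?m0 s' m' A B (1 + ops (Reg ''m'') + (4 + t)) (1 + ops (Reg ''m'') + (4 + d))"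
    using m by (intro exec_If_true) (auto simp: input_regs_def)
  then have run: "exec w (program \<epsilon>) ?s0 ?m0 s' m' A B (5 + t) (5 + d)"
    using \<epsilon> by (simp add: program_def k_def)
  obtain y \<Delta> where y: "\<forall>e<m. view z m' 32 (2 * m + n + e) = y e" "fractional 1 y"
    "\<And>U y. fractional U y \<Longrightarrow> sum y {..<m} \<le> U * \<Delta>" "(D - 6) * \<Delta> \<le> D * sum y {..<m}"
    using Q by blast
  have "m' (2 * m + n + e) = y e" if "e < m" for e
    using y(1) that by (auto simp: view_def adr_def z_def)
  then have out: "output_edges n es m' = {es ! i | i. i < m \<and> y i \<noteq> 0}" by (auto simp: output_edges_def)
  obtain M' where M': "maximum_b_matching L R E b M'" using ex_maximum_b_matching[OF finE] by blast
  then have M'b: "b_matching L R E b M'" by (simp add: maximum_b_matching_def)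
  let ?S = "sum y {..<m}"
  have cM: "card M' \<le> \<Delta>" using y(3)[OF fractional_matching(1)[OF M'b]] fractional_matching(2)[OF M'b] by simp
  have cMm: "card M' \<le> m"
    using card_mono[OF finE, of M'] M'b card_E by (simp add: b_matching_def)
  have "(D - 6) * card M' \<le> D * ?S" using cM y(4) by (meson le_trans mult_le_mono2)
  then have "real ((D - 6) * card M') \<le> real (D * ?S)" by (simp only: of_nat_le_iff)
  then have ratio: "(real D - 6) * real (card M') \<le> real D * real ?S" using D6 by (simp add: of_nat_diff)
  have approx: "(1 - \<epsilon>) * real (card M') \<le> real ?S"
  proof (cases "k \<le> 6 * N ^ 2")
    \<comment> \<open>Here D \<ge> 6 / \<epsilon>, so (D - 6) / D is at least 1 -
      \<epsilon>.\<close>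
    case True
    then have Dk: "D = k" by (simp add: D_def)
    have "6 \<le> \<epsilon> * real D" using k6(1) \<epsilon> by (simp add: Dk field_simps)
    then have "real D * (1 - \<epsilon>) \<le> real D - 6" by (simp add: algebra_simps)
    then have "real D * (1 - \<epsilon>) * real (card M') \<le> (real D - 6) * real (card M')" by (intro mult_right_mono) auto
    with ratio have "real D * ((1 - \<epsilon>) * real (card M')) \<le> real D * real ?S" by (simp add: ac_simps)
    then show ?thesis using D6 by simp
  next
    \<comment> \<open>At the cap the ratio is 1 - 1 / N ^ 2, while a maximum b-matching has at most
      m < N ^ 2 edges; the deficit is below one edge, so the result is optimal.\<close>
    case False
    then have Dk: "D = 6 * N ^ 2" by (simp add: D_def)
    have "real N ^ 2 * real (card M') - real (card M') \<le> real N ^ 2 * real ?S" using ratio by (simp add: Dk algebra_simps)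
    moreover have "real (card M') < real (N ^ 2)" using cMm mN by (simp only: of_nat_less_iff)
    then have "real (card M') < real N ^ 2" by (simp only: of_nat_power)
    ultimately have "real N ^ 2 * real (card M') < real N ^ 2 * real ?S + real N ^ 2" by linarith
    then have "real N ^ 2 * real (card M') < real N ^ 2 * (real ?S + 1)" by (simp only: distrib_left mult_1_right)
    then have "real (card M') < real ?S + 1" using N1 by simp
    then have "card M' \<le> ?S" by linarith
    then have "real (card M') \<le> real ?S" by (simp only: of_nat_le_iff)
    moreover have "(1 - \<epsilon>) * real (card M') \<le> 1 * real (card M')" using \<epsilon> by (intro mult_right_mono) auto
    ultimately show ?thesis by linarith
  qed
  have good: "approx_maximum_b_matching \<epsilon> L R E b (output_edges n es m')"
    unfolding approx_maximum_b_matching_def out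
    using b_matching_selected[OF y(2)] M' approx by auto
  define l where "l = log 2 (real n)"
  have l1: "1 \<le> l" using n by (simp add: l_def)
  have lgl: "real lg \<le> 2 * l"
  proof -
    have "2 ^ (lg - 1) \<le> n" using lg(2)[of "lg - 1"] lg0 by simp
    then have "real (2 ^ (lg - 1)) \<le> real n" by (simp only: of_nat_le_iff)
    then have "log 2 (2 ^ (lg - 1)) \<le> l" unfolding l_def using n by (intro log_mono) auto
    then have "real (lg - 1) \<le> l" by (simp add: log_nat_power)
    then show ?thesis using lg0 l1 by (simp add: of_nat_diff)
  qed
  have De: "real D \<le> 7 / \<epsilon>" 
  proof -
    have "real D \<le> real k" unfolding of_nat_le_iff by (simp add: D_def)
    then show ?thesis using k6(2) by linarith
  qed
  have DD: "real D * real D \<le> 49 / \<epsilon>\<^sup>2"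
    using mult_mono[OF De De] \<epsilon> by (simp add: power2_eq_square)
  have small: "7 / \<epsilon> \<le> 7 / \<epsilon>\<^sup>2" "1 \<le> 1 / \<epsilon>\<^sup>2"
    using \<epsilon> by (auto simp: field_simps power2_eq_square mult_le_one)
  have m1: "1 \<le> real m" using m by simp
  have work: "real (5 + t) \<le> 10 ^ 9 * (real m * l / \<epsilon>\<^sup>2)"
  proof -
    have ml: "1 \<le> real m * l" using m1 l1 mult_mono[of 1 "real m" 1 l] by simp
    have "real W = real m * (real D * real D * real lg)" by (simp add: W_def)
    also have "\<dots> \<le> real m * (49 / \<epsilon>\<^sup>2 * (2 * l))" using DD lgl by (intro mult_left_mono mult_mono) auto
    finally have W: "real W \<le> 98 * (real m * l / \<epsilon>\<^sup>2)" by (simp add: field_simps)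
    have "1 / \<epsilon>\<^sup>2 \<le> real m * l / \<epsilon>\<^sup>2" using ml \<epsilon> by (intro divide_right_mono) auto
    then have "real k \<le> 7 * (real m * l / \<epsilon>\<^sup>2)" "1 \<le> real m * l / \<epsilon>\<^sup>2" using k6(2) small by auto
    moreover have "real (5 + t) \<le> 5 + 1000000 * real W + 100 * real k" using t by linarith
    moreover have "x \<le> 10 ^ 9 * Z" if "x \<le> 5 + 1000000 * v + 100 * k'" "v \<le> 98 * Z" "k' \<le> 7 * Z" "1 \<le> Z"
      for x v k' Z :: real using that by simp
    ultimately show ?thesis using W by blast
  qed
  have depth: "real (5 + d) \<le> 10 ^ 9 * (l ^ 3 / \<epsilon>\<^sup>2)"
  proof -
    \<comment> \<open>The depth obtained has the square of the logarithm; l \<ge> 1 permits passing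
      to the cube.\<close>
    have l23: "l ^ 2 \<le> l ^ 3" "1 \<le> l ^ 3" using l1 by (auto intro: power_increasing one_le_power)
    have "real H = real D * real D * (real lg * real lg)" by (simp add: H_def)
    also have "\<dots> \<le> 49 / \<epsilon>\<^sup>2 * ((2 * l) * (2 * l))" using DD lgl l1 by (intro mult_mono) auto
    also have "\<dots> = 196 / \<epsilon>\<^sup>2 * l ^ 2" by (simp add: power2_eq_square)
    also have "\<dots> \<le> 196 / \<epsilon>\<^sup>2 * l ^ 3" using l23 by (intro mult_left_mono) auto
    finally have H: "real H \<le> 196 * (l ^ 3 / \<epsilon>\<^sup>2)" by simp
    have "1 / \<epsilon>\<^sup>2 \<le> l ^ 3 / \<epsilon>\<^sup>2" using l23 \<epsilon> by (intro divide_right_mono) auto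
    then have "real k \<le> 7 * (l ^ 3 / \<epsilon>\<^sup>2)" "1 \<le> l ^ 3 / \<epsilon>\<^sup>2" using k6(2) small by auto
    moreover have "real (5 + d) \<le> 5 + 1000000 * real H + 100 * real k" using d by linarith
    moreover have "x \<le> 10 ^ 9 * Z" if "x \<le> 5 + 1000000 * v + 100 * k'" "v \<le> 196 * Z" "k' \<le> 7 * Z" "1 \<le> Z"
      for x v k' Z :: real using that by simp
    ultimately show ?thesis using H by blast
  qed
  show ?thesis using run good work depth unfolding l_def by blast
qed

end

theorem theorem10:
  shows "\<exists>C > 0. \<forall>\<epsilon> > 0. \<exists>P. parallel_approx_b_matching_alg C \<epsilon> P"
proof (rule exI[of _ "10 ^ 9"], intro conjI allI impI)
  fix \<epsilon> :: real assume \<epsilon>: "0 < \<epsilon>"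
  show "\<exists>P. parallel_approx_b_matching_alg (10 ^ 9) \<epsilon> P"
    unfolding parallel_approx_b_matching_alg_def
  proof (rule exI[of _ "program \<epsilon>"], intro allI impI, elim conjE)
    fix w n L R E b and es :: "(nat \<times> nat) list"
    assume *: "bipartite_graph L R E" "L \<union> R = {..<n}" "card L \<le> card R" "\<forall>v\<in>L \<union> R. b v \<le> card R"
      "distinct es" "set es = E" "10 ^ 9 * log 2 (real n + 2) \<le> real w"
    interpret instance_data n L R E b es by unfold_locales (use * in auto)
    have zero: "output_edges n es (input_mem n es b) = {}"
      by (auto simp: output_edges_def input_mem_def)
    have pos: "1 \<le> 10 ^ 9 * max 1 x" for x :: real by (simp add: max_def)
    show "\<exists>s' mem' A B work depth.
           exec w (program \<epsilon>) (input_regs n es) (input_mem n es b) s' mem' A B work depth \<and>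
           approx_maximum_b_matching \<epsilon> L R E b (output_edges n es mem') \<and>
           real depth \<le> 10 ^ 9 * max 1 (log 2 (real n) ^ 3 / \<epsilon>\<^sup>2) \<and>
           real work \<le> 10 ^ 9 * max 1 (real (card E) * log 2 (real n) / \<epsilon>\<^sup>2)"
    proof -
      consider "1 \<le> \<epsilon>" | "\<epsilon> < 1" "m = 0" | "\<epsilon> < 1" "0 < m" by force
      then show ?thesis
      proof cases
        case 1
        have "exec w (program \<epsilon>) (input_regs n es) (input_mem n es b) (input_regs n es) (input_mem n es b) {} {} 0 0"
          using 1 exec_Skip by (simp add: program_def)
        moreover have "approx_maximum_b_matching \<epsilon> L R E b (output_edges n es (input_mem n es b))"
          unfolding zero by (rule approx_ge_1[OF finE 1])
        moreover have "real 0 \<le> 10 ^ 9 * max 1 x" for x :: real using pos[of x] by simp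
        ultimately show ?thesis by blast
      next
        case 2
        then have "exec w (program \<epsilon>) (input_regs n es) (input_mem n es b) (input_regs n es) (input_mem n es b) {} {}
            (1 + ops (Reg ''m'') + 0) (1 + ops (Reg ''m'') + 0)"
          unfolding program_def by (simp only: if_True) (intro exec_If_false exec_Skip, simp add: input_regs_def)
        moreover have "E = {}" using 2 list(2) by simp
        then have "approx_maximum_b_matching \<epsilon> L R E b (output_edges n es (input_mem n es b))"
          unfolding zero using approx_no_edges by simp
        moreover have "real (1 + ops (Reg ''m'') + 0) \<le> 10 ^ 9 * max 1 x" for x :: real using pos[of x] by simp
        ultimately show ?thesis by blast
      next
        case 3
        have "1601 * log 2 (real n + 2) \<le> 10 ^ 9 * log 2 (real n + 2)"
          by (intro mult_right_mono) auto
        then have "1601 * log 2 (real n + 2) \<le> real w" using *(7) by linarith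
        from exec_program[OF this \<epsilon> 3] obtain s' mem' A B work depth where
          r: "exec w (program \<epsilon>) (input_regs n es) (input_mem n es b) s' mem' A B work depth"
             "approx_maximum_b_matching \<epsilon> L R E b (output_edges n es mem')"
             "real depth \<le> 10 ^ 9 * (log 2 (real n) ^ 3 / \<epsilon>\<^sup>2)"
             "real work \<le> 10 ^ 9 * (real m * log 2 (real n) / \<epsilon>\<^sup>2)" by blast
        have mx: "x \<le> 10 ^ 9 * max 1 v" if "x \<le> 10 ^ 9 * v" for x v :: real
          using that by (rule order_trans) (intro mult_left_mono, auto)
        show ?thesis using r(1,2) mx[OF r(3)] mx[OF r(4)] unfolding card_E by blast
      qed
    qed
  qed
qed simp

end
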